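(* Let $H$ be a complex Hilbert space. Every unital contractive homomorphism $\pi:\mathcal A(\mathcal V)\to B(H)$ is completely contractive.
   Context: $\mathcal V=\{(z,w)\in\mathbb D^2: z^2=w^2\}$, where $\mathbb D$ is the open unit disk in $\mathbb C$. Its boundary $\partial\mathcal V$ consists of the two disjoint circles $\{z=w,\ |z|=|w|=1\}$ and $\{z=-w,\ |z|=|w|=1\}$. A scalar or matrix valued function $F$ on $\mathcal V$ is holomorphic if for each point of $\mathcal V$ there is a neighborhood $\Omega$ of this point in $\mathbb C^2$ such that $F$ extends to be holomorphic in $\Omega$. $\mathcal A(\mathcal V)$ is the algebra of scalar functions holomorphic on $\mathcal V$ and continuous on $\mathcal V\cup\partial\mathcal V$, with the supremum norm. A homomorphism $\pi:\mathcal A(\mathcal V)\to B(H)$ is contractive if $\|\pi(f)\|\le\|f\|$ for all $f$, and completely contractive if for every $n$ and every $F=(f_{j,\ell})\in M_n(\mathcal A(\mathcal V))$ one has $\|(\pi(f_{j,\ell}))_{j,\ell}\|\le\sup_{p\in\mathcal V}\|F(p)\|$, with operator norms of matrices on the right. *)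

theory Defs
  imports "HOL-Analysis.Analysis"
begin

section \<open>Complex Hilbert spaces\<close>

text \<open>
  A complex Hilbert space is a real Hilbert space together with a complex scalar multiplication
  extending the real one and a sesquilinear Hermitian form (linear in the first argument) whose
  real part is the real inner product. Positivity, completeness and
  \<open>norm x = sqrt (Re (cinner x x))\<close> are inherited from the real structure.
\<close>

class chilbert_space = real_inner + banach +
  fixes scaleC :: "complex \<Rightarrow> 'a \<Rightarrow> 'a"
    and cinner :: "'a \<Rightarrow> 'a \<Rightarrow> complex"
  assumes scaleC_add_right: "scaleC a (x + y) = scaleC a x + scaleC a y"
    and scaleC_add_left: "scaleC (a + b) x = scaleC a x + scaleC b x"
    and scaleC_scaleC: "scaleC a (scaleC b x) = scaleC (a * b) x"
    and scaleR_scaleC: "scaleR r x = scaleC (complex_of_real r) x"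
    and cinner_commute: "cinner x y = cnj (cinner y x)"
    and cinner_add_left: "cinner (x + y) z = cinner x z + cinner y z"
    and cinner_scaleC_left: "cinner (scaleC a x) y = a * cinner x y"
    and inner_eq_Re_cinner: "inner x y = Re (cinner x y)"

lemma norm_eq_sqrt_cinner: "norm (x::'a::chilbert_space) = sqrt (Re (cinner x x))"
  by (simp add: norm_eq_sqrt_inner inner_eq_Re_cinner)

instantiation complex :: chilbert_space
begin

definition scaleC_complex :: "complex \<Rightarrow> complex \<Rightarrow> complex"
  where "scaleC_complex a x = a * x"

definition cinner_complex :: "complex \<Rightarrow> complex \<Rightarrow> complex"
  where "cinner_complex x y = x * cnj y"

instance
  by standard
    (simp_all add: scaleC_complex_def cinner_complex_def algebra_simps scaleR_conv_of_real
      inner_complex_def)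

end

text \<open>\<open>B(H)\<close>: the bounded complex-linear operators, inside the real-linear ones; the library norm
  on \<open>\<Rightarrow>\<^sub>L\<close> is the operator norm.\<close>

definition bounded_ops :: "('h::chilbert_space \<Rightarrow>\<^sub>L 'h) set"
  where "bounded_ops =
    {T. \<forall>c x. blinfun_apply T (scaleC c x) = scaleC c (blinfun_apply T x)}"

text \<open>
  The norm of an \<open>n \<times> n\<close> matrix of bounded operators on a normed space, acting on the
  \<open>n\<close>-fold Hilbert (\<open>\<ell>\<^sup>2\<close>) direct sum of that space.
\<close>

definition opmat_norm :: "nat \<Rightarrow> (nat \<Rightarrow> nat \<Rightarrow> 'a::real_normed_vector \<Rightarrow> 'a) \<Rightarrow> real"
  where "opmat_norm n T =
    (SUP h \<in> {h. L2_set (\<lambda>l. norm (h l)) {..<n} \<le> 1}.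
       L2_set (\<lambda>j. norm (\<Sum>l<n. T j l (h l))) {..<n})"

section \<open>The variety and its function algebra\<close>

definition V :: "(complex \<times> complex) set"
  where "V = {(z, w). norm z < 1 \<and> norm w < 1 \<and> z\<^sup>2 = w\<^sup>2}"

definition bdV :: "(complex \<times> complex) set"
  where "bdV = {(z, w). z = w \<and> norm z = 1 \<and> norm w = 1} \<union>
               {(z, w). z = - w \<and> norm z = 1 \<and> norm w = 1}"

text \<open>Holomorphy on an open subset of \<open>\<complex>\<^sup>2\<close>: the Frechet derivative exists and is complex-linear.\<close>

definition holomorphic2_on :: "(complex \<times> complex \<Rightarrow> complex) \<Rightarrow> (complex \<times> complex) set \<Rightarrow> bool"
  where "holomorphic2_on G \<Omega> \<longleftrightarrow>
    (\<forall>q\<in>\<Omega>. \<exists>a b. (G has_derivative (\<lambda>(h, k). a * h + b * k)) (at q))"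

definition holomorphic_on_V :: "(complex \<times> complex \<Rightarrow> complex) \<Rightarrow> bool"
  where "holomorphic_on_V f \<longleftrightarrow>
    (\<forall>p\<in>V. \<exists>\<Omega> G. open \<Omega> \<and> p \<in> \<Omega> \<and> holomorphic2_on G \<Omega> \<and> (\<forall>q\<in>\<Omega> \<inter> V. G q = f q))"

text \<open>
  Elements of the algebra are represented by total functions whose values off
  \<open>V \<union> bdV\<close> are irrelevant; \<open>unital_hom\<close> below requires maps on the algebra to respect this.
\<close>

definition A_V :: "(complex \<times> complex \<Rightarrow> complex) set"
  where "A_V = {f. holomorphic_on_V f \<and> continuous_on (V \<union> bdV) f}"

definition norm_A_V :: "(complex \<times> complex \<Rightarrow> complex) \<Rightarrow> real"
  where "norm_A_V f = (SUP p \<in> V \<union> bdV. norm (f p))"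

section \<open>Homomorphisms into \<open>B(H)\<close>\<close>

definition unital_hom ::
    "((complex \<times> complex \<Rightarrow> complex) \<Rightarrow> ('h::chilbert_space \<Rightarrow>\<^sub>L 'h)) \<Rightarrow> bool"
  where "unital_hom \<pi> \<longleftrightarrow>
    (\<forall>f\<in>A_V. \<pi> f \<in> bounded_ops) \<and>
    (\<forall>f\<in>A_V. \<forall>g\<in>A_V. (\<forall>p\<in>V \<union> bdV. f p = g p) \<longrightarrow> \<pi> f = \<pi> g) \<and>
    (\<forall>f\<in>A_V. \<forall>g\<in>A_V. \<pi> (\<lambda>p. f p + g p) = \<pi> f + \<pi> g) \<and>
    (\<forall>c. \<forall>f\<in>A_V. \<forall>x. blinfun_apply (\<pi> (\<lambda>p. c * f p)) x = scaleC c (blinfun_apply (\<pi> f) x)) \<and>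
    (\<forall>f\<in>A_V. \<forall>g\<in>A_V. \<pi> (\<lambda>p. f p * g p) = \<pi> f o\<^sub>L \<pi> g) \<and>
    \<pi> (\<lambda>p. 1) = id_blinfun"

definition contractive ::
    "((complex \<times> complex \<Rightarrow> complex) \<Rightarrow> ('h::chilbert_space \<Rightarrow>\<^sub>L 'h)) \<Rightarrow> bool"
  where "contractive \<pi> \<longleftrightarrow> (\<forall>f\<in>A_V. norm (\<pi> f) \<le> norm_A_V f)"

definition completely_contractive ::
    "((complex \<times> complex \<Rightarrow> complex) \<Rightarrow> ('h::chilbert_space \<Rightarrow>\<^sub>L 'h)) \<Rightarrow> bool"
  where "completely_contractive \<pi> \<longleftrightarrow>
    (\<forall>n\<ge>1. \<forall>F :: nat \<Rightarrow> nat \<Rightarrow> complex \<times> complex \<Rightarrow> complex.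
       (\<forall>j<n. \<forall>l<n. F j l \<in> A_V) \<longrightarrow>
         opmat_norm n (\<lambda>j l. blinfun_apply (\<pi> (F j l)))
           \<le> (SUP p\<in>V. opmat_norm n (\<lambda>j l v. F j l p * v)))"

end

theory Submission
  imports Defs "HOL-Complex_Analysis.Cauchy_Integral_Formula"
begin

text \<open>
  On the variety \<open>w = z\<close> or \<open>w = - z\<close>, so an element of the algebra is a pair of disc algebra functions
  \<open>f, g\<close>, its restrictions to the two sheets, with \<open>f 0 = g 0\<close>. The functions \<open>(z + w) / 2\<close> and \<open>(z - w) / 2\<close>
  have product zero and generate the algebra. If \<open>A\<close> and \<open>B\<close> are their images, then \<open>A B = B A = 0\<close>, and the
  pair \<open>f, g\<close> is mapped to \<open>f(A) + g(B) - f(0)\<close>. For unimodular \<open>\<omega>\<close> the function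
  \<open>(z + w) / 2 + \<omega> (z - w) / 2\<close> has norm 1, whence \<open>\<parallel>A + \<omega> B\<parallel> \<le> 1\<close>. Two ideas lead
  from these scalar inequalities to matrices.

  The first one separates \<open>A\<close> from \<open>B\<close> (\<open>splitting_forms\<close>). The inequalities say that the operator
  trigonometric polynomial \<open>\<parallel>u\<parallel>\<^sup>2 + \<parallel>v\<parallel>\<^sup>2 - 2 Re \<langle>(A + \<omega> B) u, v\<rangle>\<close> of degree 1 in \<open>\<omega>\<close> is nonnegative. As in the
  Fejer-Riesz theorem, minimizing the associated Toeplitz form yields quadratic forms \<open>q + r = p + s = \<parallel>\<cdot>\<parallel>\<^sup>2\<close>,
  all positive, with \<open>\<bar>\<langle>A u, v\<rangle>\<bar>\<^sup>2 \<le> q u p v\<close> and \<open>\<bar>\<langle>B u, v\<rangle>\<bar>\<^sup>2 \<le> r u s v\<close>. Consequently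
  \<open>Z \<otimes> A + W \<otimes> B\<close> is a contraction for any two unitaries \<open>Z\<close> and \<open>W\<close>, commuting or not: the forms do not
  see the unitaries.

  The second one replaces contractive by positive matrix functions, with the block matrix of rows
  \<open>(1, F)\<close> and \<open>(F\<^sup>*, 1)\<close>. On the two sheets these are positive densities with the same mean \<open>M\<close>. The two
  \<open>L\<^sup>2\<close> spaces which they define contain the same constants, so they can be amalgamated, and multiplication by
  the coordinate on each of them extends to unitaries \<open>Z\<close> and \<open>W\<close> of the amalgam. Because of \<open>A B = B A = 0\<close>
  the vector \<open>x = (1 - Z \<otimes> A - W \<otimes> B)\<^sup>-\<^sup>1 h\<close> splits as \<open>h\<close> plus one contribution from each sheet. The inequality
  \<open>\<parallel>x\<parallel>\<^sup>2 \<ge> \<parallel>x - h\<parallel>\<^sup>2\<close> turns out to be exactly the positivity of the image of the block matrix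
  (\<open>two_field_positivity\<close>).

  To keep the scalar spaces finite-dimensional, the circle is replaced by the \<open>N\<close>-th roots of unity. For matrix
  polynomials the limit \<open>N \<rightarrow> \<infinity>\<close> gives contractivity of the functional calculus
  (\<open>pair_calculus_contraction\<close>), and polynomials are dense in the algebra (\<open>A_V_polynomial_approx\<close>).
\<close>

section \<open>Complex Hilbert spaces and Hermitian pairings\<close>

lemma scaleC_one [simp]: "scaleC 1 (x::'h::chilbert_space) = x"
  using scaleR_scaleC[of 1 x] by simp

lemma scaleC_zero_left [simp]: "scaleC 0 (x::'h::chilbert_space) = 0"
  using scaleR_scaleC[of 0 x] by simp

lemma scaleC_zero_right [simp]: "scaleC c (0::'h::chilbert_space) = 0"
  using scaleC_add_right[of c 0 "0::'h"] by simp

lemma scaleC_minus_right: "scaleC c (- x) = - scaleC c (x::'h::chilbert_space)"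
  using scaleC_add_right[of c x "- x"] by (simp add: eq_neg_iff_add_eq_0 add.commute)

lemma scaleC_diff_right: "scaleC c (x - y) = scaleC c x - scaleC c (y::'h::chilbert_space)"
  using scaleC_add_right[of c x "- y"] by (simp add: scaleC_minus_right)

lemma scaleC_minus_left: "scaleC (- c) x = - scaleC c (x::'h::chilbert_space)"
  using scaleC_add_left[of c "- c" x] by (simp add: eq_neg_iff_add_eq_0 add.commute)

lemma scaleC_sum_right: "scaleC c (\<Sum>i\<in>S. f i) = (\<Sum>i\<in>S. scaleC c (f i :: 'h::chilbert_space))"
  by (induction S rule: infinite_finite_induct) (auto simp: scaleC_add_right)

lemma scaleC_sum_left: "scaleC (\<Sum>i\<in>S. f i) x = (\<Sum>i\<in>S. scaleC (f i) (x :: 'h::chilbert_space))"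
  by (induction S rule: infinite_finite_induct) (auto simp: scaleC_add_left)

lemma cinner_scaleC_right: "cinner x (scaleC c y) = cnj c * cinner x (y::'h::chilbert_space)"
  by (metis cinner_commute cinner_scaleC_left complex_cnj_mult)

lemma inner_scaleC_left: "inner (scaleC c x) y = inner x (scaleC (cnj c) (y::'h::chilbert_space))"
  by (simp add: inner_eq_Re_cinner cinner_scaleC_left cinner_scaleC_right)

lemma norm_scaleC: "norm (scaleC c x) = cmod c * norm (x::'h::chilbert_space)"
proof -
  have "(norm (scaleC c x))\<^sup>2 = inner x (scaleC (cnj c * c) x)"
    by (simp add: power2_norm_eq_inner inner_scaleC_left scaleC_scaleC)
  also have "cnj c * c = complex_of_real ((cmod c)\<^sup>2)"
    using complex_norm_square[of c] by (simp add: mult.commute)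
  also have "inner x (scaleC (complex_of_real ((cmod c)\<^sup>2)) x) = (cmod c * norm x)\<^sup>2"
    by (simp add: power2_norm_eq_inner power_mult_distrib flip: scaleR_scaleC)
  finally show ?thesis by simp
qed

definition clin :: "('h::chilbert_space \<Rightarrow> 'h) \<Rightarrow> bool"
  where "clin A \<longleftrightarrow> (\<forall>x y. A (x + y) = A x + A y) \<and> (\<forall>c x. A (scaleC c x) = scaleC c (A x))"

lemma clin_add: "clin A \<Longrightarrow> A (x + y) = A x + A y"
  and clin_scaleC: "clin A \<Longrightarrow> A (scaleC c x) = scaleC c (A x)"
  by (auto simp: clin_def)

lemma clin_zero: "clin A \<Longrightarrow> A 0 = 0"
  using clin_scaleC[of A 0 0] by simp

lemma clin_sum: "clin A \<Longrightarrow> A (\<Sum>i\<in>S. f i) = (\<Sum>i\<in>S. A (f i))"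
  by (induction S rule: infinite_finite_induct) (auto simp: clin_add clin_zero)

lemma clin_minus: "clin A \<Longrightarrow> A (- x) = - A x"
  using clin_add[of A x "- x"] by (simp add: clin_zero eq_neg_iff_add_eq_0 add.commute)

lemma clin_diff: "clin A \<Longrightarrow> A (x - y) = A x - A y"
  using clin_add[of A x "- y"] by (simp add: clin_minus)

text \<open>
  A pairing is the real part of a sesquilinear form: like the inner product, it moves a complex
  scalar to the other argument as its conjugate. Working with real parts keeps all the inequalities
  real.
\<close>

definition pairing :: "('h::chilbert_space \<Rightarrow> 'h \<Rightarrow> real) \<Rightarrow> bool"
  where "pairing b \<longleftrightarrow> (\<forall>u u' v. b (u + u') v = b u v + b u' v) \<and>
    (\<forall>u v v'. b u (v + v') = b u v + b u v') \<and>
    (\<forall>c u v. b (scaleC c u) v = b u (scaleC (cnj c) v))"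

lemma pairing_add_left: "pairing b \<Longrightarrow> b (u + u') v = b u v + b u' v"
  and pairing_add_right: "pairing b \<Longrightarrow> b u (v + v') = b u v + b u v'"
  and pairing_scaleC: "pairing b \<Longrightarrow> b (scaleC c u) v = b u (scaleC (cnj c) v)"
  by (auto simp: pairing_def)

lemma pairing_zero_left: "pairing b \<Longrightarrow> b 0 v = 0"
  using pairing_add_left[of b 0 0 v] by simp

lemma pairing_zero_right: "pairing b \<Longrightarrow> b u 0 = 0"
  using pairing_add_right[of b u 0 0] by simp

lemma pairing_sum_left: "pairing b \<Longrightarrow> b (\<Sum>i\<in>S. f i) v = (\<Sum>i\<in>S. b (f i) v)"
  by (induction S rule: infinite_finite_induct) (auto simp: pairing_add_left pairing_zero_left)

lemma pairing_sum_right: "pairing b \<Longrightarrow> b u (\<Sum>i\<in>S. f i) = (\<Sum>i\<in>S. b u (f i))"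
  by (induction S rule: infinite_finite_induct) (auto simp: pairing_add_right pairing_zero_right)

lemma pairing_diff_left: "pairing b \<Longrightarrow> b (u - u') v = b u v - b u' v"
  using pairing_add_left[of b "u - u'" u' v] by simp

lemma pairing_diff_right: "pairing b \<Longrightarrow> b u (v - v') = b u v - b u v'"
  using pairing_add_right[of b u "v - v'" v'] by simp

lemma pairing_inner: "pairing (inner :: 'h::chilbert_space \<Rightarrow> 'h \<Rightarrow> real)"
  by (simp add: pairing_def inner_add_left inner_add_right inner_scaleC_left)

lemma pairing_minus: "pairing b \<Longrightarrow> pairing c \<Longrightarrow> pairing (\<lambda>u v. b u v - c u v)"
  by (simp add: pairing_def)

section \<open>Quadratic forms from the parallelogram law\<close>

text \<open>
  With modulus \<open>2 cos t\<close>, a complex number is the sum of its direction turned by \<open>t\<close> and by \<open>- t\<close>.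
  Hence every complex number is a finite sum of unimodular ones, which is how additivity and
  invariance under unimodular scalars give behaviour under all scalars, without any continuity.
\<close>

lemma complex_sum_of_two_units:
  assumes "cmod c \<le> 2"
  obtains a b where "cmod a = 1" "cmod b = 1" "c = a + b"
proof -
  define t where "t = arccos (cmod c / 2)"
  have t: "cos t = cmod c / 2"
    unfolding t_def using assms by (intro cos_arccos) (auto intro: order_trans[of _ 0])
  have "c = of_real (cmod c) * cis (Arg c)"
    by (metis rcis_cmod_Arg rcis_def)
  also have "complex_of_real (cmod c) = cis t + cis (- t)"
    using t by (simp add: complex_eq_iff)
  finally have "c = cis t * cis (Arg c) + cis (- t) * cis (Arg c)"
    by (simp add: distrib_right)
  then show ?thesis
    using that[of "cis t * cis (Arg c)" "cis (- t) * cis (Arg c)"] by (simp add: norm_mult)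
qed

definition quadratic :: "('h::chilbert_space \<Rightarrow> real) \<Rightarrow> bool"
  where "quadratic Q \<longleftrightarrow> (\<forall>u v. Q (u + v) + Q (u - v) = 2 * Q u + 2 * Q v) \<and>
    (\<forall>c u. cmod c = 1 \<longrightarrow> Q (scaleC c u) = Q u)"

definition polar :: "('h::chilbert_space \<Rightarrow> real) \<Rightarrow> 'h \<Rightarrow> 'h \<Rightarrow> real"
  where "polar Q u v = (Q (u + v) - Q (u - v)) / 4"

text \<open>
  The Jordan-von Neumann argument. The parallelogram law makes the polarization additive;
  a unimodular \<open>c\<close> moves to the other argument because \<open>Q\<close> is invariant under \<open>c\<close>, and a general
  scalar is a finite sum of unimodular ones.
\<close>

lemma quadratic_polar:
  assumes Q: "quadratic Q"
  shows "pairing (polar Q)" "\<And>u v. polar Q u v = polar Q v u" "\<And>u. polar Q u u = Q u"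
proof -
  have par: "Q (u + v) + Q (u - v) = 2 * Q u + 2 * Q v" for u v
    using Q by (auto simp: quadratic_def)
  have uni: "Q (scaleC c u) = Q u" if "cmod c = 1" for c u
    using Q that by (auto simp: quadratic_def)
  have Q0: "Q 0 = 0"
    using par[of 0 0] by simp
  have even: "Q (- u) = Q u" for u
    using uni[of "-1" u] by (simp add: scaleC_minus_left)
  show sym: "polar Q u v = polar Q v u" for u v
    using even[of "u - v"] by (simp add: polar_def add.commute)
  show "polar Q u u = Q u" for u
    using par[of u u] by (simp add: polar_def Q0)
  have mid: "polar Q (u + w) v + polar Q (u - w) v = 2 * polar Q u v" for u w v
  proof -
    have eq: "u + v + w = u + w + v" "u + v - w = u - w + v" "u - v + w = u + w - v"
      "u - v - w = u - w - v"
      by simp_all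
    have arith: "a + b = 2 * c + 2 * d \<Longrightarrow> e + f = 2 * g + 2 * d \<Longrightarrow>
        (a - e) / 4 + (b - f) / 4 = 2 * ((c - g) / 4)" for a b c d e f g :: real
      by (simp add: field_simps)
    show ?thesis
      using par[of "u + v" w] par[of "u - v" w] unfolding eq polar_def by (rule arith)
  qed
  have zero: "polar Q 0 v = 0" for v
    by (simp add: polar_def even)
  have dbl: "polar Q (u + u) v = 2 * polar Q u v" for u v
    using mid[of u u v] by (simp add: zero)
  have addl: "polar Q (x + y) v = polar Q x v + polar Q y v" for x y v
  proof -
    define x' y' where "x' = (1/2) *\<^sub>R x" and "y' = (1/2) *\<^sub>R y"
    have "x = x' + x'" "y = y' + y'"
      by (simp_all add: x'_def y'_def flip: scaleR_add_left)
    then show ?thesis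
      using mid[of "x' + y'" "x' - y'" v] dbl[of "x' + y'" v] by (simp add: algebra_simps)
  qed
  have addr: "polar Q v (x + y) = polar Q v x + polar Q v y" for x y v
    using addl[of x y v] sym by metis
  have unit: "polar Q (scaleC c u) v = polar Q u (scaleC (cnj c) v)" if c: "cmod c = 1" for c u v
  proof -
    have "c * cnj c = 1"
      using complex_norm_square[of c] c by simp
    then have "scaleC c u + v = scaleC c (u + scaleC (cnj c) v)"
      "scaleC c u - v = scaleC c (u - scaleC (cnj c) v)"
      by (simp_all add: scaleC_add_right scaleC_diff_right scaleC_scaleC)
    then show ?thesis
      using uni[OF c] by (simp add: polar_def)
  qed
  have small: "polar Q (scaleC c u) v = polar Q u (scaleC (cnj c) v)" if c: "cmod c \<le> 2" for c u v
  proof -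
    obtain a b where "cmod a = 1" "cmod b = 1" "c = a + b"
      using complex_sum_of_two_units[OF c] by blast
    then show ?thesis
      by (simp add: scaleC_add_left addl addr unit)
  qed
  have mult: "polar Q (scaleC (of_nat n * c) u) v = polar Q u (scaleC (cnj (of_nat n * c)) v)"
    if c: "cmod c \<le> 2" for n c u v
    by (induction n) (simp_all add: algebra_simps scaleC_add_left addl addr small[OF c] zero sym[of u 0])
  have "polar Q (scaleC c u) v = polar Q u (scaleC (cnj c) v)" for c u v
  proof -
    obtain n :: nat where n: "cmod c < of_nat n"
      using reals_Archimedean2 by blast
    then have "n > 0"
      by (metis norm_ge_zero not_gr_zero not_less of_nat_0)
    then have "cmod (c / of_nat n) \<le> 2"
      using n by (simp add: norm_divide divide_simps)
    from mult[OF this, of n u v] show ?thesis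
      using \<open>n > 0\<close> by simp
  qed
  then show "pairing (polar Q)"
    by (simp add: pairing_def addl addr)
qed

section \<open>The energy of a chain\<close>

lemma sum_roots_of_unity_orthogonal:
  fixes a b N :: nat
  assumes "a < N" "b < N"
  shows "(\<Sum>t<N. cis (2 * pi * real t / real N) ^ a * cnj (cis (2 * pi * real t / real N) ^ b)) =
    (if a = b then of_nat N else 0)"
proof -
  define z where "z = cis (2 * pi * (real a - real b) / real N)"
  have "(\<Sum>t<N. cis (2 * pi * real t / real N) ^ a * cnj (cis (2 * pi * real t / real N) ^ b)) =
    (\<Sum>t<N. z ^ t)"
  proof (intro sum.cong refl)
    fix t
    have "real a * (2 * pi * real t / real N) + - (real b * (2 * pi * real t / real N)) =
      real t * (2 * pi * (real a - real b) / real N)"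
      by (simp add: diff_divide_distrib algebra_simps)
    then show "cis (2 * pi * real t / real N) ^ a * cnj (cis (2 * pi * real t / real N) ^ b) = z ^ t"
      by (simp only: z_def complex_cnj_power cis_cnj Complex.DeMoivre cis_mult mult_minus_right)
  qed
  also have "\<dots> = (if a = b then of_nat N else 0)"
  proof (cases "a = b")
    case True
    then show ?thesis by (simp add: z_def)
  next
    case False
    have "z \<noteq> 1"
    proof
      assume "z = 1"
      then have "cos (2 * pi * (real a - real b) / real N) = 1"
        by (metis cis.simps(1) one_complex.simps(1) z_def)
      then obtain k :: int where "2 * pi * (real a - real b) / real N = of_int k * 2 * pi"
        using cos_one_2pi_int by blast
      then have "(2 * pi) * (real a - real b) = (2 * pi) * (of_int k * real N)"
        using assms by (simp add: field_simps)
      then have "real a - real b = of_int k * real N"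
        by (subst (asm) mult_cancel_left) simp
      then have "of_int (int a - int b) = (of_int (k * int N) :: real)"
        by simp
      then have "int a - int b = k * int N"
        by (simp only: of_int_eq_iff)
      then have "int N dvd int a - int b" "\<bar>int a - int b\<bar> < int N"
        using assms by auto
      then show False
        using False dvd_imp_le_int[of "int a - int b" "int N"] by auto
    qed
    moreover have "z ^ N = 1"
    proof -
      have "z ^ N = cis (2 * pi * of_int (int a - int b))"
        using assms by (simp add: z_def Complex.DeMoivre)
      then show ?thesis
        using cis_multiple_2pi[of "of_int (int a - int b)"] by (metis Ints_of_int)
    qed
    ultimately show ?thesis
      using False geometric_sum[of z N] by simp
  qed
  finally show ?thesis .
qed

lemma clin_scaleR: "clin A \<Longrightarrow> A (r *\<^sub>R x) = r *\<^sub>R A x"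
  by (simp add: scaleR_scaleC clin_scaleC)

definition root_node :: "nat \<Rightarrow> nat \<Rightarrow> complex"
  where "root_node N t = cis (2 * pi * real t / real N)"

lemma norm_root_node [simp]: "cmod (root_node N t) = 1"
  by (simp add: root_node_def)

text \<open>
  Orthogonality of the characters of the cyclic group of order \<open>N\<close>, for vector-valued
  trigonometric polynomials: as long as no exponent reaches \<open>N\<close>, the mean over the nodes is the mean
  over the circle.
\<close>

lemma sum_root_node_inner:
  fixes a b :: "nat \<Rightarrow> 'h::chilbert_space"
  assumes "m + e \<le> N" "m' \<le> N"
  shows "(\<Sum>t<N. inner (\<Sum>i<m. scaleC (root_node N t ^ (i + e)) (a i))
                        (\<Sum>j<m'. scaleC (root_node N t ^ j) (b j))) =
    real N * (\<Sum>i<m. if i + e < m' then inner (a i) (b (i + e)) else 0)"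
proof -
  have one: "(\<Sum>t<N. inner (scaleC (root_node N t ^ (i + e)) (a i)) (scaleC (root_node N t ^ j) (b j))) =
     (if i + e = j then real N * inner (a i) (b j) else 0)" if "i < m" "j < m'" for i j
  proof -
    have "(\<Sum>t<N. inner (scaleC (root_node N t ^ (i + e)) (a i)) (scaleC (root_node N t ^ j) (b j))) =
      Re ((\<Sum>t<N. root_node N t ^ (i + e) * cnj (root_node N t ^ j)) * cinner (a i) (b j))"
      by (simp add: inner_eq_Re_cinner cinner_scaleC_left cinner_scaleC_right sum_distrib_right
          flip: Re_sum) (simp add: algebra_simps)
    also have "(\<Sum>t<N. root_node N t ^ (i + e) * cnj (root_node N t ^ j)) =
      (if i + e = j then of_nat N else 0)"
      unfolding root_node_def using that assms by (intro sum_roots_of_unity_orthogonal) auto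
    finally show ?thesis
      by (simp add: inner_eq_Re_cinner)
  qed
  have "(\<Sum>t<N. inner (\<Sum>i<m. scaleC (root_node N t ^ (i + e)) (a i))
                        (\<Sum>j<m'. scaleC (root_node N t ^ j) (b j))) =
    (\<Sum>i<m. \<Sum>j<m'. \<Sum>t<N. inner (scaleC (root_node N t ^ (i + e)) (a i)) (scaleC (root_node N t ^ j) (b j)))"
    unfolding inner_sum_left
    unfolding inner_sum_right
    by (subst sum.swap) (rule sum.cong[OF refl], rule sum.swap)
  also have "\<dots> = (\<Sum>i<m. \<Sum>j<m'. if i + e = j then real N * inner (a i) (b j) else 0)"
    by (intro sum.cong refl one) auto
  also have "\<dots> = real N * (\<Sum>i<m. if i + e < m' then inner (a i) (b (i + e)) else 0)"
    by (simp add: sum_distrib_left if_distrib cong: if_cong)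
  finally show ?thesis .
qed

text \<open>
  The quadratic form of the block Toeplitz operator with symbol
  \<open>\<omega> \<mapsto> \<parallel>u\<parallel>\<^sup>2 + \<parallel>v\<parallel>\<^sup>2 - 2 Re \<langle>(A + \<omega> B) u, v\<rangle>\<close>, written along the chain
  \<open>y 0 - x 0 - y 1 - x 1 - \<dots> - y K\<close> whose links are alternately of type \<open>A\<close> and of type \<open>B\<close>.
\<close>

definition energy :: "('h::chilbert_space \<Rightarrow> 'h) \<Rightarrow> ('h \<Rightarrow> 'h) \<Rightarrow> nat \<Rightarrow> (nat \<Rightarrow> 'h) \<Rightarrow> (nat \<Rightarrow> 'h) \<Rightarrow> real"
  where "energy A B K x y = (\<Sum>i<Suc K. inner (y i) (y i)) +
    (\<Sum>i<K. inner (x i) (x i) - 2 * inner (A (x i)) (y i) - 2 * inner (B (x i)) (y (Suc i)))"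

text \<open>
  The energy is the mean over \<open>\<omega>\<close> of the symbol at \<open>u = \<Sum> \<omega>\<^sup>i x\<^sub>i\<close> and
  \<open>v = \<Sum> \<omega>\<^sup>i y\<^sub>i\<close>: averaging keeps exactly the terms that link neighbours in the chain. The symbol is
  nonnegative since \<open>A + \<omega> B\<close> is a contraction.
\<close>

lemma energy_nonneg:
  assumes A: "clin A" and B: "clin B"
    and contr: "\<And>\<omega> u. cmod \<omega> = 1 \<Longrightarrow> norm (A u + scaleC \<omega> (B u)) \<le> norm u"
  shows "energy A B K x y \<ge> 0"
proof -
  \<comment> \<open>The exponents that occur are at most \<open>K\<close>.\<close>
  define N where "N = Suc (Suc K)"
  define X where "X = (\<lambda>t. \<Sum>i<K. scaleC (root_node N t ^ (i + 0)) (x i))"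
  define AX where "AX = (\<lambda>t. \<Sum>i<K. scaleC (root_node N t ^ (i + 0)) (A (x i)))"
  define BX where "BX = (\<lambda>t. \<Sum>i<K. scaleC (root_node N t ^ (i + 1)) (B (x i)))"
  define Y where "Y = (\<lambda>t. \<Sum>i<Suc K. scaleC (root_node N t ^ (i + 0)) (y i))"
  have pos: "inner (X t) (X t) + inner (Y t) (Y t) - 2 * inner (AX t) (Y t) - 2 * inner (BX t) (Y t) \<ge> 0" for t
  proof -
    have "AX t = A (X t)" "BX t = scaleC (root_node N t) (B (X t))"
      by (simp_all add: X_def AX_def BX_def clin_sum[OF A] clin_scaleC[OF A] clin_sum[OF B]
          clin_scaleC[OF B] scaleC_sum_right scaleC_scaleC)
    then have "norm (AX t + BX t) \<le> norm (X t)"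
      using contr[of "root_node N t" "X t"] by simp
    then have "inner (AX t + BX t) (Y t) \<le> norm (X t) * norm (Y t)"
      by (intro order_trans[OF norm_cauchy_schwarz] mult_right_mono) auto
    moreover have "2 * (norm (X t) * norm (Y t)) \<le> inner (X t) (X t) + inner (Y t) (Y t)"
      using sum_squares_bound[of "norm (X t)" "norm (Y t)"] by (simp add: power2_norm_eq_inner)
    ultimately show ?thesis
      by (simp add: inner_add_left)
  qed
  have "0 \<le> (\<Sum>t<N. inner (X t) (X t) + inner (Y t) (Y t) - 2 * inner (AX t) (Y t) - 2 * inner (BX t) (Y t))"
    by (intro sum_nonneg pos)
  also have "\<dots> = (\<Sum>t<N. inner (X t) (X t)) + (\<Sum>t<N. inner (Y t) (Y t))
      - 2 * (\<Sum>t<N. inner (AX t) (Y t)) - 2 * (\<Sum>t<N. inner (BX t) (Y t))"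
    by (simp add: sum.distrib sum_subtractf sum_distrib_left)
  also have "(\<Sum>t<N. inner (X t) (X t)) = real N * (\<Sum>i<K. inner (x i) (x i))"
    using sum_root_node_inner[of K 0 N K x x] by (simp add: X_def N_def)
  also have "(\<Sum>t<N. inner (Y t) (Y t)) = real N * (\<Sum>i<Suc K. inner (y i) (y i))"
    using sum_root_node_inner[of "Suc K" 0 N "Suc K" y y] by (simp add: Y_def N_def)
  also have "(\<Sum>t<N. inner (AX t) (Y t)) = real N * (\<Sum>i<K. inner (A (x i)) (y i))"
    using sum_root_node_inner[of K 0 N "Suc K" "\<lambda>i. A (x i)" y]
    by (simp add: AX_def Y_def N_def less_SucI)
  also have "(\<Sum>t<N. inner (BX t) (Y t)) = real N * (\<Sum>i<K. inner (B (x i)) (y (Suc i)))"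
    using sum_root_node_inner[of K 1 N "Suc K" "\<lambda>i. B (x i)" y]
    by (simp add: BX_def Y_def N_def)
  finally have "0 \<le> real N * energy A B K x y"
    by (simp add: energy_def sum.distrib sum_subtractf sum_distrib_left algebra_simps)
  then show ?thesis
    by (simp add: N_def zero_le_mult_iff)
qed

lemma energy_shift:
  "energy A B (Suc K) (case_nat u x) (case_nat v y) =
    inner v v + inner u u - 2 * inner (A u) v - 2 * inner (B u) (y 0) + energy A B K x y"
  unfolding energy_def sum.lessThan_Suc_shift[of _ "Suc K"] sum.lessThan_Suc_shift[of _ K]
  by (simp add: sum.lessThan_Suc_shift del: sum.lessThan_Suc)

text \<open>
  Chains of different lengths can be compared after continuing them by zero.
\<close>

lemma energy_pad:
  assumes "clin A" "clin B" "K \<le> L"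
  shows "energy A B L (\<lambda>i. if i < K then x i else 0) (\<lambda>i. if i \<le> K then y i else 0) = energy A B K x y"
proof -
  have "(\<Sum>i<Suc L. inner (if i \<le> K then y i else 0) (if i \<le> K then y i else 0)) = (\<Sum>i<Suc K. inner (y i) (y i))"
    using assms by (intro sum.mono_neutral_cong_right) auto
  moreover have "(\<Sum>i<L. inner (if i < K then x i else 0) (if i < K then x i else 0)
       - 2 * inner (A (if i < K then x i else 0)) (if i \<le> K then y i else 0)
       - 2 * inner (B (if i < K then x i else 0)) (if Suc i \<le> K then y (Suc i) else 0)) =
    (\<Sum>i<K. inner (x i) (x i) - 2 * inner (A (x i)) (y i) - 2 * inner (B (x i)) (y (Suc i)))"
    using assms by (intro sum.mono_neutral_cong_right) (auto simp: clin_zero)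
  ultimately show ?thesis
    by (simp add: energy_def)
qed

lemma energy_parallelogram:
  assumes "clin A" "clin B"
  shows "energy A B K (\<lambda>i. x i + x' i) (\<lambda>i. y i + y' i) + energy A B K (\<lambda>i. x i - x' i) (\<lambda>i. y i - y' i)
    = 2 * energy A B K x y + 2 * energy A B K x' y'"
proof -
  have "(\<Sum>i<Suc K. inner (y i + y' i) (y i + y' i)) + (\<Sum>i<Suc K. inner (y i - y' i) (y i - y' i)) =
      2 * (\<Sum>i<Suc K. inner (y i) (y i)) + 2 * (\<Sum>i<Suc K. inner (y' i) (y' i))"
    unfolding sum_distrib_left sum.distrib[symmetric]
    by (intro sum.cong refl) (simp add: inner_add_left inner_add_right inner_diff_left inner_diff_right)
  moreover have
   "(\<Sum>i<K. inner (x i + x' i) (x i + x' i) - 2 * inner (A (x i + x' i)) (y i + y' i) - 2 * inner (B (x i + x' i)) (y (Suc i) + y' (Suc i))) +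
    (\<Sum>i<K. inner (x i - x' i) (x i - x' i) - 2 * inner (A (x i - x' i)) (y i - y' i) - 2 * inner (B (x i - x' i)) (y (Suc i) - y' (Suc i))) =
    2 * (\<Sum>i<K. inner (x i) (x i) - 2 * inner (A (x i)) (y i) - 2 * inner (B (x i)) (y (Suc i))) +
    2 * (\<Sum>i<K. inner (x' i) (x' i) - 2 * inner (A (x' i)) (y' i) - 2 * inner (B (x' i)) (y' (Suc i)))"
    unfolding sum_distrib_left sum.distrib[symmetric]
    by (intro sum.cong refl)
      (simp add: inner_add_left inner_add_right inner_diff_left inner_diff_right clin_add clin_diff assms algebra_simps)
  ultimately show ?thesis
    by (simp add: energy_def)
qed

lemma energy_scaleC:
  assumes "clin A" "clin B" "cmod c = 1"
  shows "energy A B K (\<lambda>i. scaleC c (x i)) (\<lambda>i. scaleC c (y i)) = energy A B K x y"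
proof -
  have "cnj c * c = 1"
    using complex_norm_square[of c] assms by (simp add: mult.commute)
  then have "inner (scaleC c u) (scaleC c v) = inner u v" for u v :: 'a
    by (simp add: inner_scaleC_left scaleC_scaleC)
  then show ?thesis
    using assms by (simp add: energy_def clin_scaleC)
qed

section \<open>Splitting the inner product\<close>

text \<open>
  The set \<open>S v\<close> stands for the values of a quadratic form on the fibre over \<open>v\<close> of a linear map.
  Adding and subtracting points of two fibres gives one half of the parallelogram law for the infimum;
  the same inequality for \<open>u + v\<close> and \<open>u - v\<close>, with homogeneity, gives the other half.
\<close>

lemma quadratic_Inf:
  fixes S :: "'h::chilbert_space \<Rightarrow> real set"
  assumes ne: "\<And>v. S v \<noteq> {}" and lb: "\<And>v a. a \<in> S v \<Longrightarrow> 0 \<le> a"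
    and le: "\<And>u v a b. a \<in> S u \<Longrightarrow> b \<in> S v \<Longrightarrow>
      \<exists>c\<in>S (u + v). \<exists>d\<in>S (u - v). c + d = 2 * a + 2 * b"
    and four: "\<And>u a. a \<in> S (u + u) \<Longrightarrow> a / 4 \<in> S u"
    and unit: "\<And>c u. cmod c = 1 \<Longrightarrow> S (scaleC c u) \<subseteq> S u"
  shows "quadratic (\<lambda>v. Inf (S v))"
proof -
  have bdd: "bdd_below (S v)" for v
    using lb by (meson bdd_belowI)
  have par: "Inf (S (u + v)) + Inf (S (u - v)) \<le> 2 * Inf (S u) + 2 * Inf (S v)" for u v
  proof -
    have 1: "(Inf (S (u + v)) + Inf (S (u - v))) / 2 - b \<le> a" if ab: "a \<in> S u" "b \<in> S v" for a b
    proof -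
      obtain c d where "c \<in> S (u + v)" "d \<in> S (u - v)" "c + d = 2 * a + 2 * b"
        using le[OF ab] by blast
      then show ?thesis
        using cInf_lower[OF _ bdd, of c "u + v"] cInf_lower[OF _ bdd, of d "u - v"]
        by (simp add: field_simps)
    qed
    have 2: "(Inf (S (u + v)) + Inf (S (u - v))) / 2 - Inf (S u) \<le> b" if b: "b \<in> S v" for b
      using cInf_greatest[OF ne[of u] 1[OF _ b]] by (simp add: field_simps)
    show ?thesis
      using cInf_greatest[OF ne[of v] 2] by (simp add: field_simps)
  qed
  have quad: "4 * Inf (S u) \<le> Inf (S (u + u))" for u
  proof (rule cInf_greatest[OF ne])
    fix a assume "a \<in> S (u + u)"
    then show "4 * Inf (S u) \<le> a"
      using cInf_lower[OF four bdd] by force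
  qed
  have eq: "Inf (S (u + v)) + Inf (S (u - v)) = 2 * Inf (S u) + 2 * Inf (S v)" for u v
    using par[of u v] par[of "u + v" "u - v"] quad[of u] quad[of v]
    by (simp add: algebra_simps)
  have "S (scaleC c u) = S u" if c: "cmod c = 1" for c u
  proof
    have "cnj c * c = 1"
      using complex_norm_square[of c] c by (simp add: mult.commute)
    then show "S u \<subseteq> S (scaleC c u)"
      using unit[of "cnj c" "scaleC c u"] c by (simp add: scaleC_scaleC)
  qed (rule unit[OF c])
  then show ?thesis
    using eq by (simp add: quadratic_def)
qed

text \<open>
  The forms \<open>q\<close>, \<open>r = inner - q\<close>, \<open>s\<close>, \<open>p = inner - s\<close> are all positive and bound \<open>A\<close> and \<open>B\<close>
  separately: \<open>\<bar>\<langle>A u, v\<rangle>\<bar>\<^sup>2 \<le> q u p v\<close> and \<open>\<bar>\<langle>B u, v\<rangle>\<bar>\<^sup>2 \<le> r u s v\<close>. This is the Fejer-Riesz factorization of the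
  symbol of the energy, in the language of forms. Let \<open>s v\<close> be the least energy of a chain that
  starts at \<open>v\<close> with an \<open>A\<close>-link, and \<open>q u\<close> the least energy of one that starts at \<open>u\<close> with a \<open>B\<close>-link.
  Removing the first link of a chain relates the two minima, and the two relations are the two
  inequalities. Minimizing over the rest of the chain does not destroy the quadratic character.
\<close>

theorem splitting_forms:
  fixes A B :: "'h::chilbert_space \<Rightarrow> 'h"
  assumes A: "clin A" and B: "clin B"
    and contr: "\<And>\<omega> u. cmod \<omega> = 1 \<Longrightarrow> norm (A u + scaleC \<omega> (B u)) \<le> norm u"
  obtains q s where "pairing q" "\<And>u v. q u v = q v u" "pairing s" "\<And>u v. s u v = s v u"
    "\<And>u. 0 \<le> q u u" "\<And>u. q u u \<le> inner u u" "\<And>u. 0 \<le> s u u" "\<And>u. s u u \<le> inner u u"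
    "\<And>u v. 2 * inner (A u) v \<le> q u u + (inner v v - s v v)"
    "\<And>u v. 2 * inner (B u) v \<le> (inner u u - q u u) + s v v"
proof -
  note pos = energy_nonneg[OF A B contr]
  \<comment> \<open>Energies of the chains that start at \<open>v\<close> with an \<open>A\<close>-link.\<close>
  define S where "S v = {energy A B K x y | K x y. y 0 = v}" for v
  define s0 where "s0 v = Inf (S v)" for v
  have Sne: "S v \<noteq> {}" and Slb: "a \<in> S v \<Longrightarrow> 0 \<le> a" for v a
    using pos by (force simp: S_def)+
  have quad_s: "quadratic s0"
    unfolding s0_def
  proof (rule quadratic_Inf[OF Sne Slb])
    fix u v a b assume "a \<in> S u" "b \<in> S v"
    then obtain K x y L x' y' where a: "a = energy A B K x y" "y 0 = u"
      and b: "b = energy A B L x' y'" "y' 0 = v"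
      by (auto simp: S_def)
    define M where "M = max K L"
    define z where "z i = (if i < K then x i else 0)" for i
    define w where "w i = (if i \<le> K then y i else 0)" for i
    define z' where "z' i = (if i < L then x' i else 0)" for i
    define w' where "w' i = (if i \<le> L then y' i else 0)" for i
    have "energy A B M z w = a" "energy A B M z' w' = b"
      unfolding a b z_def w_def z'_def w'_def using A B by (intro energy_pad; simp add: M_def)+
    moreover have "w 0 = u" "w' 0 = v"
      using a b by (auto simp: w_def w'_def)
    ultimately show "\<exists>c\<in>S (u + v). \<exists>d\<in>S (u - v). c + d = 2 * a + 2 * b"
      using energy_parallelogram[OF A B, of M z z' w w'] unfolding S_def by force
  next
    fix u a assume "a \<in> S (u + u)"
    then obtain K x y where a: "a = energy A B K x y" "y 0 = u + u"
      by (auto simp: S_def)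
    have "energy A B K (\<lambda>i. (1/2) *\<^sub>R x i) (\<lambda>i. (1/2) *\<^sub>R y i) = a / 4"
      unfolding a energy_def clin_scaleR[OF A] clin_scaleR[OF B] inner_scaleR_left inner_scaleR_right
        add_divide_distrib sum_divide_distrib by (simp add: diff_divide_distrib)
    moreover have "(1/2) *\<^sub>R y 0 = u"
      by (simp add: a flip: scaleR_2)
    ultimately show "a / 4 \<in> S u"
      unfolding S_def by (metis (mono_tags, lifting) mem_Collect_eq)
  next
    fix c :: complex and u assume c: "cmod c = 1"
    show "S (scaleC c u) \<subseteq> S u"
    proof
      fix a assume "a \<in> S (scaleC c u)"
      then obtain K x y where a: "a = energy A B K x y" "y 0 = scaleC c u"
        by (auto simp: S_def)
      have "cnj c * c = 1"
        using complex_norm_square[of c] c by (simp add: mult.commute)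
      then have "scaleC (cnj c) (y 0) = u"
        by (simp add: a scaleC_scaleC)
      moreover have "energy A B K (\<lambda>i. scaleC (cnj c) (x i)) (\<lambda>i. scaleC (cnj c) (y i)) = a"
        using c by (simp add: a energy_scaleC A B)
      ultimately show "a \<in> S u"
        unfolding S_def by (metis (mono_tags, lifting) mem_Collect_eq)
    qed
  qed
  have s_le: "s0 (y 0) \<le> energy A B K x y" for K x y
    unfolding s0_def by (rule cInf_lower) (auto simp: S_def intro!: bdd_belowI[of _ 0] pos)
  have s_ge: "m \<le> s0 v" if "\<And>K x y. y 0 = v \<Longrightarrow> m \<le> energy A B K x y" for m v
    unfolding s0_def by (rule cInf_greatest[OF Sne]) (use that in \<open>auto simp: S_def\<close>)
  have s_pos: "0 \<le> s0 v" for v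
    by (intro s_ge pos)
  have s_upper: "s0 v \<le> inner v v" for v
    using s_le[of "\<lambda>_. v" 0 "\<lambda>_. 0"] by (simp add: energy_def)
  have s0_0: "s0 0 = 0"
    using s_pos[of 0] s_upper[of 0] by simp

  \<comment> \<open>Energies of chains that start at \<open>u\<close> with a \<open>B\<close>-link, minimized beyond that link.\<close>
  define T where "T u = {inner u u - 2 * inner (B u) v + s0 v | v. True}" for u
  define q0 where "q0 u = Inf (T u)" for u
  have Tne: "T v \<noteq> {}" for v
    by (auto simp: T_def)
  have Tpos: "0 \<le> inner u u - 2 * inner (B u) v + s0 v" for u v
  proof -
    have "2 * inner (B u) v - inner u u \<le> energy A B K x y" if y: "y 0 = v" for K x y
      using pos[of "Suc K" "case_nat u x" "case_nat 0 y"] y by (simp add: energy_shift)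
    from s_ge[of v, OF this] show ?thesis by simp
  qed
  then have Tlb: "a \<in> T v \<Longrightarrow> 0 \<le> a" for v a
    by (auto simp: T_def)
  have quad_q: "quadratic q0"
    unfolding q0_def
  proof (rule quadratic_Inf[OF Tne Tlb])
    fix u v a b assume "a \<in> T u" "b \<in> T v"
    then obtain w w' where a: "a = inner u u - 2 * inner (B u) w + s0 w"
      and b: "b = inner v v - 2 * inner (B v) w' + s0 w'"
      by (auto simp: T_def)
    have "s0 (w + w') + s0 (w - w') = 2 * s0 w + 2 * s0 w'"
      using quad_s by (simp add: quadratic_def)
    then have "(inner (u + v) (u + v) - 2 * inner (B (u + v)) (w + w') + s0 (w + w')) +
      (inner (u - v) (u - v) - 2 * inner (B (u - v)) (w - w') + s0 (w - w')) = 2 * a + 2 * b"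
      by (simp add: a b inner_add_left inner_add_right inner_diff_left inner_diff_right
          clin_add[OF B] clin_diff[OF B])
    then show "\<exists>c\<in>T (u + v). \<exists>d\<in>T (u - v). c + d = 2 * a + 2 * b"
      unfolding T_def by blast
  next
    fix u a assume "a \<in> T (u + u)"
    then obtain w where a: "a = inner (u + u) (u + u) - 2 * inner (B (u + u)) w + s0 w"
      by (auto simp: T_def)
    define w' where "w' = (1/2) *\<^sub>R w"
    have w: "w = w' + w'"
      by (simp add: w'_def flip: scaleR_add_left)
    have "s0 (w' + w') = 4 * s0 w'"
      using quad_s s0_0 unfolding quadratic_def by (metis add.right_neutral diff_self mult_2 numeral_Bit0 distrib_right)
    then have "a / 4 = inner u u - 2 * inner (B u) w' + s0 w'"
      by (simp add: a w clin_add[OF B] inner_add_left inner_add_right)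
    then show "a / 4 \<in> T u"
      by (auto simp: T_def)
  next
    fix c :: complex and u assume c: "cmod c = 1"
    show "T (scaleC c u) \<subseteq> T u"
    proof
      fix a assume "a \<in> T (scaleC c u)"
      then obtain w where a: "a = inner (scaleC c u) (scaleC c u) - 2 * inner (B (scaleC c u)) w + s0 w"
        by (auto simp: T_def)
      have cc: "cnj c * c = 1"
        using complex_norm_square[of c] c by (simp add: mult.commute)
      have "s0 (scaleC (cnj c) w) = s0 w"
        using quad_s c by (simp add: quadratic_def)
      then have "a = inner u u - 2 * inner (B u) (scaleC (cnj c) w) + s0 (scaleC (cnj c) w)"
        by (simp add: a clin_scaleC[OF B] inner_scaleC_left scaleC_scaleC cc)
      then show "a \<in> T u"
        by (auto simp: T_def)
    qed
  qed
  have q_le: "q0 u \<le> inner u u - 2 * inner (B u) v + s0 v" for u v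
    unfolding q0_def by (rule cInf_lower) (auto simp: T_def intro!: bdd_belowI[of _ 0] Tpos)
  have q_ge: "m \<le> q0 u" if "\<And>v. m \<le> inner u u - 2 * inner (B u) v + s0 v" for m u
    unfolding q0_def by (rule cInf_greatest[OF Tne]) (use that in \<open>auto simp: T_def\<close>)
  have s_step: "s0 v \<le> inner v v - 2 * inner (A u) v + q0 u" for u v
  proof -
    have "s0 v - inner v v + 2 * inner (A u) v \<le> inner u u - 2 * inner (B u) w + s0 w" for w
    proof -
      have "s0 v - inner v v + 2 * inner (A u) v - inner u u + 2 * inner (B u) w \<le> energy A B K x y"
        if "y 0 = w" for K x y
        using s_le[of "case_nat v y" "Suc K" "case_nat u x"] that by (simp add: energy_shift)
      from s_ge[of w, OF this] show ?thesis by simp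
    qed
    from q_ge[of _ u, OF this] show ?thesis by simp
  qed
  show thesis
  proof (rule that[of "polar q0" "polar s0"])
    show "0 \<le> polar q0 u u" for u
      using q_ge[of 0 u] Tpos by (simp add: quadratic_polar(3)[OF quad_q])
    show "polar q0 u u \<le> inner u u" for u
      using q_le[of u 0] by (simp add: quadratic_polar(3)[OF quad_q] s0_0)
    show "2 * inner (A u) v \<le> polar q0 u u + (inner v v - polar s0 v v)" for u v
      using s_step[of v u] by (simp add: quadratic_polar(3)[OF quad_q] quadratic_polar(3)[OF quad_s])
    show "2 * inner (B u) v \<le> (inner u u - polar q0 u u) + polar s0 v v" for u v
      using q_le[of u v] by (simp add: quadratic_polar(3)[OF quad_q] quadratic_polar(3)[OF quad_s])
  qed (use s_pos s_upper in \<open>auto simp: quadratic_polar[OF quad_q] quadratic_polar[OF quad_s]\<close>)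
qed

section \<open>Positive definite matrices\<close>

definition posdef :: "'i set \<Rightarrow> ('i \<Rightarrow> 'i \<Rightarrow> complex) \<Rightarrow> bool"
  where "posdef I M \<longleftrightarrow> (\<forall>j\<in>I. \<forall>l\<in>I. M l j = cnj (M j l)) \<and>
    (\<forall>u. (\<exists>j\<in>I. u j \<noteq> 0) \<longrightarrow> 0 < Re (\<Sum>j\<in>I. \<Sum>l\<in>I. cnj (u j) * M j l * u l))"

lemma posdef_herm: "posdef I M \<Longrightarrow> j \<in> I \<Longrightarrow> l \<in> I \<Longrightarrow> M l j = cnj (M j l)"
  unfolding posdef_def by blast

lemma posdef_diag:
  assumes "posdef I M" "i \<in> I" "finite I"
  obtains r where "r > 0" "M i i = complex_of_real r"
proof -
  have "0 < Re (\<Sum>j\<in>I. \<Sum>l\<in>I. cnj (if j = i then 1 else 0) * M j l * (if l = i then 1 else 0))"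
    using assms(1,2) unfolding posdef_def
    by (elim conjE allE[of _ "\<lambda>j. if j = i then 1 else 0"]) (erule mp, rule bexI[of _ i], simp_all)
  also have "(\<Sum>j\<in>I. \<Sum>l\<in>I. cnj (if j = i then 1 else 0) * M j l * (if l = i then 1 else 0)) = M i i"
    using assms by (simp add: if_distrib[of cnj] if_distrib[of "\<lambda>x. x * _"] if_distrib[of "\<lambda>x. _ * x"] cong: if_cong)
  finally have "0 < Re (M i i)" .
  moreover have "M i i = complex_of_real (Re (M i i))"
    using arg_cong[OF posdef_herm[OF assms(1) assms(2) assms(2)], of Im] by (simp add: complex_eq_iff)
  ultimately show ?thesis
    using that by blast
qed

text \<open>
  Complete the square in the coordinate \<open>i\<close>: the form of the Schur complement at \<open>u\<close> is the
  form of \<open>M\<close> at the extension of \<open>u\<close> whose coordinate at \<open>i\<close> minimizes it.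
\<close>

lemma posdef_schur_complement:
  assumes pd: "posdef (insert i I) M" and i: "i \<notin> I" "finite I"
  shows "posdef I (\<lambda>j l. M j l - M j i * M i l / M i i)"
proof -
  obtain r where r: "r > 0" "M i i = complex_of_real r"
    using posdef_diag[OF pd] i by auto
  have herm: "M l j = cnj (M j l)" if "j \<in> insert i I" "l \<in> insert i I" for j l
    using posdef_herm[OF pd] that by blast
  have "0 < Re (\<Sum>j\<in>I. \<Sum>l\<in>I. cnj (u j) * (M j l - M j i * M i l / M i i) * u l)"
    if u: "\<exists>j\<in>I. u j \<noteq> 0" for u
  proof -
    define w where "w = (\<Sum>l\<in>I. M i l * u l)"
    \<comment> \<open>The value at \<open>i\<close> that minimizes the form of \<open>M\<close>.\<close>
    define v where "v = u(i := - w / r)"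
    define S where "S = (\<Sum>j\<in>I. \<Sum>l\<in>I. cnj (u j) * M j l * u l)"
    have w': "cnj w = (\<Sum>j\<in>I. cnj (u j) * M j i)"
      unfolding w_def cnj_sum by (intro sum.cong refl) (simp add: herm[of i])
    have v: "v j = u j" if "j \<in> I" for j
      using that i by (auto simp: v_def)
    have vi: "v i = - w / r"
      by (simp add: v_def)
    have "(\<Sum>j\<in>insert i I. \<Sum>l\<in>insert i I. cnj (v j) * M j l * v l) =
      cnj (v i) * M i i * v i + cnj (v i) * w + (cnj w * v i + S)"
      using i by (simp add: sum.distrib v S_def w_def sum_distrib_left sum_distrib_right mult.assoc
          flip: w'[unfolded w_def]) (auto intro!: sum.cong simp: herm[of i] mult_ac)
    also have "\<dots> = S - cnj w * w / r"
      using r by (simp add: vi r divide_simps)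
    also have "cnj w * w / r = (\<Sum>j\<in>I. \<Sum>l\<in>I. cnj (u j) * (M j i * M i l / M i i) * u l)"
      unfolding w' unfolding w_def sum_product sum_divide_distrib
      by (simp add: r mult_ac)
    also have "S - \<dots> = (\<Sum>j\<in>I. \<Sum>l\<in>I. cnj (u j) * (M j l - M j i * M i l / M i i) * u l)"
      by (simp add: S_def algebra_simps sum_subtractf)
    finally have eq: "(\<Sum>j\<in>insert i I. \<Sum>l\<in>insert i I. cnj (v j) * M j l * v l) = \<dots>" .
    obtain j where "j \<in> I" "u j \<noteq> 0"
      using u by blast
    then have "\<exists>j\<in>insert i I. v j \<noteq> 0"
      using v[of j] by (intro bexI[of _ j]) auto
    with pd have "0 < Re (\<Sum>j\<in>insert i I. \<Sum>l\<in>insert i I. cnj (v j) * M j l * v l)"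
      unfolding posdef_def by blast
    then show ?thesis
      unfolding eq .
  qed
  moreover have "M l j - M l i * M i j / M i i = cnj (M j l - M j i * M i l / M i i)"
    if "j \<in> I" "l \<in> I" for j l
    using that herm[of j l] herm[of i l] herm[of j i] by (simp add: r mult.commute)
  ultimately show ?thesis
    unfolding posdef_def by blast
qed

lemma posdef_cholesky:
  assumes "finite I" "posdef I M"
  shows "\<exists>C. \<forall>j\<in>I. \<forall>l\<in>I. M j l = (\<Sum>k\<in>I. cnj (C k j) * C k l)"
  using assms
proof (induction I arbitrary: M)
  case empty
  then show ?case by simp
next
  case (insert i I)
  obtain r where r: "r > 0" "M i i = complex_of_real r"
    using posdef_diag[OF insert.prems] insert.hyps by auto
  obtain C where C: "\<forall>j\<in>I. \<forall>l\<in>I. M j l - M j i * M i l / M i i = (\<Sum>k\<in>I. cnj (C k j) * C k l)"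
    using insert.IH[OF posdef_schur_complement[OF insert.prems insert.hyps(2,1)]] by blast
  define D where "D k l = (if k = i then M i l / complex_of_real (sqrt r) else if l = i then 0 else C k l)" for k l
  have sq: "complex_of_real (sqrt r) * complex_of_real (sqrt r) = complex_of_real r"
    using r by (simp flip: of_real_mult)
  have "M j l = (\<Sum>k\<in>insert i I. cnj (D k j) * D k l)" if jl: "j \<in> insert i I" "l \<in> insert i I" for j l
  proof -
    have "(\<Sum>k\<in>insert i I. cnj (D k j) * D k l) = cnj (D i j) * D i l + (\<Sum>k\<in>I. cnj (D k j) * D k l)"
      using insert.hyps by simp
    also have "cnj (D i j) * D i l = M j i * M i l / M i i"
      using posdef_herm[OF insert.prems, of i j] jl by (simp add: D_def r sq)
    also have "(\<Sum>k\<in>I. cnj (D k j) * D k l) = M j l - M j i * M i l / M i i"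
    proof (cases "j = i \<or> l = i")
      case True
      then have "(\<Sum>k\<in>I. cnj (D k j) * D k l) = 0"
        using insert.hyps by (intro sum.neutral) (auto simp: D_def)
      then show ?thesis
        using True r by auto
    next
      case False
      then have "(\<Sum>k\<in>I. cnj (D k j) * D k l) = (\<Sum>k\<in>I. cnj (C k j) * C k l)"
        using insert.hyps by (intro sum.cong) (auto simp: D_def)
      then show ?thesis
        using C False jl by auto
    qed
    finally show ?thesis by simp
  qed
  then show ?case by blast
qed

text \<open>
  Block elimination along the same induction as the Cholesky factorization.
\<close>

lemma posdef_solve:
  assumes "finite I" "posdef I M"
  shows "\<exists>e. \<forall>j\<in>I. (\<Sum>k\<in>I. M j k * e k) = y j"
  using assms
proof (induction I arbitrary: M y)
  case empty
  then show ?case by simp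
next
  case (insert i I)
  obtain r where r: "r > 0" "M i i = complex_of_real r"
    using posdef_diag[OF insert.prems] insert.hyps by auto
  obtain e where e: "\<forall>j\<in>I. (\<Sum>k\<in>I. (M j k - M j i * M i k / M i i) * e k) = y j - M j i * y i / M i i"
    using insert.IH[OF posdef_schur_complement[OF insert.prems insert.hyps(2,1)],
        of "\<lambda>j. y j - M j i * y i / M i i"] by blast
  define s where "s = (\<Sum>k\<in>I. M i k * e k)"
  define f where "f = e(i := (y i - s) / M i i)"
  have f: "(\<Sum>k\<in>I. a k * f k) = (\<Sum>k\<in>I. a k * e k)" for a
    using insert.hyps by (intro sum.cong) (auto simp: f_def)
  have "(\<Sum>k\<in>insert i I. M j k * f k) = y j" if j: "j \<in> insert i I" for j
  proof -
    have "(\<Sum>k\<in>insert i I. M j k * f k) = M j i * (y i - s) / M i i + (\<Sum>k\<in>I. M j k * e k)"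
      using insert.hyps f by (simp add: f_def)
    also have "\<dots> = y j"
    proof (cases "j = i")
      case True
      then show ?thesis using r by (simp add: s_def)
    next
      case False
      then have "(\<Sum>k\<in>I. (M j k - M j i * M i k / M i i) * e k) = y j - M j i * y i / M i i"
        using e j by blast
      moreover have "(\<Sum>k\<in>I. (M j k - M j i * M i k / M i i) * e k) =
          (\<Sum>k\<in>I. M j k * e k) - M j i * s / M i i"
        unfolding s_def left_diff_distrib sum_subtractf sum_distrib_left sum_divide_distrib
        by (simp add: mult_ac)
      ultimately have "(\<Sum>k\<in>I. M j k * e k) = y j - M j i * y i / M i i + M j i * s / M i i"
        by (metis diff_eq_eq)
      then show ?thesis
        by (simp add: right_diff_distrib diff_divide_distrib)
    qed
    finally show ?thesis .
  qed
  then show ?case by blast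
qed

lemma posdef_inverse:
  assumes "finite I" "posdef I M"
  obtains L where "\<And>j l. j \<in> I \<Longrightarrow> (\<Sum>k\<in>I. M j k * L k l) = (if j = l then 1 else 0)"
proof -
  have "\<exists>e. \<forall>j\<in>I. (\<Sum>k\<in>I. M j k * e k) = (if j = l then 1 else 0)" for l
    using posdef_solve[OF assms, of "\<lambda>j. if j = l then 1 else 0"] .
  then obtain e where "\<forall>l. \<forall>j\<in>I. (\<Sum>k\<in>I. M j k * e l k) = (if j = l then 1 else 0)"
    by metis
  then show ?thesis
    using that[of "\<lambda>k l. e l k"] by auto
qed

section \<open>Tensoring a pairing with a matrix\<close>

text \<open>
  The real part of the form \<open>M \<otimes> b\<close> on vectors with entries in the Hilbert space.
\<close>

definition tens :: "'i set \<Rightarrow> ('i \<Rightarrow> 'i \<Rightarrow> complex) \<Rightarrow> ('h::chilbert_space \<Rightarrow> 'h \<Rightarrow> real) \<Rightarrow>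
    ('i \<Rightarrow> 'h) \<Rightarrow> ('i \<Rightarrow> 'h) \<Rightarrow> real"
  where "tens I M b x y = (\<Sum>j\<in>I. \<Sum>l\<in>I. b (scaleC (M j l) (x l)) (y j))"

text \<open>
  A factorization \<open>M = C\<^sup>* C\<close> diagonalizes \<open>M \<otimes> b\<close>. Therefore every inequality between forms on
  the Hilbert space passes to their tensor products with a positive definite matrix; the two
  instances used are positivity and domination of an operator.
\<close>

lemma tens_cholesky:
  assumes b: "pairing b" and C: "\<forall>j\<in>I. \<forall>l\<in>I. M j l = (\<Sum>k\<in>I. cnj (C k j) * C k l)"
  shows "tens I M b x y =
    (\<Sum>k\<in>I. b (\<Sum>l\<in>I. scaleC (C k l) (x l)) (\<Sum>j\<in>I. scaleC (C k j) (y j)))"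
proof -
  have "tens I M b x y = (\<Sum>j\<in>I. \<Sum>l\<in>I. \<Sum>k\<in>I. b (scaleC (C k l) (x l)) (scaleC (C k j) (y j)))"
    unfolding tens_def
  proof (intro sum.cong refl)
    fix j l assume "j \<in> I" "l \<in> I"
    then have "b (scaleC (M j l) (x l)) (y j) = (\<Sum>k\<in>I. b (scaleC (cnj (C k j)) (scaleC (C k l) (x l))) (y j))"
      using C by (simp add: scaleC_sum_left pairing_sum_left[OF b] scaleC_scaleC)
    then show "b (scaleC (M j l) (x l)) (y j) = (\<Sum>k\<in>I. b (scaleC (C k l) (x l)) (scaleC (C k j) (y j)))"
      by (simp add: pairing_scaleC[OF b, of "cnj _"])
  qed
  also have "\<dots> = (\<Sum>k\<in>I. \<Sum>j\<in>I. \<Sum>l\<in>I. b (scaleC (C k l) (x l)) (scaleC (C k j) (y j)))"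
    by (rule trans[OF sum.cong[OF refl sum.swap] sum.swap])
  also have "\<dots> = (\<Sum>k\<in>I. b (\<Sum>l\<in>I. scaleC (C k l) (x l)) (\<Sum>j\<in>I. scaleC (C k j) (y j)))"
    by (simp add: pairing_sum_left[OF b] pairing_sum_right[OF b])
  finally show ?thesis .
qed

lemma tens_sym:
  assumes "pairing b" "\<And>u v. b u v = b v u" "\<And>j l. j \<in> I \<Longrightarrow> l \<in> I \<Longrightarrow> M l j = cnj (M j l)"
  shows "tens I M b x y = tens I M b y x"
proof -
  have "b (scaleC (M j l) (x l)) (y j) = b (scaleC (M l j) (y j)) (x l)" if "j \<in> I" "l \<in> I" for j l
    using assms(3)[OF that] by (simp add: pairing_scaleC[OF assms(1), of _ "x l"] assms(2)[of "x l"])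
  then have "tens I M b x y = (\<Sum>j\<in>I. \<Sum>l\<in>I. b (scaleC (M l j) (y j)) (x l))"
    unfolding tens_def by (intro sum.cong refl)
  also have "\<dots> = tens I M b y x"
    unfolding tens_def by (rule sum.swap)
  finally show ?thesis .
qed

lemma tens_add_left: "pairing b \<Longrightarrow> tens I M b (\<lambda>j. x j + x' j) y = tens I M b x y + tens I M b x' y"
  by (simp add: tens_def scaleC_add_right pairing_add_left sum.distrib)

lemma tens_add_right: "pairing b \<Longrightarrow> tens I M b x (\<lambda>j. y j + y' j) = tens I M b x y + tens I M b x y'"
  by (simp add: tens_def pairing_add_right sum.distrib)

lemma tens_diff_left: "pairing b \<Longrightarrow> tens I M b (\<lambda>j. x j - x' j) y = tens I M b x y - tens I M b x' y"
  by (simp add: tens_def scaleC_diff_right pairing_diff_left sum_subtractf)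

lemma tens_diff_right: "pairing b \<Longrightarrow> tens I M b x (\<lambda>j. y j - y' j) = tens I M b x y - tens I M b x y'"
  by (simp add: tens_def pairing_diff_right sum_subtractf)

lemma tens_minus: "tens I M (\<lambda>u v. b u v - c u v) x y = tens I M b x y - tens I M c x y"
  by (simp add: tens_def sum_subtractf)

lemma tens_nonneg:
  assumes "finite I" "posdef I M" "pairing b" "\<And>u. 0 \<le> b u u"
  shows "0 \<le> tens I M b x x"
proof -
  obtain C where C: "\<forall>j\<in>I. \<forall>l\<in>I. M j l = (\<Sum>k\<in>I. cnj (C k j) * C k l)"
    using posdef_cholesky assms by blast
  show ?thesis
    unfolding tens_cholesky[OF \<open>pairing b\<close> C] by (intro sum_nonneg assms)
qed

lemma tens_dominated:
  assumes "finite I" "posdef I M" "clin A" "pairing b" "pairing c"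
    and le: "\<And>u v. 2 * inner (A u) v \<le> b u u + c v v"
  shows "2 * tens I M inner (\<lambda>j. A (x j)) y \<le> tens I M b x x + tens I M c y y"
proof -
  obtain C where C: "\<forall>j\<in>I. \<forall>l\<in>I. M j l = (\<Sum>k\<in>I. cnj (C k j) * C k l)"
    using posdef_cholesky assms by blast
  have "2 * tens I M inner (\<lambda>j. A (x j)) y =
      (\<Sum>k\<in>I. 2 * inner (A (\<Sum>l\<in>I. scaleC (C k l) (x l))) (\<Sum>j\<in>I. scaleC (C k j) (y j)))"
    unfolding tens_cholesky[OF pairing_inner C]
    using assms(3) by (simp add: clin_sum clin_scaleC sum_distrib_left)
  also have "\<dots> \<le> tens I M b x x + tens I M c y y"
    unfolding tens_cholesky[OF \<open>pairing b\<close> C] tens_cholesky[OF \<open>pairing c\<close> C] sum.distrib[symmetric]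
    by (intro sum_mono le)
  finally show ?thesis .
qed

lemma tens_unit_scale:
  assumes "pairing b" "cmod c = 1"
  shows "tens I M b (\<lambda>j. scaleC c (x j)) (\<lambda>j. scaleC c (y j)) = tens I M b x y"
proof -
  have c: "c * cnj c = 1"
    using complex_norm_square[of c] assms by simp
  have "b (scaleC (M j l) (scaleC c (x l))) (scaleC c (y j)) = b (scaleC (M j l) (x l)) (y j)" for j l
  proof -
    have "b (scaleC (M j l) (scaleC c (x l))) (scaleC c (y j)) =
        b (scaleC (cnj c) (scaleC (M j l) (scaleC c (x l)))) (y j)"
      by (simp add: pairing_scaleC[OF assms(1), of "cnj c"])
    also have "scaleC (cnj c) (scaleC (M j l) (scaleC c (x l))) = scaleC (c * cnj c * M j l) (x l)"
      by (simp add: scaleC_scaleC mult_ac)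
    finally show ?thesis
      by (simp add: c)
  qed
  then show ?thesis
    by (simp add: tens_def)
qed

section \<open>The positivity theorem\<close>

text \<open>
  The form \<open>b\<close> tensored with the inner product of the space \<open>L\<^sup>2\<close> of vector functions on \<open>N\<close> nodes
  with matrix density \<open>M\<close>; the vector functions take values in tuples of Hilbert space elements.
\<close>

definition field_form :: "nat \<Rightarrow> 'i set \<Rightarrow> (nat \<Rightarrow> 'i \<Rightarrow> 'i \<Rightarrow> complex) \<Rightarrow> ('h::chilbert_space \<Rightarrow> 'h \<Rightarrow> real) \<Rightarrow>
    (nat \<Rightarrow> 'i \<Rightarrow> 'h) \<Rightarrow> (nat \<Rightarrow> 'i \<Rightarrow> 'h) \<Rightarrow> real"
  where "field_form N I M b x y = (\<Sum>i<N. tens I (M i) b (x i) (y i))"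

lemma field_form_add_left: "pairing b \<Longrightarrow> field_form N I M b (\<lambda>i j. x i j + x' i j) y =
    field_form N I M b x y + field_form N I M b x' y"
  by (simp add: field_form_def tens_add_left sum.distrib)

lemma field_form_add_right: "pairing b \<Longrightarrow> field_form N I M b x (\<lambda>i j. y i j + y' i j) =
    field_form N I M b x y + field_form N I M b x y'"
  by (simp add: field_form_def tens_add_right sum.distrib)

lemma field_form_diff_left: "pairing b \<Longrightarrow> field_form N I M b (\<lambda>i j. x i j - x' i j) y =
    field_form N I M b x y - field_form N I M b x' y"
  by (simp add: field_form_def tens_diff_left sum_subtractf)

lemma field_form_diff_right: "pairing b \<Longrightarrow> field_form N I M b x (\<lambda>i j. y i j - y' i j) =
    field_form N I M b x y - field_form N I M b x y'"
  by (simp add: field_form_def tens_diff_right sum_subtractf)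

text \<open>
  Here \<open>e\<close> is the orthogonal projection of \<open>x\<close> to the constant functions. It does not depend
  on \<open>b\<close>, because it is given by a scalar matrix.
\<close>

lemma field_form_const:
  assumes b: "pairing b" and "finite I" and M: "\<And>j l. j \<in> I \<Longrightarrow> l \<in> I \<Longrightarrow> (\<Sum>i<N. Mf i j l) = M j l"
    and e: "\<And>j. j \<in> I \<Longrightarrow> (\<Sum>k\<in>I. scaleC (M j k) (e k)) = (\<Sum>i<N. \<Sum>l\<in>I. scaleC (Mf i j l) (x i l))"
  shows "field_form N I Mf b x (\<lambda>_. d) = tens I M b e d"
proof -
  have "field_form N I Mf b x (\<lambda>_. d) = (\<Sum>j\<in>I. b (\<Sum>i<N. \<Sum>l\<in>I. scaleC (Mf i j l) (x i l)) (d j))"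
    unfolding field_form_def tens_def
    by (subst sum.swap) (simp add: pairing_sum_left[OF b])
  also have "\<dots> = tens I M b e d"
    by (simp add: tens_def e[symmetric] pairing_sum_left[OF b])
  finally show ?thesis .
qed

text \<open>
  Amalgamate the two \<open>L\<^sup>2\<close> spaces with densities \<open>Mf\<close> and \<open>Mg\<close> over their common subspace of
  constants, on which both induce \<open>M\<close>. There the vector \<open>h + x1 + x2\<close> has the component \<open>h + x1 + e2\<close> in
  the first space, and \<open>x2 - e2\<close> in the complement of the constants in the second one. The identity is
  the theorem of Pythagoras; the right hand side is the square of \<open>h + x1 + x2\<close>, so it is symmetric in
  the two spaces.
\<close>

lemma field_form_split:
  assumes b: "pairing b" "\<And>u v. b u v = b v u" and I: "finite I"
    and Mf: "\<And>j l. j \<in> I \<Longrightarrow> l \<in> I \<Longrightarrow> (\<Sum>i<N. Mf i j l) = M j l"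
    and Mg: "\<And>j l. j \<in> I \<Longrightarrow> l \<in> I \<Longrightarrow> (\<Sum>i<N. Mg i j l) = M j l"
    and hf: "\<And>i j l. i < N \<Longrightarrow> j \<in> I \<Longrightarrow> l \<in> I \<Longrightarrow> Mf i l j = cnj (Mf i j l)"
    and hg: "\<And>i j l. i < N \<Longrightarrow> j \<in> I \<Longrightarrow> l \<in> I \<Longrightarrow> Mg i l j = cnj (Mg i j l)"
    and e1: "\<And>j. j \<in> I \<Longrightarrow> (\<Sum>k\<in>I. scaleC (M j k) (e1 k)) = (\<Sum>i<N. \<Sum>l\<in>I. scaleC (Mf i j l) (x1 i l))"
    and e2: "\<And>j. j \<in> I \<Longrightarrow> (\<Sum>k\<in>I. scaleC (M j k) (e2 k)) = (\<Sum>i<N. \<Sum>l\<in>I. scaleC (Mg i j l) (x2 i l))"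
  shows "field_form N I Mf b (\<lambda>i j. h j + x1 i j + e2 j) (\<lambda>i j. h j + x1 i j + e2 j) +
      field_form N I Mg b (\<lambda>i j. x2 i j - e2 j) (\<lambda>i j. x2 i j - e2 j) =
    tens I M b h h + 2 * tens I M b e1 h + 2 * tens I M b e2 h + 2 * tens I M b e1 e2 +
    field_form N I Mf b x1 x1 + field_form N I Mg b x2 x2"
proof -
  have symf: "field_form N I Mf b x y = field_form N I Mf b y x" for x y
    unfolding field_form_def by (intro sum.cong refl tens_sym[OF b] hf) auto
  have symg: "field_form N I Mg b x y = field_form N I Mg b y x" for x y
    unfolding field_form_def by (intro sum.cong refl tens_sym[OF b] hg) auto
  have hM: "M l j = cnj (M j l)" if "j \<in> I" "l \<in> I" for j l
  proof -
    have "M l j = (\<Sum>i<N. Mf i l j)"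
      using Mf[of l j] that by simp
    also have "\<dots> = (\<Sum>i<N. cnj (Mf i j l))"
      by (intro sum.cong refl hf) (use that in auto)
    also have "\<dots> = cnj (M j l)"
      using that by (simp add: Mf flip: cnj_sum)
    finally show ?thesis .
  qed
  have symM: "tens I M b x y = tens I M b y x" for x y
    by (rule tens_sym[OF b hM])
  have mean: "(\<Sum>k\<in>I. scaleC (M j k) (d k)) = (\<Sum>i<N. \<Sum>l\<in>I. scaleC (K i j l) (d l))"
    if "\<And>j l. j \<in> I \<Longrightarrow> l \<in> I \<Longrightarrow> (\<Sum>i<N. K i j l) = M j l" "j \<in> I" for K d j
    by (subst sum.swap) (simp add: that flip: scaleC_sum_left)
  have cf: "field_form N I Mf b (\<lambda>_. d) (\<lambda>_. d') = tens I M b d d'" for d d'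
    by (rule field_form_const[OF b(1) I Mf mean[OF Mf]])
  have cg: "field_form N I Mg b (\<lambda>_. d) (\<lambda>_. d') = tens I M b d d'" for d d'
    by (rule field_form_const[OF b(1) I Mg mean[OF Mg]])
  have x1: "field_form N I Mf b x1 (\<lambda>_. d) = tens I M b e1 d" for d
    by (rule field_form_const[OF b(1) I Mf e1])
  have x2: "field_form N I Mg b x2 (\<lambda>_. d) = tens I M b e2 d" for d
    by (rule field_form_const[OF b(1) I Mg e2])
  show ?thesis
    unfolding field_form_add_left[OF b(1)] field_form_add_right[OF b(1)]
      field_form_diff_left[OF b(1)] field_form_diff_right[OF b(1)]
    using symf[of "\<lambda>_. h" x1] symf[of "\<lambda>_. e2" x1] symM[of e2 h] symg[of "\<lambda>_. e2" x2]
    by (simp add: cf cg x1 x2)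
qed

lemma tens_cong: "(\<And>j. j \<in> I \<Longrightarrow> x j = x' j) \<Longrightarrow> tens I M b x y = tens I M b x' y"
  by (simp add: tens_def)

lemma field_form_minus: "field_form N I M (\<lambda>u v. b u v - c u v) x y = field_form N I M b x y - field_form N I M c x y"
  by (simp add: field_form_def tens_minus sum_subtractf)

lemma field_form_nonneg:
  assumes "finite I" "\<And>i. i < N \<Longrightarrow> posdef I (M i)" "pairing b" "\<And>u. 0 \<le> b u u"
  shows "0 \<le> field_form N I M b x x"
  unfolding field_form_def using assms by (intro sum_nonneg tens_nonneg) auto

lemma field_form_dominated:
  assumes "finite I" "\<And>i. i < N \<Longrightarrow> posdef I (M i)" "clin A" "pairing b" "pairing c"
    and le: "\<And>u v. 2 * inner (A u) v \<le> b u u + c v v"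
    and \<zeta>: "\<And>i. i < N \<Longrightarrow> cmod (\<zeta> i) = 1"
    and z: "\<And>i j. i < N \<Longrightarrow> j \<in> I \<Longrightarrow> z i j = scaleC (\<zeta> i) (A (x i j))"
  shows "2 * field_form N I M inner z y \<le> field_form N I M b x x + field_form N I M c y y"
  unfolding field_form_def sum_distrib_left sum.distrib[symmetric]
proof (intro sum_mono)
  fix i assume "i \<in> {..<N}"
  then have i: "i < N" by simp
  have "tens I (M i) inner (z i) (y i) = tens I (M i) inner (\<lambda>j. A (scaleC (\<zeta> i) (x i j))) (y i)"
    by (rule tens_cong) (simp add: z[OF i] clin_scaleC[OF assms(3)])
  moreover have "tens I (M i) b (x i) (x i) = tens I (M i) b (\<lambda>j. scaleC (\<zeta> i) (x i j)) (\<lambda>j. scaleC (\<zeta> i) (x i j))"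
    using tens_unit_scale[OF assms(4) \<zeta>[OF i]] by metis
  ultimately show "2 * tens I (M i) inner (z i) (y i) \<le> tens I (M i) b (x i) (x i) + tens I (M i) c (y i) (y i)"
    using tens_dominated[OF assms(1) assms(2)[OF i] assms(3-5) le] by metis
qed

text \<open>
  In the amalgamated space behind \<open>field_form_split\<close> put \<open>x = h + x1 + x2\<close>. Multiplication
  by the coordinate on one factor and the identity on the complement of the other factor
  give unitaries \<open>Z\<close>, \<open>W\<close> of the scalar space, and \<open>A B = B A = 0\<close> gives \<open>x = h + T x\<close> with
  \<open>T = Z \<otimes> A + W \<otimes> B\<close>. The claim is \<open>\<parallel>x\<parallel>\<^sup>2 - \<parallel>T x\<parallel>\<^sup>2 \<ge> 0\<close>, so \<open>T\<close> must be a contraction although \<open>Z\<close> and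
  \<open>W\<close> need not commute. The splitting forms achieve this, since they do not see unitaries of the scalar space:
  \<open>2 \<parallel>T x\<parallel>\<^sup>2 \<le> (q x + p (T x)) + (r x + s (T x)) = \<parallel>x\<parallel>\<^sup>2 + \<parallel>T x\<parallel>\<^sup>2\<close>. The proof carries this out in components.
\<close>

theorem two_field_positivity:
  fixes A B :: "'h::chilbert_space \<Rightarrow> 'h"
  assumes A: "clin A" and B: "clin B" and AB: "\<And>x. A (B x) = 0" and BA: "\<And>x. B (A x) = 0"
    and contr: "\<And>\<omega> u. cmod \<omega> = 1 \<Longrightarrow> norm (A u + scaleC \<omega> (B u)) \<le> norm u"
    and I: "finite I" and M: "posdef I M"
    and Mf: "\<And>i. i < N \<Longrightarrow> posdef I (Mf i)" "\<And>j l. j \<in> I \<Longrightarrow> l \<in> I \<Longrightarrow> (\<Sum>i<N. Mf i j l) = M j l"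
    and Mg: "\<And>i. i < N \<Longrightarrow> posdef I (Mg i)" "\<And>j l. j \<in> I \<Longrightarrow> l \<in> I \<Longrightarrow> (\<Sum>i<N. Mg i j l) = M j l"
    and \<zeta>: "\<And>i. i < N \<Longrightarrow> cmod (\<zeta> i) = 1"
    and x1: "\<And>i j. i < N \<Longrightarrow> j \<in> I \<Longrightarrow> x1 i j = scaleC (\<zeta> i) (A (h j + x1 i j))"
    and x2: "\<And>i j. i < N \<Longrightarrow> j \<in> I \<Longrightarrow> x2 i j = scaleC (\<zeta> i) (B (h j + x2 i j))"
  shows "0 \<le> tens I M inner h h + 2 * field_form N I Mf inner x1 (\<lambda>_. h) + 2 * field_form N I Mg inner x2 (\<lambda>_. h)"
proof -
  obtain L where L: "\<And>j l. j \<in> I \<Longrightarrow> (\<Sum>k\<in>I. M j k * L k l) = (if j = l then 1 else 0)"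
    using posdef_inverse[OF I M] by blast
  define solve where "solve y k = (\<Sum>l\<in>I. scaleC (L k l) (y l))" for y :: "'a \<Rightarrow> 'h" and k
  have solve: "(\<Sum>k\<in>I. scaleC (M j k) (solve y k)) = y j" if j: "j \<in> I" for y j
  proof -
    have "(\<Sum>k\<in>I. scaleC (M j k) (solve y k)) = (\<Sum>l\<in>I. scaleC (\<Sum>k\<in>I. M j k * L k l) (y l))"
      unfolding solve_def scaleC_sum_right scaleC_sum_left scaleC_scaleC by (rule sum.swap)
    also have "\<dots> = (\<Sum>l\<in>I. if j = l then y l else 0)"
      by (intro sum.cong refl) (simp add: L[OF j])
    finally show ?thesis
      using I j by simp
  qed
  have clin_solve: "T (solve y k) = solve (\<lambda>l. T (y l)) k" if "clin T" for T y k
    by (simp add: solve_def clin_sum[OF that] clin_scaleC[OF that])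
  \<comment> \<open>Projections of \<open>x1\<close> and \<open>x2\<close> to the constants; \<open>A e2 = 0\<close> because \<open>A\<close> commutes with scalar matrices and annihilates \<open>x2\<close>.\<close>
  define e1 where "e1 = solve (\<lambda>j. \<Sum>i<N. \<Sum>l\<in>I. scaleC (Mf i j l) (x1 i l))"
  define e2 where "e2 = solve (\<lambda>j. \<Sum>i<N. \<Sum>l\<in>I. scaleC (Mg i j l) (x2 i l))"
  have e1: "(\<Sum>k\<in>I. scaleC (M j k) (e1 k)) = (\<Sum>i<N. \<Sum>l\<in>I. scaleC (Mf i j l) (x1 i l))" if "j \<in> I" for j
    unfolding e1_def using that by (rule solve)
  have e2: "(\<Sum>k\<in>I. scaleC (M j k) (e2 k)) = (\<Sum>i<N. \<Sum>l\<in>I. scaleC (Mg i j l) (x2 i l))" if "j \<in> I" for j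
    unfolding e2_def using that by (rule solve)
  have Ax2: "A (x2 i l) = 0" if "i < N" "l \<in> I" for i l
    by (subst x2[OF that]) (simp add: clin_scaleC[OF A] AB)
  have Bx1: "B (x1 i l) = 0" if "i < N" "l \<in> I" for i l
    by (subst x1[OF that]) (simp add: clin_scaleC[OF B] BA)
  have Ae2: "A (e2 k) = 0" for k
    unfolding e2_def clin_solve[OF A] by (simp add: clin_sum[OF A] clin_scaleC[OF A] Ax2) (simp add: solve_def)
  have Be1: "B (e1 k) = 0" for k
    unfolding e1_def clin_solve[OF B] by (simp add: clin_sum[OF B] clin_scaleC[OF B] Bx1) (simp add: solve_def)
  obtain q s where q: "pairing q" "\<And>u v. q u v = q v u" and s: "pairing s" "\<And>u v. s u v = s v u"
    and q0: "\<And>u. 0 \<le> q u u" and q1: "\<And>u. q u u \<le> inner u u"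
    and s0: "\<And>u. 0 \<le> s u u" and s1: "\<And>u. s u u \<le> inner u u"
    and Adom: "\<And>u v. 2 * inner (A u) v \<le> q u u + (inner v v - s v v)"
    and Bdom: "\<And>u v. 2 * inner (B u) v \<le> (inner u u - q u u) + s v v"
    using splitting_forms[OF A B contr] by blast
  define r where "r = (\<lambda>u v. inner u v - q u v)"
  define p where "p = (\<lambda>u v. inner u v - s u v)"
  have r: "pairing r" "\<And>u v. r u v = r v u" and r0: "\<And>u. 0 \<le> r u u"
    using q q1 by (auto simp: r_def pairing_minus pairing_inner inner_commute)
  have p: "pairing p" "\<And>u v. p u v = p v u" and p0: "\<And>u. 0 \<le> p u u"
    using s s1 by (auto simp: p_def pairing_minus pairing_inner inner_commute)
  \<comment> \<open>Components of \<open>x\<close> and \<open>T x\<close> in the two \<open>L\<^sup>2\<close> spaces.\<close>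
  define \<xi> where "\<xi> = (\<lambda>i j. h j + x1 i j + e2 j)"
  define \<eta> where "\<eta> = (\<lambda>i j. 0 + x1 i j + e2 j)"
  define \<xi>' where "\<xi>' = (\<lambda>i j. h j + x2 i j + e1 j)"
  define \<eta>' where "\<eta>' = (\<lambda>i j. 0 + x2 i j + e1 j)"
  have dom1: "2 * field_form N I Mf inner x1 \<eta> \<le> field_form N I Mf q \<xi> \<xi> + field_form N I Mf p \<eta> \<eta>"
  proof (rule field_form_dominated[OF I Mf(1) A q(1) p(1) _ \<zeta>])
    show "2 * inner (A u) v \<le> q u u + p v v" for u v
      using Adom by (simp add: p_def)
    show "x1 i j = scaleC (\<zeta> i) (A (\<xi> i j))" if "i < N" "j \<in> I" for i j
      using x1[OF that] by (simp add: \<xi>_def clin_add[OF A] Ae2)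
  qed auto
  have dom2: "2 * field_form N I Mg inner x2 \<eta>' \<le> field_form N I Mg r \<xi>' \<xi>' + field_form N I Mg s \<eta>' \<eta>'"
  proof (rule field_form_dominated[OF I Mg(1) B r(1) s(1) _ \<zeta>])
    show "2 * inner (B u) v \<le> r u u + s v v" for u v
      using Bdom by (simp add: r_def)
    show "x2 i j = scaleC (\<zeta> i) (B (\<xi>' i j))" if "i < N" "j \<in> I" for i j
      using x2[OF that] by (simp add: \<xi>'_def clin_add[OF B] Be1)
  qed auto
  have hf: "Mf i l j = cnj (Mf i j l)" and hg: "Mg i l j = cnj (Mg i j l)" if "i < N" "j \<in> I" "l \<in> I" for i j l
    by (rule posdef_herm[OF Mf(1)[OF that(1)] that(2,3)], rule posdef_herm[OF Mg(1)[OF that(1)] that(2,3)])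
  have split1: "field_form N I Mf b (\<lambda>i j. k j + x1 i j + e2 j) (\<lambda>i j. k j + x1 i j + e2 j) +
      field_form N I Mg b (\<lambda>i j. x2 i j - e2 j) (\<lambda>i j. x2 i j - e2 j) =
      tens I M b k k + 2 * tens I M b e1 k + 2 * tens I M b e2 k + 2 * tens I M b e1 e2 +
      field_form N I Mf b x1 x1 + field_form N I Mg b x2 x2"
    if "pairing b" "\<And>u v. b u v = b v u" for b k
    by (rule field_form_split[OF that I Mf(2) Mg(2) hf hg e1 e2])
  have split2: "field_form N I Mg b (\<lambda>i j. k j + x2 i j + e1 j) (\<lambda>i j. k j + x2 i j + e1 j) +
      field_form N I Mf b (\<lambda>i j. x1 i j - e1 j) (\<lambda>i j. x1 i j - e1 j) =
      tens I M b k k + 2 * tens I M b e2 k + 2 * tens I M b e1 k + 2 * tens I M b e2 e1 +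
      field_form N I Mg b x2 x2 + field_form N I Mf b x1 x1"
    if "pairing b" "\<And>u v. b u v = b v u" for b k
    by (rule field_form_split[OF that I Mg(2) Mf(2) hg hf e2 e1])
  have nonneg_f: "0 \<le> field_form N I Mf b x x" if "pairing b" "\<And>u. 0 \<le> b u u" for b x
    by (rule field_form_nonneg[OF I Mf(1) that])
  have nonneg_g: "0 \<le> field_form N I Mg b x x" if "pairing b" "\<And>u. 0 \<le> b u u" for b x
    by (rule field_form_nonneg[OF I Mg(1) that])
  \<comment> \<open>By Pythagoras the component is no larger than the whole vector, in each of the four forms.\<close>
  have sq: "field_form N I Mf q \<xi> \<xi> \<le> tens I M q h h + 2 * tens I M q e1 h + 2 * tens I M q e2 h +
      2 * tens I M q e1 e2 + field_form N I Mf q x1 x1 + field_form N I Mg q x2 x2"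
    using split1[OF q, of h] nonneg_g[OF q(1) q0, of "\<lambda>i j. x2 i j - e2 j"]
    unfolding \<xi>_def by linarith
  have sp: "field_form N I Mf p \<eta> \<eta> \<le> tens I M p (\<lambda>_. 0) (\<lambda>_. 0) + 2 * tens I M p e1 (\<lambda>_. 0) + 2 * tens I M p e2 (\<lambda>_. 0) +
      2 * tens I M p e1 e2 + field_form N I Mf p x1 x1 + field_form N I Mg p x2 x2"
    using split1[OF p, of "\<lambda>_. 0"] nonneg_g[OF p(1) p0, of "\<lambda>i j. x2 i j - e2 j"]
    unfolding \<eta>_def by linarith
  have sr: "field_form N I Mg r \<xi>' \<xi>' \<le> tens I M r h h + 2 * tens I M r e2 h + 2 * tens I M r e1 h +
      2 * tens I M r e2 e1 + field_form N I Mg r x2 x2 + field_form N I Mf r x1 x1"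
    using split2[OF r, of h] nonneg_f[OF r(1) r0, of "\<lambda>i j. x1 i j - e1 j"]
    unfolding \<xi>'_def by linarith
  have ss: "field_form N I Mg s \<eta>' \<eta>' \<le> tens I M s (\<lambda>_. 0) (\<lambda>_. 0) + 2 * tens I M s e2 (\<lambda>_. 0) + 2 * tens I M s e1 (\<lambda>_. 0) +
      2 * tens I M s e2 e1 + field_form N I Mg s x2 x2 + field_form N I Mf s x1 x1"
    using split2[OF s, of "\<lambda>_. 0"] nonneg_f[OF s(1) s0, of "\<lambda>i j. x1 i j - e1 j"]
    unfolding \<eta>'_def by linarith
  have zero: "tens I M b x (\<lambda>_. 0) = 0" if "pairing b" for b x
    by (simp add: tens_def pairing_zero_right[OF that])
  note const_f = field_form_const[OF pairing_inner I Mf(2) e1]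
  note const_g = field_form_const[OF pairing_inner I Mg(2) e2]
  have lhs1: "field_form N I Mf inner x1 \<eta> = field_form N I Mf inner x1 x1 + tens I M inner e1 e2"
    unfolding \<eta>_def by (simp add: field_form_add_right[OF pairing_inner] const_f)
  have lhs2: "field_form N I Mg inner x2 \<eta>' = field_form N I Mg inner x2 x2 + tens I M inner e2 e1"
    unfolding \<eta>'_def by (simp add: field_form_add_right[OF pairing_inner] const_g)
  have hM: "M l j = cnj (M j l)" if "j \<in> I" "l \<in> I" for j l
    using that by (rule posdef_herm[OF M])
  have symi: "tens I M inner e2 e1 = tens I M inner e1 e2"
    by (rule tens_sym[OF pairing_inner inner_commute hM])
  have symq: "tens I M q e2 e1 = tens I M q e1 e2"
    by (rule tens_sym[OF q hM])
  have syms: "tens I M s e2 e1 = tens I M s e1 e2"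
    by (rule tens_sym[OF s hM])
  have tf: "field_form N I Mf inner x1 (\<lambda>_. h) = tens I M inner e1 h"
    by (rule const_f)
  have tg: "field_form N I Mg inner x2 (\<lambda>_. h) = tens I M inner e2 h"
    by (rule const_g)
  show ?thesis
    using dom1 dom2 sq sp sr ss
    unfolding lhs1 lhs2 zero[OF p(1)] zero[OF s(1)] tf tg
    unfolding r_def p_def tens_minus field_form_minus symi symq syms
    by argo
qed

section \<open>Matrix polynomials\<close>

definition matpoly :: "nat \<Rightarrow> (nat \<Rightarrow> nat \<Rightarrow> nat \<Rightarrow> complex) \<Rightarrow> complex \<Rightarrow> nat \<Rightarrow> nat \<Rightarrow> complex"
  where "matpoly d f z j l = (\<Sum>k\<le>d. f k j l * z ^ k)"

definition contraction_by :: "real \<Rightarrow> nat \<Rightarrow> (nat \<Rightarrow> nat \<Rightarrow> complex) \<Rightarrow> bool"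
  where "contraction_by \<kappa> n F \<longleftrightarrow>
    (\<forall>u. (\<Sum>j<n. (cmod (\<Sum>l<n. F j l * u l))\<^sup>2) \<le> \<kappa>\<^sup>2 * (\<Sum>l<n. (cmod (u l))\<^sup>2))"

text \<open>
  The matrix with rows \<open>(1, F)\<close> and \<open>(F\<^sup>*, 1)\<close>, the upper block being indexed by \<open>True\<close>. It turns
  contractivity of \<open>F\<close> into positivity.
\<close>

definition block :: "(nat \<Rightarrow> nat \<Rightarrow> complex) \<Rightarrow> bool \<times> nat \<Rightarrow> bool \<times> nat \<Rightarrow> complex"
  where "block F p q = (if fst p = fst q then (if snd p = snd q then 1 else 0)
    else if fst p then F (snd p) (snd q) else cnj (F (snd q) (snd p)))"

abbreviation block_index :: "nat \<Rightarrow> (bool \<times> nat) set"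
  where "block_index n \<equiv> UNIV \<times> {..<n}"

lemma sum_block_index:
  "(\<Sum>p\<in>block_index n. g p) = (\<Sum>j<n. g (True, j)) + (\<Sum>j<n. g (False, j))"
proof -
  have "(\<Sum>p\<in>block_index n. g p) = (\<Sum>b\<in>UNIV. \<Sum>j<n. g (b, j))"
    by (simp add: sum.cartesian_product)
  then show ?thesis
    by (simp add: UNIV_bool add.commute)
qed

lemma contraction_by_entry:
  assumes "contraction_by \<kappa> n F" "0 \<le> \<kappa>" "\<kappa> \<le> 1" "j < n" "l < n"
  shows "cmod (F j l) \<le> 1"
proof -
  have delta: "(\<Sum>m<n. F i m * (if m = l then 1 else 0)) = F i l" for i
    using assms by (simp add: if_distrib cong: if_cong)
  have "(cmod (F j l))\<^sup>2 \<le> (\<Sum>i<n. (cmod (F i l))\<^sup>2)"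
    using assms by (intro member_le_sum) auto
  also have "\<dots> \<le> \<kappa>\<^sup>2 * (\<Sum>m<n. (cmod (if m = l then 1 else 0))\<^sup>2)"
    using assms(1)[unfolded contraction_by_def, rule_format, of "\<lambda>m. if m = l then 1 else 0"]
    unfolding delta .
  also have "(\<Sum>m<n. (cmod (if m = l then 1 else 0))\<^sup>2) = (\<Sum>m<n. if m = l then 1 else 0)"
    by (intro sum.cong) auto
  also have "\<kappa>\<^sup>2 * \<dots> \<le> 1\<^sup>2"
    using assms by (simp add: power_le_one)
  finally show ?thesis
    by (rule power2_le_imp_le) simp
qed

text \<open>
  The cross term is at most \<open>\<kappa>\<close> times the diagonal terms, by the weighted inequality
  \<open>2 a w \<le> \<kappa> a\<^sup>2 + w\<^sup>2 / \<kappa>\<close>. Strictness keeps the matrix invertible.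
\<close>

lemma block_posdef:
  assumes F: "contraction_by \<kappa> n F" and \<kappa>: "0 < \<kappa>" "\<kappa> < 1"
  shows "posdef (block_index n) (block F)"
  unfolding posdef_def
proof (intro conjI ballI allI impI)
  show "block F q p = cnj (block F p q)" for p q
    by (auto simp: block_def)
next
  fix u :: "bool \<times> nat \<Rightarrow> complex"
  assume ex: "\<exists>p\<in>block_index n. u p \<noteq> 0"
  define a where "a j = u (True, j)" for j
  define b where "b j = u (False, j)" for j
  define w where "w j = (\<Sum>l<n. F j l * b l)" for j
  define Sa where "Sa = (\<Sum>j<n. (cmod (a j))\<^sup>2)"
  define Sb where "Sb = (\<Sum>j<n. (cmod (b j))\<^sup>2)"
  have dl: "(\<Sum>l<n. cnj (v j) * (if j = l then 1 else 0) * v l) = cnj (v j) * v j" if "j < n" for v :: "nat \<Rightarrow> complex" and j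
  proof -
    have "(\<Sum>l<n. cnj (v j) * (if j = l then 1 else 0) * v l) = (\<Sum>l<n. if j = l then cnj (v j) * v l else 0)"
      by (intro sum.cong) auto
    then show ?thesis using that by simp
  qed
  have "(\<Sum>p\<in>block_index n. \<Sum>q\<in>block_index n. cnj (u p) * block F p q * u q) =
    (\<Sum>j<n. cnj (a j) * a j) + (\<Sum>j<n. cnj (a j) * w j) +
    ((\<Sum>j<n. \<Sum>l<n. cnj (b j) * cnj (F l j) * a l) + (\<Sum>j<n. cnj (b j) * b j))"
    unfolding sum_block_index
    by (simp add: block_def sum.distrib dl[unfolded a_def b_def] w_def sum_distrib_left mult.assoc
        flip: a_def b_def) (simp add: dl[simplified mult.assoc])
  also have "(\<Sum>j<n. \<Sum>l<n. cnj (b j) * cnj (F l j) * a l) = cnj (\<Sum>j<n. cnj (a j) * w j)"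
    by (subst sum.swap) (simp add: w_def sum_distrib_left mult_ac)
  also have "(\<Sum>j<n. cnj (a j) * a j) = complex_of_real Sa"
    by (simp add: Sa_def mult.commute[of "cnj _"] flip: complex_norm_square)
  also have "(\<Sum>j<n. cnj (b j) * b j) = complex_of_real Sb"
    by (simp add: Sb_def mult.commute[of "cnj _"] flip: complex_norm_square)
  finally have form: "Re (\<Sum>p\<in>block_index n. \<Sum>q\<in>block_index n. cnj (u p) * block F p q * u q) =
      Sa + Sb + 2 * Re (\<Sum>j<n. cnj (a j) * w j)"
    by simp
  have "\<bar>2 * Re (\<Sum>j<n. cnj (a j) * w j)\<bar> \<le> 2 * cmod (\<Sum>j<n. cnj (a j) * w j)"
    using abs_Re_le_cmod[of "\<Sum>j<n. cnj (a j) * w j"] by (simp only: abs_mult abs_numeral)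
  also have "\<dots> \<le> 2 * (\<Sum>j<n. cmod (a j) * cmod (w j))"
    using norm_sum[of "\<lambda>j. cnj (a j) * w j" "{..<n}"] by (simp add: norm_mult)
  also have "\<dots> \<le> (\<Sum>j<n. \<kappa> * (cmod (a j))\<^sup>2 + (cmod (w j))\<^sup>2 / \<kappa>)"
    unfolding sum_distrib_left
  proof (intro sum_mono)
    fix j
    have "0 \<le> (\<kappa> * cmod (a j) - cmod (w j))\<^sup>2 / \<kappa>"
      using \<kappa> by simp
    also have "\<dots> = \<kappa> * (cmod (a j))\<^sup>2 + (cmod (w j))\<^sup>2 / \<kappa> - 2 * (cmod (a j) * cmod (w j))"
      using \<kappa> by (simp add: field_simps power2_eq_square)
    finally show "2 * (cmod (a j) * cmod (w j)) \<le> \<kappa> * (cmod (a j))\<^sup>2 + (cmod (w j))\<^sup>2 / \<kappa>"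
      by simp
  qed
  also have "\<dots> = \<kappa> * Sa + (\<Sum>j<n. (cmod (w j))\<^sup>2) / \<kappa>"
    by (simp add: sum.distrib Sa_def sum_distrib_left sum_divide_distrib)
  also have "(\<Sum>j<n. (cmod (w j))\<^sup>2) / \<kappa> \<le> \<kappa> * Sb"
  proof -
    have "(\<Sum>j<n. (cmod (w j))\<^sup>2) \<le> \<kappa>\<^sup>2 * Sb"
      using F by (simp add: contraction_by_def w_def Sb_def)
    then show ?thesis
      using \<kappa> by (simp add: pos_divide_le_eq power2_eq_square mult_ac)
  qed
  finally have cross: "\<bar>2 * Re (\<Sum>j<n. cnj (a j) * w j)\<bar> \<le> \<kappa> * (Sa + Sb)"
    by (simp add: distrib_left)
  have "0 < Sa + Sb"
  proof -
    obtain c j where cj: "j < n" "u (c, j) \<noteq> 0"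
      using ex by auto
    have "0 < (\<Sum>j<n. (cmod (a j))\<^sup>2 + (cmod (b j))\<^sup>2)"
    proof (rule sum_pos2[of _ j])
      show "0 < (cmod (a j))\<^sup>2 + (cmod (b j))\<^sup>2"
        using cj by (cases c) (auto simp: a_def b_def add_pos_nonneg add_nonneg_pos)
    qed (use cj in auto)
    then show ?thesis
      by (simp add: Sa_def Sb_def sum.distrib)
  qed
  then have "\<kappa> * (Sa + Sb) < 1 * (Sa + Sb)"
    using \<kappa> by (intro mult_strict_right_mono) auto
  then show "0 < Re (\<Sum>p\<in>block_index n. \<Sum>q\<in>block_index n. cnj (u p) * block F p q * u q)"
    unfolding form using abs_le_D2[OF cross] by argo
qed

lemma posdef_sum:
  assumes "finite S" "S \<noteq> {}" and M: "\<And>i. i \<in> S \<Longrightarrow> posdef I (M i)"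
  shows "posdef I (\<lambda>j l. \<Sum>i\<in>S. M i j l)"
  unfolding posdef_def
proof (intro conjI ballI allI impI)
  show "(\<Sum>i\<in>S. M i l j) = cnj (\<Sum>i\<in>S. M i j l)" if "j \<in> I" "l \<in> I" for j l
    unfolding cnj_sum by (intro sum.cong refl posdef_herm[OF M] that)
next
  fix u :: "'b \<Rightarrow> complex"
  assume ex: "\<exists>j\<in>I. u j \<noteq> 0"
  have "(\<Sum>j\<in>I. \<Sum>l\<in>I. cnj (u j) * (\<Sum>i\<in>S. M i j l) * u l) =
      (\<Sum>j\<in>I. \<Sum>l\<in>I. \<Sum>i\<in>S. cnj (u j) * M i j l * u l)"
    by (simp add: sum_distrib_left sum_distrib_right)
  also have "\<dots> = (\<Sum>i\<in>S. \<Sum>j\<in>I. \<Sum>l\<in>I. cnj (u j) * M i j l * u l)"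
    by (rule trans[OF sum.cong[OF refl sum.swap] sum.swap])
  finally have eq: "(\<Sum>j\<in>I. \<Sum>l\<in>I. cnj (u j) * (\<Sum>i\<in>S. M i j l) * u l) = \<dots>" .
  have pos: "0 < Re (\<Sum>j\<in>I. \<Sum>l\<in>I. cnj (u j) * M i j l * u l)" if "i \<in> S" for i
    using M[OF that] ex unfolding posdef_def by blast
  show "0 < Re (\<Sum>j\<in>I. \<Sum>l\<in>I. cnj (u j) * (\<Sum>i\<in>S. M i j l) * u l)"
    unfolding eq by (subst Re_sum) (intro sum_pos assms pos)
qed

lemma posdef_divide:
  assumes M: "posdef I M" and N: "N > 0"
  shows "posdef I (\<lambda>j l. M j l / of_nat N)"
  unfolding posdef_def
proof (intro conjI ballI allI impI)
  show "M l j / of_nat N = cnj (M j l / of_nat N)" if "j \<in> I" "l \<in> I" for j l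
    using posdef_herm[OF M that] by simp
next
  fix u :: "'a \<Rightarrow> complex"
  assume ex: "\<exists>j\<in>I. u j \<noteq> 0"
  have "(\<Sum>j\<in>I. \<Sum>l\<in>I. cnj (u j) * (M j l / of_nat N) * u l) =
      (\<Sum>j\<in>I. \<Sum>l\<in>I. cnj (u j) * M j l * u l) / of_real (real N)"
    by (simp add: sum_divide_distrib)
  moreover have "0 < Re (\<Sum>j\<in>I. \<Sum>l\<in>I. cnj (u j) * M j l * u l)"
    using M ex unfolding posdef_def by blast
  ultimately show "0 < Re (\<Sum>j\<in>I. \<Sum>l\<in>I. cnj (u j) * (M j l / of_nat N) * u l)"
    using N by (simp only: Re_divide_of_real) simp
qed

section \<open>Sampling at roots of unity\<close>

text \<open>
  The vector \<open>\<zeta> A (1 - \<zeta> A)\<^sup>-\<^sup>1 h\<close> as a fixed point, with the error of the truncated Neumann series.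
\<close>

lemma resolvent_exists:
  fixes A :: "'h::chilbert_space \<Rightarrow> 'h"
  assumes A: "clin A" and \<rho>: "0 \<le> \<rho>" "\<rho> < 1" and contr: "\<And>u. norm (A u) \<le> \<rho> * norm u"
    and \<zeta>: "cmod \<zeta> = 1"
  shows "\<exists>x. x = scaleC \<zeta> (A (h + x)) \<and>
    (\<forall>K. norm (x - (\<Sum>k<K. scaleC (\<zeta> ^ Suc k) ((A ^^ Suc k) h))) \<le> \<rho> ^ K * (norm h / (1 - \<rho>)))"
proof -
  define T where "T x = scaleC \<zeta> (A (h + x))" for x
  have T: "norm (T x - T y) \<le> \<rho> * norm (x - y)" for x y
  proof -
    have "T x - T y = scaleC \<zeta> (A (x - y))"
      by (simp add: T_def clin_add[OF A] clin_diff[OF A] scaleC_add_right scaleC_diff_right)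
    then show ?thesis
      using contr by (simp add: norm_scaleC \<zeta>)
  qed
  then obtain x where x: "T x = x"
    using banach_fix_type[OF \<rho>, of T] by (auto simp: dist_norm)
  have "norm x \<le> \<rho> * norm (h + x)"
    using contr[of "h + x"] x by (metis T_def \<zeta> mult_1 norm_scaleC)
  also have "\<dots> \<le> \<rho> * (norm h + norm x)"
    using \<rho> by (intro mult_left_mono norm_triangle_ineq)
  finally have "norm x * (1 - \<rho>) \<le> \<rho> * norm h"
    by (simp add: algebra_simps)
  also have "\<dots> \<le> norm h"
    using \<rho> by (simp add: mult_left_le_one_le)
  finally have nx: "norm x \<le> norm h / (1 - \<rho>)"
    using \<rho> by (simp add: pos_le_divide_eq)
  define S where "S K = (\<Sum>k<K. scaleC (\<zeta> ^ Suc k) ((A ^^ Suc k) h))" for K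
  have S: "S (Suc K) = T (S K)" for K
  proof -
    have "S (Suc K) = scaleC \<zeta> (A h) + (\<Sum>k<K. scaleC (\<zeta> ^ Suc (Suc k)) ((A ^^ Suc (Suc k)) h))"
      unfolding S_def sum.lessThan_Suc_shift by simp
    also have "\<dots> = T (S K)"
      by (simp add: T_def S_def clin_add[OF A] clin_sum[OF A] clin_scaleC[OF A] scaleC_add_right
          scaleC_sum_right scaleC_scaleC)
    finally show ?thesis .
  qed
  have "norm (x - S K) \<le> \<rho> ^ K * norm x" for K
  proof (induction K)
    case (Suc K)
    have "norm (x - S (Suc K)) \<le> \<rho> * norm (x - S K)"
      using T[of x "S K"] by (simp add: S x)
    also have "\<dots> \<le> \<rho> * (\<rho> ^ K * norm x)"
      using \<rho> Suc by (intro mult_left_mono)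
    finally show ?case by (simp add: mult.assoc)
  qed (simp add: S_def)
  then have "norm (x - S K) \<le> \<rho> ^ K * (norm h / (1 - \<rho>))" for K
    using nx \<rho> by (meson mult_left_mono order_trans zero_le_power)
  then show ?thesis
    using x unfolding T_def S_def by metis
qed

text \<open>
  The weight \<open>1 / N\<close> is included, so that summing over the nodes is taking a mean.
\<close>

definition node_matrix :: "nat \<Rightarrow> nat \<Rightarrow> (nat \<Rightarrow> nat \<Rightarrow> nat \<Rightarrow> complex) \<Rightarrow> nat \<Rightarrow> bool \<times> nat \<Rightarrow> bool \<times> nat \<Rightarrow> complex"
  where "node_matrix N d f i p q = block (matpoly d f (root_node N i)) p q / of_nat N"

lemma sum_root_node_orthogonal:
  "a < N \<Longrightarrow> b < N \<Longrightarrow> (\<Sum>t<N. root_node N t ^ a * cnj (root_node N t ^ b)) = (if a = b then of_nat N else 0)"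
  unfolding root_node_def by (rule sum_roots_of_unity_orthogonal)

lemma matpoly_moment:
  assumes "d < N" "m < N" and f0: "\<And>k. k > d \<Longrightarrow> f k j l = 0"
  shows "(\<Sum>i<N. matpoly d f (root_node N i) j l * cnj (root_node N i ^ m)) = of_nat N * f m j l"
proof -
  have "(\<Sum>i<N. matpoly d f (root_node N i) j l * cnj (root_node N i ^ m)) =
    (\<Sum>k\<le>d. f k j l * (\<Sum>i<N. root_node N i ^ k * cnj (root_node N i ^ m)))"
    unfolding matpoly_def sum_distrib_left sum_distrib_right mult.assoc by (rule sum.swap)
  also have "\<dots> = (\<Sum>k\<le>d. if k = m then of_nat N * f m j l else 0)"
    using assms by (intro sum.cong refl) (simp add: sum_root_node_orthogonal del: complex_cnj_power)
  also have "\<dots> = of_nat N * f m j l"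
    using f0[of m] by auto
  finally show ?thesis .
qed

lemma matpoly_conj_moment:
  assumes "d + m < N" "0 < m"
  shows "(\<Sum>i<N. cnj (matpoly d f (root_node N i) j l) * cnj (root_node N i ^ m)) = 0"
proof -
  have "(\<Sum>i<N. matpoly d f (root_node N i) j l * root_node N i ^ m) =
    (\<Sum>k\<le>d. f k j l * (\<Sum>i<N. root_node N i ^ (k + m) * cnj (root_node N i ^ 0)))"
    unfolding matpoly_def sum_distrib_left sum_distrib_right
    by (subst sum.swap) (simp add: power_add mult_ac)
  also have "\<dots> = 0"
    using assms by (intro sum.neutral ballI) (simp add: sum_root_node_orthogonal del: complex_cnj_power power_0)
  finally have "cnj (\<Sum>i<N. matpoly d f (root_node N i) j l * root_node N i ^ m) = 0"
    by simp
  then show ?thesis by simp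
qed

lemma node_matrix_mean:
  assumes "d < N" "\<And>k j l. k > d \<Longrightarrow> f k j l = 0"
  shows "(\<Sum>i<N. node_matrix N d f i p q) = block (f 0) p q"
proof -
  have m: "(\<Sum>i<N. matpoly d f (root_node N i) j l) = of_nat N * f 0 j l" for j l
    using matpoly_moment[of d N 0 f j l] assms by simp
  have m': "(\<Sum>i<N. cnj (matpoly d f (root_node N i) j l)) = of_nat N * cnj (f 0 j l)" for j l
    using arg_cong[OF m[of j l], of cnj] by simp
  show ?thesis
    unfolding node_matrix_def block_def sum_divide_distrib[symmetric]
    by (cases "fst p"; cases "fst q"; cases "snd p = snd q") (use assms in \<open>simp_all add: m m'\<close>)
qed

text \<open>
  A mean over the nodes against a negative power of the coordinate extracts a Taylor coefficient.
  The diagonal blocks are constant and the adjoint block has only powers of the other sign, so they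
  contribute nothing; \<open>d + K < N\<close> excludes aliasing.
\<close>

lemma node_matrix_moment:
  assumes N: "d + K < N" and k: "k < K" and f0: "\<And>k j l. k > d \<Longrightarrow> f k j l = 0"
  shows "(\<Sum>i<N. node_matrix N d f i p q * cnj (root_node N i) ^ Suc k) =
    (if fst p \<and> \<not> fst q then f (Suc k) (snd p) (snd q) else 0)"
proof -
  have z: "(\<Sum>i<N. cnj (root_node N i ^ Suc k)) = 0"
    using sum_root_node_orthogonal[of 0 N "Suc k"] N k by simp
  have m: "(\<Sum>i<N. matpoly d f (root_node N i) j l * cnj (root_node N i ^ Suc k)) = of_nat N * f (Suc k) j l" for j l
    using N k by (intro matpoly_moment f0) auto
  have m': "(\<Sum>i<N. cnj (matpoly d f (root_node N i) j l) * cnj (root_node N i ^ Suc k)) = 0" for j l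
    using N k by (intro matpoly_conj_moment) auto
  show ?thesis
    unfolding node_matrix_def block_def complex_cnj_power[symmetric] times_divide_eq_left
      sum_divide_distrib[symmetric]
    by (cases "fst p"; cases "fst q"; cases "snd p = snd q")
      (use N in \<open>simp_all add: m m' z del: power_Suc complex_cnj_power\<close>)
qed

lemma tens_block:
  assumes "pairing b"
  shows "tens (block_index n) (block F) b x y =
    (\<Sum>j<n. b (x (True, j)) (y (True, j))) + (\<Sum>j<n. b (x (False, j)) (y (False, j))) +
    (\<Sum>j<n. \<Sum>l<n. b (scaleC (F j l) (x (False, l))) (y (True, j))) +
    (\<Sum>j<n. \<Sum>l<n. b (scaleC (cnj (F l j)) (x (True, l))) (y (False, j)))"
proof -
  have dl: "(\<Sum>l<n. b (scaleC (if j = l then 1 else 0) (v l)) w) = b (v j) w" if "j < n" for v j w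
  proof -
    have "(\<Sum>l<n. b (scaleC (if j = l then 1 else 0) (v l)) w) = (\<Sum>l<n. if j = l then b (v l) w else 0)"
      by (intro sum.cong) (auto simp: pairing_zero_left[OF assms])
    then show ?thesis using that by simp
  qed
  show ?thesis
    unfolding tens_def sum_block_index by (simp add: block_def sum.distrib dl)
qed

lemma field_form_node_bound:
  assumes N: "N > 0" and z: "\<And>i q. i < N \<Longrightarrow> q \<in> block_index n \<Longrightarrow> norm (z i q) \<le> \<epsilon> * c q"
    and F: "\<And>i j l. i < N \<Longrightarrow> j < n \<Longrightarrow> l < n \<Longrightarrow> cmod (matpoly d f (root_node N i) j l) \<le> 1"
  shows "\<bar>field_form N (block_index n) (node_matrix N d f) inner z (\<lambda>_. h)\<bar> \<le>
    \<epsilon> * (\<Sum>p\<in>block_index n. \<Sum>q\<in>block_index n. c q * norm (h p))"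
proof -
  have entry: "cmod (node_matrix N d f i p q) \<le> 1 / real N"
    if "i < N" "p \<in> block_index n" "q \<in> block_index n" for i p q
    using that F[of i "snd p" "snd q"] F[of i "snd q" "snd p"] N
    by (auto simp: node_matrix_def block_def norm_divide divide_simps)
  have "\<bar>field_form N (block_index n) (node_matrix N d f) inner z (\<lambda>_. h)\<bar> \<le>
     (\<Sum>i<N. \<Sum>p\<in>block_index n. \<Sum>q\<in>block_index n. \<bar>inner (scaleC (node_matrix N d f i p q) (z i q)) (h p)\<bar>)"
    unfolding field_form_def tens_def
    by (rule order_trans[OF sum_abs] sum_mono)+ simp
  also have "\<dots> \<le> (\<Sum>i<N. \<Sum>p\<in>block_index n. \<Sum>q\<in>block_index n. 1 / real N * (\<epsilon> * c q) * norm (h p))"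
  proof (intro sum_mono)
    fix i p q assume "i \<in> {..<N}" and pq: "p \<in> block_index n" "q \<in> block_index n"
    then have i: "i < N" by simp
    have "\<bar>inner (scaleC (node_matrix N d f i p q) (z i q)) (h p)\<bar> \<le>
      norm (scaleC (node_matrix N d f i p q) (z i q)) * norm (h p)"
      by (rule Cauchy_Schwarz_ineq2)
    also have "\<dots> \<le> 1 / real N * (\<epsilon> * c q) * norm (h p)"
      unfolding norm_scaleC using entry[OF i pq] z[OF i pq(2)]
      by (intro mult_right_mono mult_mono) auto
    finally show "\<bar>inner (scaleC (node_matrix N d f i p q) (z i q)) (h p)\<bar> \<le> 1 / real N * (\<epsilon> * c q) * norm (h p)" .
  qed
  also have "\<dots> = \<epsilon> * (\<Sum>p\<in>block_index n. \<Sum>q\<in>block_index n. c q * norm (h p))"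
    unfolding sum_constant card_lessThan sum_distrib_left using N by (intro sum.cong refl) simp
  finally show ?thesis .
qed

text \<open>
  Substituting the Neumann series in the form of the node matrices leaves, by the moment formula,
  the functional calculus of \<open>f\<close> without its constant term, paired between the two blocks of \<open>h\<close>. The
  truncation error is geometric, with a constant that does not depend on \<open>N\<close>.
\<close>

lemma node_response:
  fixes A :: "'h::chilbert_space \<Rightarrow> 'h"
  assumes A: "clin A" and \<rho>: "0 \<le> \<rho>" "\<rho> < 1" and contr: "\<And>u. norm (A u) \<le> \<rho> * norm u"
    and f0: "\<And>k j l. k > d \<Longrightarrow> f k j l = 0" and N: "N = d + K + 1"
    and F: "\<And>i j l. i < N \<Longrightarrow> j < n \<Longrightarrow> l < n \<Longrightarrow> cmod (matpoly d f (root_node N i) j l) \<le> 1"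
  shows "\<exists>x. (\<forall>i p. x i p = scaleC (cnj (root_node N i)) (A (h p + x i p))) \<and>
    \<bar>field_form N (block_index n) (node_matrix N d f) inner x (\<lambda>_. h) -
      (\<Sum>k<K. \<Sum>j<n. \<Sum>l<n. inner (scaleC (f (Suc k) j l) ((A ^^ Suc k) (h (False, l)))) (h (True, j)))\<bar>
    \<le> \<rho> ^ K * (\<Sum>p\<in>block_index n. \<Sum>q\<in>block_index n. norm (h q) / (1 - \<rho>) * norm (h p))"
proof -
  let ?I = "block_index n"
  define y where "y i p = (\<Sum>k<K. scaleC (cnj (root_node N i) ^ Suc k) ((A ^^ Suc k) (h p)))" for i p
  have "\<forall>i p. \<exists>x. x = scaleC (cnj (root_node N i)) (A (h p + x)) \<and>
      norm (x - y i p) \<le> \<rho> ^ K * (norm (h p) / (1 - \<rho>))"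
    using resolvent_exists[OF A \<rho> contr] unfolding y_def by (metis complex_mod_cnj norm_root_node)
  then obtain x where x: "\<And>i p. x i p = scaleC (cnj (root_node N i)) (A (h p + x i p))"
    and xy: "\<And>i p. norm (x i p - y i p) \<le> \<rho> ^ K * (norm (h p) / (1 - \<rho>))"
    by metis
  have "field_form N ?I (node_matrix N d f) inner y (\<lambda>_. h) =
    (\<Sum>i<N. \<Sum>p\<in>?I. \<Sum>q\<in>?I. \<Sum>k<K.
      inner (scaleC (node_matrix N d f i p q * cnj (root_node N i) ^ Suc k) ((A ^^ Suc k) (h q))) (h p))"
    unfolding field_form_def tens_def y_def scaleC_sum_right scaleC_scaleC inner_sum_left ..
  also have "\<dots> = (\<Sum>p\<in>?I. \<Sum>q\<in>?I. \<Sum>k<K. \<Sum>i<N.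
      inner (scaleC (node_matrix N d f i p q * cnj (root_node N i) ^ Suc k) ((A ^^ Suc k) (h q))) (h p))"
    by (rule trans[OF sum.swap], rule sum.cong[OF refl], rule trans[OF sum.swap],
        rule sum.cong[OF refl], rule sum.swap)
  also have "\<dots> = (\<Sum>p\<in>?I. \<Sum>q\<in>?I. \<Sum>k<K.
      inner (scaleC (if fst p \<and> \<not> fst q then f (Suc k) (snd p) (snd q) else 0) ((A ^^ Suc k) (h q))) (h p))"
  proof (intro sum.cong refl)
    fix p q k assume "k \<in> {..<K}"
    then have "(\<Sum>i<N. node_matrix N d f i p q * cnj (root_node N i) ^ Suc k) =
        (if fst p \<and> \<not> fst q then f (Suc k) (snd p) (snd q) else 0)"
      by (intro node_matrix_moment f0) (auto simp: N)
    then show "(\<Sum>i<N. inner (scaleC (node_matrix N d f i p q * cnj (root_node N i) ^ Suc k) ((A ^^ Suc k) (h q))) (h p)) =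
      inner (scaleC (if fst p \<and> \<not> fst q then f (Suc k) (snd p) (snd q) else 0) ((A ^^ Suc k) (h q))) (h p)"
      unfolding inner_sum_left[symmetric] scaleC_sum_left[symmetric] by simp
  qed
  also have "\<dots> = (\<Sum>j<n. \<Sum>l<n. \<Sum>k<K. inner (scaleC (f (Suc k) j l) ((A ^^ Suc k) (h (False, l)))) (h (True, j)))"
    unfolding sum_block_index by (simp del: funpow.simps)
  also have "\<dots> = (\<Sum>k<K. \<Sum>j<n. \<Sum>l<n. inner (scaleC (f (Suc k) j l) ((A ^^ Suc k) (h (False, l)))) (h (True, j)))"
    by (rule trans[OF sum.cong[OF refl sum.swap] sum.swap])
  finally have y: "field_form N ?I (node_matrix N d f) inner y (\<lambda>_. h) = \<dots>" .
  have "\<bar>field_form N ?I (node_matrix N d f) inner (\<lambda>i p. x i p - y i p) (\<lambda>_. h)\<bar> \<le>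
    \<rho> ^ K * (\<Sum>p\<in>?I. \<Sum>q\<in>?I. norm (h q) / (1 - \<rho>) * norm (h p))"
    using N by (intro field_form_node_bound xy F) auto
  then show ?thesis
    unfolding field_form_diff_left[OF pairing_inner] y using x by blast
qed

section \<open>Contractivity of the functional calculus\<close>

text \<open>
  The matrix \<open>f(A) + g(B) - f(0)\<close> applied to \<open>h\<close>; the common constant term is counted once.
\<close>

definition pair_calculus :: "nat \<Rightarrow> (nat \<Rightarrow> nat \<Rightarrow> nat \<Rightarrow> complex) \<Rightarrow> (nat \<Rightarrow> nat \<Rightarrow> nat \<Rightarrow> complex) \<Rightarrow>
    ('h::chilbert_space \<Rightarrow> 'h) \<Rightarrow> ('h \<Rightarrow> 'h) \<Rightarrow> nat \<Rightarrow> (nat \<Rightarrow> 'h) \<Rightarrow> nat \<Rightarrow> 'h"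
  where "pair_calculus d f g A B n h j = (\<Sum>l<n. scaleC (f 0 j l) (h l) +
    (\<Sum>k<d. scaleC (f (Suc k) j l) ((A ^^ Suc k) (h l)) + scaleC (g (Suc k) j l) ((B ^^ Suc k) (h l))))"

text \<open>
  Apply the positivity theorem to the block vector with upper part \<open>- X\<close> and lower part \<open>h\<close>, where
  \<open>X\<close> is the image of \<open>h\<close>. In the limit \<open>N \<rightarrow> \<infinity>\<close> it says \<open>\<parallel>X\<parallel>\<^sup>2 + \<parallel>h\<parallel>\<^sup>2 - 2 \<parallel>X\<parallel>\<^sup>2 \<ge> 0\<close>.
\<close>

lemma pair_calculus_contraction_strict:
  fixes A B :: "'h::chilbert_space \<Rightarrow> 'h"
  assumes A: "clin A" and B: "clin B" and AB: "\<And>x. A (B x) = 0" and BA: "\<And>x. B (A x) = 0"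
    and contr: "\<And>\<omega> u. cmod \<omega> = 1 \<Longrightarrow> norm (A u + scaleC \<omega> (B u)) \<le> norm u"
    and \<rho>: "0 \<le> \<rho>" "\<rho> < 1" "\<And>u. norm (A u) \<le> \<rho> * norm u" "\<And>u. norm (B u) \<le> \<rho> * norm u"
    and \<kappa>: "0 < \<kappa>" "\<kappa> < 1"
    and f: "\<And>z. cmod z = 1 \<Longrightarrow> contraction_by \<kappa> n (matpoly d f z)"
    and g: "\<And>z. cmod z = 1 \<Longrightarrow> contraction_by \<kappa> n (matpoly d g z)"
    and f0: "\<And>k j l. k > d \<Longrightarrow> f k j l = 0" and g0: "\<And>k j l. k > d \<Longrightarrow> g k j l = 0"
    and fg: "f 0 = g 0"
  shows "(\<Sum>j<n. (norm (pair_calculus d f g A B n h j))\<^sup>2) \<le> (\<Sum>l<n. (norm (h l))\<^sup>2)"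
proof -
  let ?I = "block_index n"
  define X where "X = pair_calculus d f g A B n h"
  \<comment> \<open>The sign of the upper part is chosen to make the cross term negative.\<close>
  define v where "v p = (if fst p then - X (snd p) else h (snd p))" for p :: "bool \<times> nat"
  define C where "C = (\<Sum>p\<in>?I. \<Sum>q\<in>?I. norm (v q) / (1 - \<rho>) * norm (v p))"
  define SA where "SA = (\<Sum>k<d. \<Sum>j<n. \<Sum>l<n. inner (scaleC (f (Suc k) j l) ((A ^^ Suc k) (v (False, l)))) (v (True, j)))"
  define SB where "SB = (\<Sum>k<d. \<Sum>j<n. \<Sum>l<n. inner (scaleC (g (Suc k) j l) ((B ^^ Suc k) (v (False, l)))) (v (True, j)))"
  have trunc: "(\<Sum>k<d + K. \<Sum>j<n. \<Sum>l<n. inner (scaleC (c (Suc k) j l) ((T ^^ Suc k) (v (False, l)))) (v (True, j))) =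
      (\<Sum>k<d. \<Sum>j<n. \<Sum>l<n. inner (scaleC (c (Suc k) j l) ((T ^^ Suc k) (v (False, l)))) (v (True, j)))"
    if "\<And>k j l. k > d \<Longrightarrow> c k j l = 0" for c K and T :: "'h \<Rightarrow> 'h"
    by (rule sum.mono_neutral_right) (auto simp: that)
  have entry: "cmod (matpoly d c (root_node N i) j l) \<le> 1"
    if "\<And>z. cmod z = 1 \<Longrightarrow> contraction_by \<kappa> n (matpoly d c z)" "j < n" "l < n" for c N i j l
    using that \<kappa> by (intro contraction_by_entry[of \<kappa> n]) auto
  have main: "0 \<le> tens ?I (block (f 0)) inner v v + 2 * SA + 2 * SB + 4 * C * \<rho> ^ (d + K)" for K
  proof -
    \<comment> \<open>At least \<open>d\<close> terms of the Neumann series are kept, so that all coefficients are met.\<close>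
    define N where "N = d + (d + K) + 1"
    have N: "N > 0" "d < N" by (auto simp: N_def)
    have SAK: "SA = (\<Sum>k<d + K. \<Sum>j<n. \<Sum>l<n. inner (scaleC (f (Suc k) j l) ((A ^^ Suc k) (v (False, l)))) (v (True, j)))"
      unfolding SA_def by (rule trunc[symmetric, OF f0])
    have e1: "cmod (matpoly d f (root_node N i) j l) \<le> 1" if "i < N" "j < n" "l < n" for i j l
      using that by (intro entry f)
    have "\<exists>x. (\<forall>i p. x i p = scaleC (cnj (root_node N i)) (A (v p + x i p))) \<and>
        \<bar>field_form N ?I (node_matrix N d f) inner x (\<lambda>_. v) - SA\<bar> \<le> \<rho> ^ (d + K) * C"
      unfolding SAK C_def
      by (rule node_response[OF A \<rho>(1,2,3) f0 N_def e1])
    then obtain x1 where x1: "\<And>i p. x1 i p = scaleC (cnj (root_node N i)) (A (v p + x1 i p))"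
      and b1: "\<bar>field_form N ?I (node_matrix N d f) inner x1 (\<lambda>_. v) - SA\<bar> \<le> \<rho> ^ (d + K) * C"
      by blast
    have SBK: "SB = (\<Sum>k<d + K. \<Sum>j<n. \<Sum>l<n. inner (scaleC (g (Suc k) j l) ((B ^^ Suc k) (v (False, l)))) (v (True, j)))"
      unfolding SB_def by (rule trunc[symmetric, OF g0])
    have e2: "cmod (matpoly d g (root_node N i) j l) \<le> 1" if "i < N" "j < n" "l < n" for i j l
      using that by (intro entry g)
    have "\<exists>x. (\<forall>i p. x i p = scaleC (cnj (root_node N i)) (B (v p + x i p))) \<and>
        \<bar>field_form N ?I (node_matrix N d g) inner x (\<lambda>_. v) - SB\<bar> \<le> \<rho> ^ (d + K) * C"
      unfolding SBK C_def
      by (rule node_response[OF B \<rho>(1,2,4) g0 N_def e2])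
    then obtain x2 where x2: "\<And>i p. x2 i p = scaleC (cnj (root_node N i)) (B (v p + x2 i p))"
      and b2: "\<bar>field_form N ?I (node_matrix N d g) inner x2 (\<lambda>_. v) - SB\<bar> \<le> \<rho> ^ (d + K) * C"
      by blast
    have pd: "posdef ?I (node_matrix N d c i)" if "\<And>z. cmod z = 1 \<Longrightarrow> contraction_by \<kappa> n (matpoly d c z)" for c i
      unfolding node_matrix_def using that \<kappa> N
      by (intro posdef_divide block_posdef[of \<kappa>]) auto
    have mean: "(\<Sum>i<N. node_matrix N d f i p q) = block (f 0) p q" "(\<Sum>i<N. node_matrix N d g i p q) = block (f 0) p q" for p q
      using node_matrix_mean[OF N(2), where f = f] node_matrix_mean[OF N(2), where f = g] f0 g0 fg by auto
    have pdM: "posdef ?I (block (f 0))"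
    proof -
      have "posdef ?I (\<lambda>p q. \<Sum>i\<in>{..<N}. node_matrix N d f i p q)"
        using N by (intro posdef_sum pd f) auto
      then show ?thesis unfolding mean .
    qed
    have "0 \<le> tens ?I (block (f 0)) inner v v + 2 * field_form N ?I (node_matrix N d f) inner x1 (\<lambda>_. v) +
        2 * field_form N ?I (node_matrix N d g) inner x2 (\<lambda>_. v)"
    proof (rule two_field_positivity[OF A B AB BA contr])
      show "posdef ?I (node_matrix N d f i)" "posdef ?I (node_matrix N d g i)" for i
        using pd f g by blast+
      show "x1 i j = scaleC (cnj (root_node N i)) (A (v j + x1 i j))" for i j
        by (rule x1)
      show "x2 i j = scaleC (cnj (root_node N i)) (B (v j + x2 i j))" for i j
        by (rule x2)
    qed (auto simp: mean intro: pdM)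
    then show ?thesis
      using abs_le_D1[OF b1] abs_le_D1[OF b2] by (simp add: algebra_simps)
  qed
  have "(\<lambda>K. tens ?I (block (f 0)) inner v v + 2 * SA + 2 * SB + 4 * C * \<rho> ^ (d + K)) \<longlonglongrightarrow>
      tens ?I (block (f 0)) inner v v + 2 * SA + 2 * SB + 4 * C * 0"
    by (intro tendsto_intros LIMSEQ_ignore_initial_segment[of _ _ d, unfolded add.commute[of _ d]] LIMSEQ_power_zero)
      (use \<rho> in auto)
  then have lim: "0 \<le> tens ?I (block (f 0)) inner v v + 2 * SA + 2 * SB"
    using LIMSEQ_le_const[OF _ exI[of _ 0], of _ _ 0] main by fastforce
  have vT: "v (True, j) = - X j" and vF: "v (False, j) = h j" for j
    by (simp_all add: v_def)
  define S0 where "S0 = (\<Sum>j<n. \<Sum>l<n. inner (scaleC (f 0 j l) (h l)) (X j))"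
  have "(\<Sum>j<n. \<Sum>l<n. inner (scaleC (cnj (f 0 l j)) (- X l)) (h j)) = - S0"
  proof -
    have "inner (scaleC (cnj c) (- x)) y = - inner (scaleC c y) x" for c and x y :: 'h
      by (simp add: inner_scaleC_left[of "cnj c"] inner_commute[of x])
    then show ?thesis
      unfolding S0_def by (subst sum.swap) (simp add: sum_negf)
  qed
  then have t: "tens ?I (block (f 0)) inner v v = (\<Sum>j<n. (norm (X j))\<^sup>2) + (\<Sum>j<n. (norm (h j))\<^sup>2) - 2 * S0"
    unfolding tens_block[OF pairing_inner] vT vF by (simp add: S0_def sum_negf power2_norm_eq_inner)
  have "(\<Sum>j<n. (norm (X j))\<^sup>2) = (\<Sum>j<n. inner (pair_calculus d f g A B n h j) (X j))"
    by (simp add: X_def power2_norm_eq_inner)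
  also have "\<dots> = S0 - SA - SB"
  proof -
    have s: "(\<Sum>k<d. \<Sum>j<n. \<Sum>l<n. inner (scaleC (c (Suc k) j l) ((T ^^ Suc k) (h l))) (- X j)) =
      - (\<Sum>j<n. \<Sum>l<n. \<Sum>k<d. inner (scaleC (c (Suc k) j l) ((T ^^ Suc k) (h l))) (X j))" for c and T :: "'h \<Rightarrow> 'h"
      unfolding inner_minus_right sum_negf by (rule arg_cong[where f = uminus], rule sym, rule trans[OF sum.cong[OF refl sum.swap] sum.swap])
    show ?thesis
      unfolding SA_def SB_def vT vF s S0_def pair_calculus_def inner_sum_left inner_add_left sum.distrib
      by simp
  qed
  finally show ?thesis
    using lim t unfolding X_def[symmetric] by argo
qed

lemma norm_le_of_rotations:
  fixes A B :: "'h::chilbert_space \<Rightarrow> 'h"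
  assumes "\<And>\<omega> u. cmod \<omega> = 1 \<Longrightarrow> norm (A u + scaleC \<omega> (B u)) \<le> norm u"
  shows "norm (A u) \<le> norm u" "norm (B u) \<le> norm u"
proof -
  have p: "norm (A u + B u) \<le> norm u" and m: "norm (A u - B u) \<le> norm u"
    using assms[of 1 u] assms[of "-1" u] by (simp_all add: scaleC_minus_left)
  have "2 * norm (A u) = norm ((A u + B u) + (A u - B u))"
    by (simp flip: scaleR_2)
  also have "\<dots> \<le> norm u + norm u"
    by (rule order_trans[OF norm_triangle_ineq add_mono[OF p m]])
  finally show "norm (A u) \<le> norm u" by simp
  have "2 * norm (B u) = norm ((A u + B u) - (A u - B u))"
    by (simp flip: scaleR_2)
  also have "\<dots> \<le> norm u + norm u"
    by (rule order_trans[OF norm_triangle_ineq4 add_mono[OF p m]])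
  finally show "norm (B u) \<le> norm u" by simp
qed

text \<open>
  Replacing \<open>A, B\<close> by \<open>r A, r B\<close> and \<open>f(z), g(z)\<close> by \<open>f(r z), g(r z)\<close> makes the operators strict
  contractions and moves the circle into the open disc, where the hypothesis lives; then \<open>r \<rightarrow> 1\<close>.
\<close>

theorem pair_calculus_contraction:
  fixes A B :: "'h::chilbert_space \<Rightarrow> 'h"
  assumes A: "clin A" and B: "clin B" and AB: "\<And>x. A (B x) = 0" and BA: "\<And>x. B (A x) = 0"
    and contr: "\<And>\<omega> u. cmod \<omega> = 1 \<Longrightarrow> norm (A u + scaleC \<omega> (B u)) \<le> norm u"
    and \<kappa>: "0 < \<kappa>" "\<kappa> < 1"
    and f: "\<And>z. cmod z < 1 \<Longrightarrow> contraction_by \<kappa> n (matpoly d f z)"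
    and g: "\<And>z. cmod z < 1 \<Longrightarrow> contraction_by \<kappa> n (matpoly d g z)"
    and f0: "\<And>k j l. k > d \<Longrightarrow> f k j l = 0" and g0: "\<And>k j l. k > d \<Longrightarrow> g k j l = 0"
    and fg: "f 0 = g 0"
  shows "(\<Sum>j<n. (norm (pair_calculus d f g A B n h j))\<^sup>2) \<le> (\<Sum>l<n. (norm (h l))\<^sup>2)"
proof -
  define r where "r m = 1 - 1 / (real m + 2)" for m :: nat
  have r: "0 < r m" "r m < 1" for m
    by (auto simp: r_def)
  have rlim: "r \<longlonglongrightarrow> 1"
  proof -
    have "(\<lambda>m. 1 / real (m + 2)) \<longlonglongrightarrow> 0"
      by (rule LIMSEQ_ignore_initial_segment[OF lim_1_over_n])
    then have "(\<lambda>m. 1 - 1 / real (m + 2)) \<longlonglongrightarrow> 1 - 0"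
      by (intro tendsto_intros)
    then show ?thesis by (simp add: r_def[abs_def] add.commute)
  qed
  define T where "T c m = (\<lambda>k j l. c k j l * complex_of_real (r m ^ k))" for c :: "nat \<Rightarrow> nat \<Rightarrow> nat \<Rightarrow> complex" and m
  have pw: "((\<lambda>u. r m *\<^sub>R C u) ^^ k) x = (r m ^ k) *\<^sub>R (C ^^ k) x" if "clin C" for C :: "'h \<Rightarrow> 'h" and m k x
    by (induction k) (simp_all add: clin_scaleR[OF that])
  have poly: "matpoly d (T c m) z = matpoly d c (of_real (r m) * z)" for c m z
    unfolding matpoly_def T_def fun_eq_iff by (simp add: power_mult_distrib mult_ac)
  have le: "(\<Sum>j<n. (norm (pair_calculus d (T f m) (T g m) (\<lambda>u. r m *\<^sub>R A u) (\<lambda>u. r m *\<^sub>R B u) n h j))\<^sup>2)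
      \<le> (\<Sum>l<n. (norm (h l))\<^sup>2)" for m
  proof (rule pair_calculus_contraction_strict[where \<rho> = "r m" and \<kappa> = \<kappa>])
    show "clin (\<lambda>u. r m *\<^sub>R A u)" "clin (\<lambda>u. r m *\<^sub>R B u)"
      using A B by (auto simp: clin_def scaleR_scaleC scaleC_add_right scaleC_scaleC mult.commute)
    show "norm (r m *\<^sub>R A u + scaleC \<omega> (r m *\<^sub>R B u)) \<le> norm u" if "cmod \<omega> = 1" for \<omega> u
    proof -
      have "r m *\<^sub>R A u + scaleC \<omega> (r m *\<^sub>R B u) = r m *\<^sub>R (A u + scaleC \<omega> (B u))"
        by (simp add: scaleR_scaleC scaleC_add_right scaleC_scaleC mult.commute)
      then have "norm (r m *\<^sub>R A u + scaleC \<omega> (r m *\<^sub>R B u)) = r m * norm (A u + scaleC \<omega> (B u))"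
        using r[of m] by simp
      also have "\<dots> \<le> 1 * norm u"
        using r[of m] contr[OF that] by (intro mult_mono) auto
      finally show ?thesis by simp
    qed
    show "norm (r m *\<^sub>R A u) \<le> r m * norm u" "norm (r m *\<^sub>R B u) \<le> r m * norm u" for u
      using r[of m] norm_le_of_rotations[of A B, OF contr] by simp_all
    show "contraction_by \<kappa> n (matpoly d (T f m) z)" "contraction_by \<kappa> n (matpoly d (T g m) z)"
      if "cmod z = 1" for z
      unfolding poly using r[of m] that by (auto intro!: f g simp: norm_mult)
    show "r m *\<^sub>R A (r m *\<^sub>R B x) = 0" "r m *\<^sub>R B (r m *\<^sub>R A x) = 0" for x
      by (simp_all add: clin_scaleR[OF A] clin_scaleR[OF B] AB BA)
  qed (use r[of m] \<kappa> f0 g0 fg in \<open>auto simp: T_def\<close>)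
  have eq: "pair_calculus d (T f m) (T g m) (\<lambda>u. r m *\<^sub>R A u) (\<lambda>u. r m *\<^sub>R B u) n h j =
    (\<Sum>l<n. scaleC (f 0 j l) (h l) + (\<Sum>k<d. ((r m ^ Suc k) * (r m ^ Suc k)) *\<^sub>R
      (scaleC (f (Suc k) j l) ((A ^^ Suc k) (h l)) + scaleC (g (Suc k) j l) ((B ^^ Suc k) (h l)))))" for m j
    unfolding pair_calculus_def pw[OF A] pw[OF B] T_def
    by (simp add: scaleR_scaleC scaleC_scaleC scaleC_add_right mult_ac del: funpow.simps power_Suc)
  have "(\<lambda>m. pair_calculus d (T f m) (T g m) (\<lambda>u. r m *\<^sub>R A u) (\<lambda>u. r m *\<^sub>R B u) n h j)
      \<longlonglongrightarrow> (\<Sum>l<n. scaleC (f 0 j l) (h l) + (\<Sum>k<d. ((1 ^ Suc k) * (1 ^ Suc k)) *\<^sub>R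
      (scaleC (f (Suc k) j l) ((A ^^ Suc k) (h l)) + scaleC (g (Suc k) j l) ((B ^^ Suc k) (h l)))))" for j
    unfolding eq by (intro tendsto_intros rlim)
  then have lim: "(\<lambda>m. pair_calculus d (T f m) (T g m) (\<lambda>u. r m *\<^sub>R A u) (\<lambda>u. r m *\<^sub>R B u) n h j)
      \<longlonglongrightarrow> pair_calculus d f g A B n h j" for j
    by (simp only: pair_calculus_def power_one mult_1 scaleR_one)
  show ?thesis
    by (rule LIMSEQ_le_const2[OF tendsto_sum[OF tendsto_power[OF tendsto_norm[OF lim]]]]) (use le in blast)
qed

section \<open>The algebra on the variety\<close>

text \<open>
  The two axis functions are coordinates on the sheets \<open>z = w\<close> and \<open>z = - w\<close>, and each vanishes on
  the sheet of the other.
\<close>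

definition axis1 :: "complex \<times> complex \<Rightarrow> complex"
  where "axis1 p = (fst p + snd p) / 2"

definition axis2 :: "complex \<times> complex \<Rightarrow> complex"
  where "axis2 p = (fst p - snd p) / 2"

lemma mem_V_bdV_cases:
  assumes "p \<in> V \<union> bdV"
  obtains t where "cmod t \<le> 1" "p = (t, t)" | t where "cmod t \<le> 1" "p = (t, - t)"
proof -
  obtain z w where p: "p = (z, w)" by (cases p)
  then have "w = z \<or> w = - z" "cmod z \<le> 1"
    using assms by (auto simp: V_def bdV_def power2_eq_iff)
  then show ?thesis
    using p that by blast
qed

lemma diag_mem_V: "cmod t < 1 \<Longrightarrow> \<sigma> = 1 \<or> \<sigma> = -1 \<Longrightarrow> (t, \<sigma> * t) \<in> V"
  by (auto simp: V_def)

lemma diag_mem_closure: "cmod t \<le> 1 \<Longrightarrow> \<sigma> = 1 \<or> \<sigma> = -1 \<Longrightarrow> (t, \<sigma> * t) \<in> V \<union> bdV"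
  by (cases "cmod t = 1") (auto simp: V_def bdV_def)

lemma holomorphic2_on_add:
  assumes "holomorphic2_on f S" "holomorphic2_on g S"
  shows "holomorphic2_on (\<lambda>p. f p + g p) S"
  unfolding holomorphic2_on_def
proof
  fix q assume q: "q \<in> S"
  obtain a b a' b' where "(f has_derivative (\<lambda>(h, k). a * h + b * k)) (at q)"
    "(g has_derivative (\<lambda>(h, k). a' * h + b' * k)) (at q)"
    using assms q unfolding holomorphic2_on_def by meson
  then have "((\<lambda>p. f p + g p) has_derivative (\<lambda>(h, k). (a + a') * h + (b + b') * k)) (at q)"
    by (rule has_derivative_eq_rhs[OF has_derivative_add]) (auto simp: algebra_simps)
  then show "\<exists>a b. ((\<lambda>p. f p + g p) has_derivative (\<lambda>(h, k). a * h + b * k)) (at q)"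
    by blast
qed

lemma holomorphic2_on_mult:
  assumes "holomorphic2_on f S" "holomorphic2_on g S"
  shows "holomorphic2_on (\<lambda>p. f p * g p) S"
  unfolding holomorphic2_on_def
proof
  fix q assume q: "q \<in> S"
  obtain a b a' b' where "(f has_derivative (\<lambda>(h, k). a * h + b * k)) (at q)"
    "(g has_derivative (\<lambda>(h, k). a' * h + b' * k)) (at q)"
    using assms q unfolding holomorphic2_on_def by meson
  then have "((\<lambda>p. f p * g p) has_derivative
      (\<lambda>(h, k). (f q * a' + a * g q) * h + (f q * b' + b * g q) * k)) (at q)"
    by (rule has_derivative_eq_rhs[OF has_derivative_mult]) (auto simp: algebra_simps)
  then show "\<exists>a b. ((\<lambda>p. f p * g p) has_derivative (\<lambda>(h, k). a * h + b * k)) (at q)"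
    by blast
qed

lemma holomorphic2_on_subset: "holomorphic2_on f S \<Longrightarrow> T \<subseteq> S \<Longrightarrow> holomorphic2_on f T"
  by (auto simp: holomorphic2_on_def)

text \<open>
  Local extensions of two functions are combined on the intersection of their domains.
\<close>

lemma holomorphic_on_V_binop:
  assumes f: "holomorphic_on_V f" and g: "holomorphic_on_V g"
    and op: "\<And>F G S. holomorphic2_on F S \<Longrightarrow> holomorphic2_on G S \<Longrightarrow> holomorphic2_on (\<lambda>p. H (F p) (G p)) S"
  shows "holomorphic_on_V (\<lambda>p. H (f p) (g p))"
  unfolding holomorphic_on_V_def
proof
  fix p assume p: "p \<in> V"
  obtain S F where 1: "open S" "p \<in> S" "holomorphic2_on F S" "\<forall>q\<in>S \<inter> V. F q = f q"
    using f p unfolding holomorphic_on_V_def by blast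
  obtain T G where 2: "open T" "p \<in> T" "holomorphic2_on G T" "\<forall>q\<in>T \<inter> V. G q = g q"
    using g p unfolding holomorphic_on_V_def by blast
  have "holomorphic2_on (\<lambda>p. H (F p) (G p)) (S \<inter> T)"
    using 1 2 by (intro op holomorphic2_on_subset[of _ S "S \<inter> T"] holomorphic2_on_subset[of _ T "S \<inter> T"]) auto
  then show "\<exists>\<Omega> K. open \<Omega> \<and> p \<in> \<Omega> \<and> holomorphic2_on K \<Omega> \<and> (\<forall>q\<in>\<Omega> \<inter> V. K q = H (f q) (g q))"
    using 1 2 by (intro exI[of _ "S \<inter> T"] exI[of _ "\<lambda>p. H (F p) (G p)"]) auto
qed

lemma A_V_add: "f \<in> A_V \<Longrightarrow> g \<in> A_V \<Longrightarrow> (\<lambda>p. f p + g p) \<in> A_V"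
  by (auto simp: A_V_def intro: holomorphic_on_V_binop[where H = "(+)"] holomorphic2_on_add continuous_on_add)

lemma A_V_mult: "f \<in> A_V \<Longrightarrow> g \<in> A_V \<Longrightarrow> (\<lambda>p. f p * g p) \<in> A_V"
  by (auto simp: A_V_def intro: holomorphic_on_V_binop[where H = "(*)"] holomorphic2_on_mult continuous_on_mult)

lemma A_V_linear: "(\<lambda>p. c + a * fst p + b * snd p) \<in> A_V"
proof -
  have "holomorphic2_on (\<lambda>p. c + a * fst p + b * snd p) UNIV"
    unfolding holomorphic2_on_def by (auto intro!: exI derivative_eq_intros)
  then have "holomorphic_on_V (\<lambda>p. c + a * fst p + b * snd p)"
    unfolding holomorphic_on_V_def by blast
  then show ?thesis
    by (auto simp: A_V_def intro!: continuous_intros)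
qed

lemma A_V_const: "(\<lambda>_. c) \<in> A_V"
  using A_V_linear[of c 0 0] by simp

lemma A_V_cmult: "f \<in> A_V \<Longrightarrow> (\<lambda>p. c * f p) \<in> A_V"
  using A_V_mult[OF A_V_const] .

lemma A_V_axis1: "axis1 \<in> A_V"
  using A_V_linear[of 0 "1/2" "1/2"] by (simp add: axis1_def[abs_def] add_divide_distrib)

lemma A_V_axis2: "axis2 \<in> A_V"
  using A_V_linear[of 0 "1/2" "-1/2"] by (simp add: axis2_def[abs_def] diff_divide_distrib)

lemma A_V_power: "f \<in> A_V \<Longrightarrow> (\<lambda>p. f p ^ k) \<in> A_V"
  by (induction k) (auto intro: A_V_const A_V_mult)

lemma A_V_sum: "(\<And>k. k \<in> S \<Longrightarrow> f k \<in> A_V) \<Longrightarrow> (\<lambda>p. \<Sum>k\<in>S. f k p) \<in> A_V"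
  by (induction S rule: infinite_finite_induct) (auto intro: A_V_const A_V_add)

lemma A_V_diag_holomorphic:
  assumes F: "F \<in> A_V" and \<sigma>: "\<sigma> = 1 \<or> \<sigma> = -1"
  shows "(\<lambda>t. F (t, \<sigma> * t)) holomorphic_on ball 0 1" "continuous_on (cball 0 1) (\<lambda>t. F (t, \<sigma> * t))"
proof -
  show "continuous_on (cball 0 1) (\<lambda>t. F (t, \<sigma> * t))"
  proof (rule continuous_on_compose2[of "V \<union> bdV" F])
    show "continuous_on (V \<union> bdV) F"
      using F by (simp add: A_V_def)
    show "continuous_on (cball 0 1) (\<lambda>t. (t, \<sigma> * t))"
      by (intro continuous_intros)
    show "(\<lambda>t. (t, \<sigma> * t)) ` cball 0 1 \<subseteq> V \<union> bdV"
      by (intro image_subsetI diag_mem_closure \<sigma>) simp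
  qed
  show "(\<lambda>t. F (t, \<sigma> * t)) holomorphic_on ball 0 1"
    unfolding holomorphic_on_open[OF open_ball]
  proof
    fix t :: complex assume t: "t \<in> ball 0 1"
    then have "(t, \<sigma> * t) \<in> V"
      using \<sigma> by (intro diag_mem_V) auto
    then obtain \<Omega> G where G: "open \<Omega>" "(t, \<sigma> * t) \<in> \<Omega>" "holomorphic2_on G \<Omega>" "\<forall>q\<in>\<Omega> \<inter> V. G q = F q"
      using F unfolding A_V_def holomorphic_on_V_def by blast
    then obtain a b where ab: "(G has_derivative (\<lambda>(h, k). a * h + b * k)) (at (t, \<sigma> * t))"
      unfolding holomorphic2_on_def by blast
    have "((\<lambda>s. G (s, \<sigma> * s)) has_derivative (\<lambda>h. (\<lambda>(h, k). a * h + b * k) (h, \<sigma> * h))) (at t)"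
      by (rule has_derivative_compose[where f = "\<lambda>s. (s, \<sigma> * s)" and g = G, OF _ ab])
        (auto intro!: derivative_eq_intros)
    then have der: "((\<lambda>s. G (s, \<sigma> * s)) has_field_derivative (a + b * \<sigma>)) (at t)"
      unfolding has_field_derivative_def by (rule has_derivative_eq_rhs) (auto simp: algebra_simps)
    define U where "U = (\<lambda>s. (s, \<sigma> * s)) -` \<Omega> \<inter> ball 0 1"
    have U: "open U"
      unfolding U_def using G by (intro open_Int open_vimage) (auto intro!: continuous_intros)
    have tU: "t \<in> U"
      using t G by (auto simp: U_def)
    have GF: "G (s, \<sigma> * s) = F (s, \<sigma> * s)" if "s \<in> U" for s
      using that G \<sigma> diag_mem_V[of s \<sigma>] by (auto simp: U_def)
    have "((\<lambda>s. F (s, \<sigma> * s)) has_field_derivative (a + b * \<sigma>)) (at t)"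
      by (rule has_field_derivative_transform_within_open[OF der U tU GF])
    then show "\<exists>f'. ((\<lambda>s. F (s, \<sigma> * s)) has_field_derivative f') (at t)"
      by blast
  qed
qed

text \<open>
  The dilate \<open>f(r t)\<close> is uniformly close to \<open>f\<close> for \<open>r\<close> near 1, and its Taylor series converges
  uniformly on the closed disc. Neither step changes the value at the origin, so the two sheets keep
  a common constant term.
\<close>

lemma disc_algebra_polynomial_approx:
  assumes hol: "f holomorphic_on ball 0 1" and cont: "continuous_on (cball 0 1) f" and \<epsilon>: "0 < \<epsilon>"
  shows "\<exists>d c. (\<forall>k>d. c k = 0) \<and> c 0 = f 0 \<and> (\<forall>t. cmod t \<le> 1 \<longrightarrow> cmod (f t - (\<Sum>k\<le>d. c k * t ^ k)) \<le> \<epsilon>)"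
proof -
  have "uniformly_continuous_on (cball 0 1) f"
    using cont compact_cball by (rule compact_uniformly_continuous)
  then obtain \<delta> where \<delta>: "\<delta> > 0" "\<And>s t. s \<in> cball 0 1 \<Longrightarrow> t \<in> cball 0 1 \<Longrightarrow> dist s t < \<delta> \<Longrightarrow> dist (f s) (f t) < \<epsilon> / 2"
    using \<epsilon> unfolding uniformly_continuous_on_def by (metis half_gt_zero)
  define r where "r = max (1 - \<delta> / 2) (1 / 2)"
  have r: "0 < r" "r < 1" "1 - r < \<delta>"
    using \<delta> by (auto simp: r_def max_def)
  define a where "a k = (deriv ^^ k) f 0 / fact k" for k
  have sums: "(\<lambda>k. a k * w ^ k) sums f w" if "cmod w < 1" for w
    using holomorphic_power_series[OF hol, of w] that by (simp add: a_def)
  have "summable (\<lambda>k. norm (a k * of_real r ^ k))"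
  proof (rule powser_insidea)
    show "summable (\<lambda>k. a k * complex_of_real ((r + 1) / 2) ^ k)"
      using sums[of "complex_of_real ((r + 1) / 2)"] r by (intro sums_summable) (auto simp: norm_divide simp flip: of_real_add)
    show "norm (complex_of_real r) < norm (complex_of_real ((r + 1) / 2))"
      using r by simp
  qed
  then have "uniform_limit (cball 0 1) (\<lambda>n t. \<Sum>k<n. a k * of_real r ^ k * t ^ k) (\<lambda>t. \<Sum>k. a k * of_real r ^ k * t ^ k) sequentially"
  proof (intro Weierstrass_m_test)
    fix k and t :: complex assume "t \<in> cball 0 1"
    then have "norm (a k * of_real r ^ k) * cmod t ^ k \<le> norm (a k * of_real r ^ k) * 1"
      by (intro mult_left_mono) (auto simp: power_le_one)
    then show "norm (a k * of_real r ^ k * t ^ k) \<le> norm (a k * of_real r ^ k)"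
      by (simp add: norm_mult norm_power)
  qed
  then have "\<forall>\<^sub>F n in sequentially. \<forall>t\<in>cball 0 1. dist (\<Sum>k<n. a k * of_real r ^ k * t ^ k) (\<Sum>k. a k * of_real r ^ k * t ^ k) < \<epsilon> / 2"
    using \<epsilon> by (intro uniform_limitD) auto
  then obtain n where n: "\<And>m t. m \<ge> n \<Longrightarrow> t \<in> cball 0 1 \<Longrightarrow>
      dist (\<Sum>k<m. a k * of_real r ^ k * t ^ k) (\<Sum>k. a k * of_real r ^ k * t ^ k) < \<epsilon> / 2"
    unfolding eventually_sequentially by blast
  define c where "c k = (if k \<le> n then a k * of_real r ^ k else 0)" for k
  have "cmod (f t - (\<Sum>k\<le>n. c k * t ^ k)) \<le> \<epsilon>" if t: "cmod t \<le> 1" for t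
  proof -
    have rt: "cmod (of_real r * t) \<le> r"
      using mult_left_mono[OF t, of r] r by (simp add: norm_mult)
    then have "(\<lambda>k. a k * of_real r ^ k * t ^ k) sums f (of_real r * t)"
      using sums[of "of_real r * t"] r by (simp add: power_mult_distrib mult_ac)
    then have "(\<Sum>k. a k * of_real r ^ k * t ^ k) = f (of_real r * t)"
      by (rule sums_unique[symmetric])
    moreover have "(\<Sum>k\<le>n. c k * t ^ k) = (\<Sum>k<Suc n. a k * of_real r ^ k * t ^ k)"
      by (intro sum.cong) (auto simp: c_def)
    ultimately have 1: "dist (\<Sum>k\<le>n. c k * t ^ k) (f (of_real r * t)) < \<epsilon> / 2"
      using n[of "Suc n" t] t by simp
    have "dist t (of_real r * t) = (1 - r) * cmod t"
    proof -
      have "t - of_real r * t = of_real (1 - r) * t"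
        by (simp add: algebra_simps)
      then show ?thesis
        using r unfolding dist_norm by (simp only: norm_mult norm_of_real)
    qed
    also have "\<dots> \<le> 1 - r"
      using mult_left_mono[OF t, of "1 - r"] r by simp
    also have "\<dots> < \<delta>" by (rule r)
    finally have 2: "dist (f t) (f (of_real r * t)) < \<epsilon> / 2"
      using \<delta>(2)[of t "of_real r * t"] t rt r by simp
    show ?thesis
      using dist_triangle2[of "f t" "\<Sum>k\<le>n. c k * t ^ k" "f (of_real r * t)"] 1 2
      by (simp add: dist_norm field_simps)
  qed
  moreover have "c 0 = f 0"
    by (simp add: c_def a_def)
  moreover have "\<forall>k>n. c k = 0"
    by (simp add: c_def)
  ultimately show ?thesis by blast
qed

text \<open>
  Its restriction to a sheet is a polynomial in the parameter of the sheet, with coefficients \<open>c\<close>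
  or \<open>c'\<close>, provided that \<open>c 0 = c' 0\<close>.
\<close>

definition pair_poly :: "nat \<Rightarrow> (nat \<Rightarrow> complex) \<Rightarrow> (nat \<Rightarrow> complex) \<Rightarrow> complex \<times> complex \<Rightarrow> complex"
  where "pair_poly d c c' p = c 0 + (\<Sum>k<d. c (Suc k) * axis1 p ^ Suc k + c' (Suc k) * axis2 p ^ Suc k)"

lemma pair_poly_A_V: "pair_poly d c c' \<in> A_V"
proof -
  have "(\<lambda>p. c 0 + (\<Sum>k<d. c (Suc k) * axis1 p ^ Suc k + c' (Suc k) * axis2 p ^ Suc k)) \<in> A_V"
    by (intro A_V_add A_V_sum A_V_cmult A_V_power A_V_const A_V_axis1 A_V_axis2)
  then show ?thesis
    by (simp add: pair_poly_def[abs_def] del: power_Suc)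
qed

lemma pair_poly_diag1: "pair_poly d c c' (t, t) = (\<Sum>k\<le>d. c k * t ^ k)"
  by (simp add: pair_poly_def axis1_def axis2_def sum.atMost_shift)

lemma pair_poly_diag2: "c 0 = c' 0 \<Longrightarrow> pair_poly d c c' (t, - t) = (\<Sum>k\<le>d. c' k * t ^ k)"
  by (simp add: pair_poly_def axis1_def axis2_def sum.atMost_shift)

lemma A_V_polynomial_approx:
  assumes F: "F \<in> A_V" and \<epsilon>: "0 < \<epsilon>"
  shows "\<exists>d c c'. (\<forall>k>d. c k = 0) \<and> (\<forall>k>d. c' k = 0) \<and> c 0 = c' 0 \<and>
    (\<forall>p\<in>V \<union> bdV. cmod (F p - pair_poly d c c' p) \<le> \<epsilon>)"
proof -
  obtain d1 c where c: "\<forall>k>d1. c k = 0" "c 0 = F (0, 0)"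
    "\<And>t. cmod t \<le> 1 \<Longrightarrow> cmod (F (t, t) - (\<Sum>k\<le>d1. c k * t ^ k)) \<le> \<epsilon>"
    using disc_algebra_polynomial_approx[OF A_V_diag_holomorphic[OF F, of 1] \<epsilon>] by auto
  obtain d2 c' where c': "\<forall>k>d2. c' k = 0" "c' 0 = F (0, 0)"
    "\<And>t. cmod t \<le> 1 \<Longrightarrow> cmod (F (t, - t) - (\<Sum>k\<le>d2. c' k * t ^ k)) \<le> \<epsilon>"
    using disc_algebra_polynomial_approx[OF A_V_diag_holomorphic[OF F, of "-1"] \<epsilon>] by auto
  define d where "d = max d1 d2"
  have 1: "(\<Sum>k\<le>d. c k * t ^ k) = (\<Sum>k\<le>d1. c k * t ^ k)" for t
    using c by (intro sum.mono_neutral_right) (auto simp: d_def)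
  have 2: "(\<Sum>k\<le>d. c' k * t ^ k) = (\<Sum>k\<le>d2. c' k * t ^ k)" for t
    using c' by (intro sum.mono_neutral_right) (auto simp: d_def)
  have "cmod (F p - pair_poly d c c' p) \<le> \<epsilon>" if "p \<in> V \<union> bdV" for p
    using that
  proof (cases rule: mem_V_bdV_cases)
    case (1 t)
    then show ?thesis using c(3)[of t] by (simp add: pair_poly_diag1 \<open>\<And>t. (\<Sum>k\<le>d. c k * t ^ k) = (\<Sum>k\<le>d1. c k * t ^ k)\<close>)
  next
    case (2 t)
    then show ?thesis using c'(3)[of t] c(2) c'(2) by (simp add: pair_poly_diag2 \<open>\<And>t. (\<Sum>k\<le>d. c' k * t ^ k) = (\<Sum>k\<le>d2. c' k * t ^ k)\<close>)
  qed
  then show ?thesis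
    using c c' by (intro exI[of _ d] exI[of _ c] exI[of _ c']) (auto simp: d_def)
qed

section \<open>Homomorphisms of the algebra\<close>

lemma norm_hom_le:
  assumes "contractive \<pi>" "f \<in> A_V" "\<And>p. p \<in> V \<union> bdV \<Longrightarrow> cmod (f p) \<le> C"
  shows "norm (\<pi> f) \<le> C"
proof -
  have "(0, 0) \<in> V"
    by (simp add: V_def)
  then have "norm_A_V f \<le> C"
    unfolding norm_A_V_def using assms(3) by (intro cSUP_least) auto
  then show ?thesis
    using assms(1,2) unfolding contractive_def by force
qed

lemma norm_hom_apply_le:
  assumes "contractive \<pi>" "f \<in> A_V" "\<And>p. p \<in> V \<union> bdV \<Longrightarrow> cmod (f p) \<le> C"
  shows "norm (blinfun_apply (\<pi> f) x) \<le> C * norm x"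
  using norm_hom_le[OF assms] by (meson mult_right_mono norm_blinfun norm_ge_zero order_trans)

lemma hom_add:
  assumes "unital_hom \<pi>" "f \<in> A_V" "g \<in> A_V"
  shows "blinfun_apply (\<pi> (\<lambda>p. f p + g p)) x = blinfun_apply (\<pi> f) x + blinfun_apply (\<pi> g) x"
proof -
  have "\<pi> (\<lambda>p. f p + g p) = \<pi> f + \<pi> g"
    using assms unfolding unital_hom_def by blast
  then show ?thesis
    by (simp only: plus_blinfun.rep_eq)
qed

lemma hom_cmult: "unital_hom \<pi> \<Longrightarrow> f \<in> A_V \<Longrightarrow>
    blinfun_apply (\<pi> (\<lambda>p. c * f p)) x = scaleC c (blinfun_apply (\<pi> f) x)"
  unfolding unital_hom_def by blast

lemma hom_mult:
  assumes "unital_hom \<pi>" "f \<in> A_V" "g \<in> A_V"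
  shows "blinfun_apply (\<pi> (\<lambda>p. f p * g p)) x = blinfun_apply (\<pi> f) (blinfun_apply (\<pi> g) x)"
proof -
  have "\<pi> (\<lambda>p. f p * g p) = \<pi> f o\<^sub>L \<pi> g"
    using assms unfolding unital_hom_def by blast
  then show ?thesis
    by simp
qed

lemma hom_const:
  assumes "unital_hom \<pi>"
  shows "blinfun_apply (\<pi> (\<lambda>_. c)) x = scaleC c x"
proof -
  have "\<pi> (\<lambda>p. 1) = id_blinfun"
    using assms unfolding unital_hom_def by blast
  then show ?thesis
    using hom_cmult[OF assms A_V_const[of 1], of c x] by simp
qed

lemma hom_eqI: "unital_hom \<pi> \<Longrightarrow> f \<in> A_V \<Longrightarrow> g \<in> A_V \<Longrightarrow> (\<And>p. p \<in> V \<union> bdV \<Longrightarrow> f p = g p) \<Longrightarrow> \<pi> f = \<pi> g"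
  unfolding unital_hom_def by blast

lemma hom_clin:
  assumes "unital_hom \<pi>" "f \<in> A_V"
  shows "clin (blinfun_apply (\<pi> f))"
proof -
  have "\<pi> f \<in> bounded_ops"
    using assms unfolding unital_hom_def by blast
  then show ?thesis
    by (simp add: clin_def bounded_ops_def blinfun.add_right)
qed

lemma hom_power:
  assumes "unital_hom \<pi>" "f \<in> A_V"
  shows "blinfun_apply (\<pi> (\<lambda>p. f p ^ k)) x = (blinfun_apply (\<pi> f) ^^ k) x"
proof (induction k)
  case 0
  then show ?case
    by (simp add: hom_const[OF assms(1)])
next
  case (Suc k)
  then show ?case
    using hom_mult[OF assms A_V_power[OF assms(2), of k], of x] by simp
qed

lemma hom_sum:
  assumes "unital_hom \<pi>" "finite S" "\<And>k. k \<in> S \<Longrightarrow> f k \<in> A_V"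
  shows "blinfun_apply (\<pi> (\<lambda>p. \<Sum>k\<in>S. f k p)) x = (\<Sum>k\<in>S. blinfun_apply (\<pi> (f k)) x)"
  using assms(2,3)
proof (induction S rule: finite_induct)
  case empty
  then show ?case
    by (simp add: hom_const[OF assms(1)])
next
  case (insert i S)
  then show ?case
    using hom_add[OF assms(1), of "f i" "\<lambda>p. \<Sum>k\<in>S. f k p" x] by (simp add: A_V_sum)
qed

lemma hom_pair_poly:
  assumes \<pi>: "unital_hom \<pi>"
  shows "blinfun_apply (\<pi> (pair_poly d c c')) x = scaleC (c 0) x +
    (\<Sum>k<d. scaleC (c (Suc k)) ((blinfun_apply (\<pi> axis1) ^^ Suc k) x) +
            scaleC (c' (Suc k)) ((blinfun_apply (\<pi> axis2) ^^ Suc k) x))"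
proof -
  note mem = A_V_add A_V_sum A_V_cmult A_V_power A_V_const A_V_axis1 A_V_axis2
  have "blinfun_apply (\<pi> (pair_poly d c c')) x =
    blinfun_apply (\<pi> (\<lambda>p. c 0 + (\<Sum>k<d. c (Suc k) * axis1 p ^ Suc k + c' (Suc k) * axis2 p ^ Suc k))) x"
    by (simp only: pair_poly_def[abs_def])
  also have "\<dots> = blinfun_apply (\<pi> (\<lambda>_. c 0)) x +
      blinfun_apply (\<pi> (\<lambda>p. \<Sum>k<d. c (Suc k) * axis1 p ^ Suc k + c' (Suc k) * axis2 p ^ Suc k)) x"
    by (intro hom_add[OF \<pi>] mem)
  also have "blinfun_apply (\<pi> (\<lambda>p. \<Sum>k<d. c (Suc k) * axis1 p ^ Suc k + c' (Suc k) * axis2 p ^ Suc k)) x =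
      (\<Sum>k<d. blinfun_apply (\<pi> (\<lambda>p. c (Suc k) * axis1 p ^ Suc k + c' (Suc k) * axis2 p ^ Suc k)) x)"
    by (intro hom_sum[OF \<pi>] mem finite_lessThan)
  also have "\<dots> = (\<Sum>k<d. blinfun_apply (\<pi> (\<lambda>p. c (Suc k) * axis1 p ^ Suc k)) x +
      blinfun_apply (\<pi> (\<lambda>p. c' (Suc k) * axis2 p ^ Suc k)) x)"
    by (intro sum.cong refl hom_add[OF \<pi>] mem)
  also have "\<dots> = (\<Sum>k<d. scaleC (c (Suc k)) ((blinfun_apply (\<pi> axis1) ^^ Suc k) x) +
            scaleC (c' (Suc k)) ((blinfun_apply (\<pi> axis2) ^^ Suc k) x))"
    by (simp only: hom_cmult[OF \<pi> A_V_power[OF A_V_axis1]] hom_cmult[OF \<pi> A_V_power[OF A_V_axis2]]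
        hom_power[OF \<pi> A_V_axis1] hom_power[OF \<pi> A_V_axis2])
  finally show ?thesis
    by (simp only: hom_const[OF \<pi>])
qed

lemma axis_product_zero:
  assumes \<pi>: "unital_hom \<pi>"
  shows "blinfun_apply (\<pi> axis1) (blinfun_apply (\<pi> axis2) x) = 0"
    "blinfun_apply (\<pi> axis2) (blinfun_apply (\<pi> axis1) x) = 0"
proof -
  have z: "axis1 p * axis2 p = 0" if "p \<in> V \<union> bdV" for p
    using that by (cases rule: mem_V_bdV_cases) (auto simp: axis1_def axis2_def)
  have "\<pi> (\<lambda>p. axis1 p * axis2 p) = \<pi> (\<lambda>_. 0)" "\<pi> (\<lambda>p. axis2 p * axis1 p) = \<pi> (\<lambda>_. 0)"
    by (intro hom_eqI[OF \<pi>] A_V_mult A_V_axis1 A_V_axis2 A_V_const; simp add: z mult.commute[of "axis2 _"] del: mult_eq_0_iff)+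
  then show "blinfun_apply (\<pi> axis1) (blinfun_apply (\<pi> axis2) x) = 0"
    "blinfun_apply (\<pi> axis2) (blinfun_apply (\<pi> axis1) x) = 0"
    using hom_mult[OF \<pi> A_V_axis1 A_V_axis2, of x] hom_mult[OF \<pi> A_V_axis2 A_V_axis1, of x] hom_const[OF \<pi>, of 0 x]
    by simp_all
qed

text \<open>
  The function \<open>axis1 + \<omega> axis2\<close> is the parameter of the sheet on one sheet and \<open>\<omega>\<close> times it on
  the other, so its supremum norm is 1.
\<close>

lemma axis_rotation_contraction:
  assumes \<pi>: "unital_hom \<pi>" "contractive \<pi>" and \<omega>: "cmod \<omega> = 1"
  shows "norm (blinfun_apply (\<pi> axis1) u + scaleC \<omega> (blinfun_apply (\<pi> axis2) u)) \<le> norm u"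
proof -
  have "cmod (axis1 p + \<omega> * axis2 p) \<le> 1" if "p \<in> V \<union> bdV" for p
    using that by (cases rule: mem_V_bdV_cases) (auto simp: axis1_def axis2_def norm_mult \<omega>)
  then have "norm (blinfun_apply (\<pi> (\<lambda>p. axis1 p + \<omega> * axis2 p)) u) \<le> 1 * norm u"
    by (intro norm_hom_apply_le[OF \<pi>(2)] A_V_add A_V_cmult A_V_axis1 A_V_axis2)
  then show ?thesis
    by (simp add: hom_add[OF \<pi>(1) A_V_axis1 A_V_cmult[OF A_V_axis2]] hom_cmult[OF \<pi>(1) A_V_axis2])
qed

section \<open>Operator norms of matrices\<close>

text \<open>
  The crude factor \<open>n\<^sup>2\<close> is harmless: it enters only finiteness and the size of approximation errors.
\<close>

lemma L2_matrix_le: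
  assumes "\<And>j l. j < n \<Longrightarrow> l < n \<Longrightarrow> norm (T j l) \<le> \<epsilon> * norm (h l)" "0 \<le> \<epsilon>"
  shows "L2_set (\<lambda>j. norm (\<Sum>l<n. T j l :: 'a::real_normed_vector)) {..<n} \<le>
    (real n)\<^sup>2 * \<epsilon> * L2_set (\<lambda>l. norm (h l)) {..<n}"
proof -
  have "L2_set (\<lambda>j. norm (\<Sum>l<n. T j l)) {..<n} \<le> (\<Sum>j<n. norm (\<Sum>l<n. T j l))"
    by (intro L2_set_le_sum) auto
  also have "\<dots> \<le> (\<Sum>j<n. \<Sum>l<n. \<epsilon> * L2_set (\<lambda>l. norm (h l)) {..<n})"
  proof (intro sum_mono order_trans[OF norm_sum])
    fix j l assume "j \<in> {..<n}" "l \<in> {..<n}"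
    then have "norm (T j l) \<le> \<epsilon> * norm (h l)" "norm (h l) \<le> L2_set (\<lambda>l. norm (h l)) {..<n}"
      using assms by (auto intro: member_le_L2_set)
    then show "norm (T j l) \<le> \<epsilon> * L2_set (\<lambda>l. norm (h l)) {..<n}"
      using assms(2) by (meson mult_left_mono order_trans)
  qed
  also have "\<dots> = (real n)\<^sup>2 * \<epsilon> * L2_set (\<lambda>l. norm (h l)) {..<n}"
    by (simp add: power2_eq_square)
  finally show ?thesis .
qed

lemma opmat_norm_scalar_bdd:
  assumes C: "\<And>j l. j < n \<Longrightarrow> l < n \<Longrightarrow> cmod (F j l) \<le> C" "0 \<le> C" and h: "L2_set (\<lambda>l. norm (h l)) {..<n} \<le> 1"
  shows "L2_set (\<lambda>j. norm (\<Sum>l<n. F j l * h l)) {..<n} \<le> (real n)\<^sup>2 * C"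
proof -
  have "L2_set (\<lambda>j. norm (\<Sum>l<n. F j l * h l)) {..<n} \<le> (real n)\<^sup>2 * C * L2_set (\<lambda>l. norm (h l)) {..<n}"
    using C by (intro L2_matrix_le) (auto simp: norm_mult intro: mult_right_mono)
  also have "\<dots> \<le> (real n)\<^sup>2 * C * 1"
    using C h by (intro mult_left_mono) auto
  finally show ?thesis by simp
qed

lemma L2_ball_nonempty: "{h. L2_set (\<lambda>l. norm (h l :: 'a::real_normed_vector)) {..<n} \<le> 1} \<noteq> {}"
proof -
  have "(\<lambda>_. 0) \<in> {h. L2_set (\<lambda>l. norm (h l :: 'a)) {..<n} \<le> 1}"
    by (simp add: L2_set_def)
  then show ?thesis
    by (simp only: ex_in_conv[symmetric]) (rule exI)
qed

lemma opmat_norm_scalar_le: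
  assumes C: "\<And>j l. j < n \<Longrightarrow> l < n \<Longrightarrow> cmod (F j l) \<le> C" "0 \<le> C"
  shows "opmat_norm n (\<lambda>j l v. F j l * v) \<le> (real n)\<^sup>2 * C"
  unfolding opmat_norm_def
proof (rule cSUP_least)
  show "{h. L2_set (\<lambda>l. cmod (h l)) {..<n} \<le> 1} \<noteq> {}"
    by (rule L2_ball_nonempty)
next
  fix h :: "nat \<Rightarrow> complex" assume "h \<in> {h. L2_set (\<lambda>l. cmod (h l)) {..<n} \<le> 1}"
  then show "L2_set (\<lambda>j. cmod (\<Sum>l<n. F j l * h l)) {..<n} \<le> (real n)\<^sup>2 * C"
    by (intro opmat_norm_scalar_bdd C) simp_all
qed

text \<open>
  The supremum in the operator norm is finite, as the entries are scalars, so it bounds the value at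
  the normalized vector.
\<close>

lemma opmat_norm_scalar_apply:
  "L2_set (\<lambda>j. cmod (\<Sum>l<n. F j l * u l)) {..<n} \<le> opmat_norm n (\<lambda>j l v. F j l * v) * L2_set (\<lambda>l. cmod (u l)) {..<n}"
proof -
  define C where "C = (\<Sum>j<n. \<Sum>l<n. cmod (F j l))"
  have C: "cmod (F j l) \<le> C" if "j < n" "l < n" for j l
  proof -
    have "cmod (F j l) \<le> (\<Sum>l<n. cmod (F j l))"
      using that by (intro member_le_sum) auto
    also have "\<dots> \<le> C"
      unfolding C_def using that by (intro member_le_sum[of j _ "\<lambda>j. \<Sum>l<n. cmod (F j l)"]) (auto intro: sum_nonneg)
    finally show ?thesis .
  qed
  have C0: "0 \<le> C"
    by (auto simp: C_def intro!: sum_nonneg)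
  have bdd: "bdd_above ((\<lambda>h. L2_set (\<lambda>j. norm (\<Sum>l<n. F j l * h l)) {..<n}) ` {h. L2_set (\<lambda>l. norm (h l)) {..<n} \<le> 1})"
    by (rule bdd_aboveI2[of _ _ "(real n)\<^sup>2 * C"], rule opmat_norm_scalar_bdd[OF C C0]) simp_all
  define s where "s = L2_set (\<lambda>l. cmod (u l)) {..<n}"
  show ?thesis
  proof (cases "s = 0")
    case True
    then have "u l = 0" if "l < n" for l
      using that by (simp add: s_def L2_set_eq_0_iff)
    then show ?thesis
      using True by (simp add: s_def[symmetric] L2_set_def)
  next
    case False
    then have s: "s > 0"
      unfolding s_def by (simp add: less_le)
    have "L2_set (\<lambda>l. norm (u l / of_real s)) {..<n} = 1"
      using L2_set_right_distrib[of "1 / s" "\<lambda>l. cmod (u l)" "{..<n}"] s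
      by (simp add: norm_divide s_def[symmetric])
    then have "L2_set (\<lambda>j. norm (\<Sum>l<n. F j l * (u l / of_real s))) {..<n} \<le> opmat_norm n (\<lambda>j l v. F j l * v)"
      unfolding opmat_norm_def by (intro cSUP_upper bdd) auto
    moreover have "L2_set (\<lambda>j. norm (\<Sum>l<n. F j l * (u l / of_real s))) {..<n} =
        L2_set (\<lambda>j. cmod (\<Sum>l<n. F j l * u l)) {..<n} / s"
      using L2_set_right_distrib[of "1 / s" "\<lambda>j. cmod (\<Sum>l<n. F j l * u l)" "{..<n}"] s
      by (simp add: norm_divide flip: sum_divide_distrib)
    ultimately show ?thesis
      using s by (simp add: s_def[symmetric] pos_divide_le_eq)
  qed
qed

lemma A_V_bounded:
  assumes F: "F \<in> A_V"
  shows "\<exists>C. 0 \<le> C \<and> (\<forall>p\<in>V \<union> bdV. cmod (F p) \<le> C)"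
proof -
  have b: "\<exists>C. \<forall>t\<in>cball 0 1. cmod (F (t, \<sigma> * t)) \<le> C" if "\<sigma> = 1 \<or> \<sigma> = -1" for \<sigma>
    using compact_imp_bounded[OF compact_continuous_image[OF A_V_diag_holomorphic(2)[OF F that] compact_cball]]
    by (simp add: bounded_iff)
  obtain C1 C2 where C: "\<forall>t\<in>cball 0 1. cmod (F (t, t)) \<le> C1" "\<forall>t\<in>cball 0 1. cmod (F (t, - t)) \<le> C2"
    using b[of 1] b[of "-1"] by auto
  have "cmod (F p) \<le> max 0 (max C1 C2)" if "p \<in> V \<union> bdV" for p
    using that by (cases rule: mem_V_bdV_cases) (use C in \<open>auto simp: le_max_iff_disj\<close>)
  then show ?thesis
    by (intro exI[of _ "max 0 (max C1 C2)"]) auto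
qed

lemma opmat_norm_family_bdd:
  assumes "\<And>j l. j < n \<Longrightarrow> l < n \<Longrightarrow> F j l \<in> A_V"
  shows "bdd_above ((\<lambda>p. opmat_norm n (\<lambda>j l v. F j l p * v)) ` V)"
proof -
  have "\<forall>j l. \<exists>C. j < n \<longrightarrow> l < n \<longrightarrow> 0 \<le> C \<and> (\<forall>p\<in>V \<union> bdV. cmod (F j l p) \<le> C)"
    using A_V_bounded assms by blast
  then obtain C where C: "\<And>j l. j < n \<Longrightarrow> l < n \<Longrightarrow> 0 \<le> C j l"
    "\<And>j l p. j < n \<Longrightarrow> l < n \<Longrightarrow> p \<in> V \<union> bdV \<Longrightarrow> cmod (F j l p) \<le> C j l"
    by metis
  define D where "D = (\<Sum>j<n. \<Sum>l<n. C j l)"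
  have D0: "0 \<le> D"
    using C(1) by (auto simp: D_def intro!: sum_nonneg)
  have D: "C j l \<le> D" if "j < n" "l < n" for j l
  proof -
    have "C j l \<le> (\<Sum>l<n. C j l)"
      using that C(1) by (intro member_le_sum) auto
    also have "\<dots> \<le> D"
      unfolding D_def using that C(1) by (intro member_le_sum[of j _ "\<lambda>j. \<Sum>l<n. C j l"]) (auto intro: sum_nonneg)
    finally show ?thesis .
  qed
  have "opmat_norm n (\<lambda>j l v. F j l p * v) \<le> (real n)\<^sup>2 * D" if "p \<in> V" for p
    using that C(2) D by (intro opmat_norm_scalar_le D0) (meson UnI1 order_trans)
  then show ?thesis
    by (rule bdd_aboveI2)
qed

section \<open>Complete contractivity\<close>

lemma pair_poly_extend:
  assumes "d \<le> d'" "\<forall>k>d. c k = 0" "\<forall>k>d. c' k = 0"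
  shows "pair_poly d' c c' = pair_poly d c c'"
proof
  fix p
  have "(\<Sum>k<d'. c (Suc k) * axis1 p ^ Suc k + c' (Suc k) * axis2 p ^ Suc k) =
    (\<Sum>k<d. c (Suc k) * axis1 p ^ Suc k + c' (Suc k) * axis2 p ^ Suc k)"
    using assms by (intro sum.mono_neutral_right) auto
  then show "pair_poly d' c c' p = pair_poly d c c' p"
    by (simp only: pair_poly_def)
qed

lemma pair_poly_scale: "pair_poly d (\<lambda>k. a * c k) (\<lambda>k. a * c' k) p = a * pair_poly d c c' p"
  by (simp add: pair_poly_def distrib_left sum_distrib_left mult_ac)

text \<open>
  Coefficients beyond the degree are zero, so finitely many entries can share one degree bound.
\<close>

lemma A_V_matrix_approx:
  fixes n :: nat
  assumes F: "\<And>j l. j < n \<Longrightarrow> l < n \<Longrightarrow> F j l \<in> A_V" and \<epsilon>: "0 < \<epsilon>"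
  obtains d f g where "\<And>k j l. k > d \<Longrightarrow> f k j l = 0" "\<And>k j l. k > d \<Longrightarrow> g k j l = 0" "f 0 = g 0"
    "\<And>j l p. j < n \<Longrightarrow> l < n \<Longrightarrow> p \<in> V \<union> bdV \<Longrightarrow> cmod (F j l p - pair_poly d (\<lambda>k. f k j l) (\<lambda>k. g k j l) p) \<le> \<epsilon>"
proof -
  have "\<forall>j l. \<exists>d c c'. j < n \<longrightarrow> l < n \<longrightarrow> (\<forall>k>d. c k = 0) \<and> (\<forall>k>d. c' k = 0) \<and> c 0 = c' 0 \<and>
    (\<forall>p\<in>V \<union> bdV. cmod (F j l p - pair_poly d c c' p) \<le> \<epsilon>)"
    using A_V_polynomial_approx[OF F \<epsilon>] by blast
  then obtain d c c' where *: "\<And>j l. j < n \<Longrightarrow> l < n \<Longrightarrow> (\<forall>k>d j l. c j l k = 0) \<and> (\<forall>k>d j l. c' j l k = 0) \<and> c j l 0 = c' j l 0 \<and>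
    (\<forall>p\<in>V \<union> bdV. cmod (F j l p - pair_poly (d j l) (c j l) (c' j l) p) \<le> \<epsilon>)"
    by metis
  define D where "D = (\<Sum>j<n. \<Sum>l<n. d j l)"
  have D: "d j l \<le> D" if "j < n" "l < n" for j l
  proof -
    have "d j l \<le> (\<Sum>l<n. d j l)"
      using that by (intro member_le_sum) auto
    also have "\<dots> \<le> D"
      unfolding D_def using that by (intro member_le_sum[of j _ "\<lambda>j. \<Sum>l<n. d j l"]) auto
    finally show ?thesis .
  qed
  define f where "f k j l = (if j < n \<and> l < n then c j l k else 0)" for k j l
  define g where "g k j l = (if j < n \<and> l < n then c' j l k else 0)" for k j l
  show thesis
  proof (rule that[of D f g])
    show "f k j l = 0" "g k j l = 0" if "k > D" for k j l
      using * D[of j l] that by (auto simp: f_def g_def)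
    show "f 0 = g 0"
      using * by (auto simp: f_def g_def fun_eq_iff)
    show "cmod (F j l p - pair_poly D (\<lambda>k. f k j l) (\<lambda>k. g k j l) p) \<le> \<epsilon>"
      if "j < n" "l < n" "p \<in> V \<union> bdV" for j l p
    proof -
      have "(\<lambda>k. f k j l) = c j l" "(\<lambda>k. g k j l) = c' j l"
        using that by (auto simp: f_def g_def)
      then show ?thesis
        using *[OF that(1,2)] pair_poly_extend[OF D[OF that(1,2)]] that(3) by simp
    qed
  qed
qed

text \<open>
  Approximate the entries by polynomials with error \<open>\<epsilon>\<close> and divide by \<open>R\<close>, slightly more than a
  bound for the approximants, to obtain strict contractions on both sheets. The functional calculus
  makes them contractions on the Hilbert space, and the error is controlled since the homomorphism is
  bounded on each entry.
\<close>

theorem theorem6p6: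
  fixes \<pi> :: "(complex \<times> complex \<Rightarrow> complex) \<Rightarrow> ('h::chilbert_space \<Rightarrow>\<^sub>L 'h)"
  assumes "unital_hom \<pi>"
    and "contractive \<pi>"
  shows "completely_contractive \<pi>"
  unfolding completely_contractive_def
proof (intro allI impI)
  fix n :: nat and F :: "nat \<Rightarrow> nat \<Rightarrow> complex \<times> complex \<Rightarrow> complex"
  assume n: "1 \<le> n" and F': "\<forall>j<n. \<forall>l<n. F j l \<in> A_V"
  then have F: "F j l \<in> A_V" if "j < n" "l < n" for j l
    using that by blast
  define M where "M = (SUP p\<in>V. opmat_norm n (\<lambda>j l v. F j l p * v))"
  have FM: "L2_set (\<lambda>j. cmod (\<Sum>l<n. F j l p * u l)) {..<n} \<le> M * L2_set (\<lambda>l. cmod (u l)) {..<n}"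
    if "p \<in> V" for p u
  proof -
    have "opmat_norm n (\<lambda>j l v. F j l p * v) \<le> M"
      unfolding M_def by (rule cSUP_upper[OF that opmat_norm_family_bdd[OF F]])
    then show ?thesis
      by (intro order_trans[OF opmat_norm_scalar_apply] mult_right_mono L2_set_nonneg)
  qed
  have M0: "0 \<le> M"
  proof -
    have "(0, 0) \<in> V" by (simp add: V_def)
    then have "0 \<le> M * L2_set (\<lambda>l. cmod 1) {..<n}"
      by (rule order_trans[OF L2_set_nonneg FM])
    moreover have "0 < L2_set (\<lambda>l. cmod 1) {..<n}"
      using n by (simp add: L2_set_def)
    ultimately show ?thesis
      by (simp add: zero_le_mult_iff)
  qed
  define A where "A = blinfun_apply (\<pi> axis1)"
  define B where "B = blinfun_apply (\<pi> axis2)"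
  have "L2_set (\<lambda>j. norm (\<Sum>l<n. blinfun_apply (\<pi> (F j l)) (h l))) {..<n} \<le> M"
    if h: "L2_set (\<lambda>l. norm (h l)) {..<n} \<le> 1" for h :: "nat \<Rightarrow> 'h"
  proof (rule field_le_epsilon)
    fix e :: real assume e: "0 < e"
    define D where "D = 2 * (real n)\<^sup>2 + 1"
    have pos: "0 < D"
      by (simp add: D_def add_nonneg_pos)
    define \<epsilon> where "\<epsilon> = e / D"
    have "\<epsilon> * D = e"
      using pos by (simp add: \<epsilon>_def)
    then have "2 * ((real n)\<^sup>2 * \<epsilon>) + \<epsilon> = e"
      by (simp add: D_def algebra_simps)
    moreover have "0 < \<epsilon>"
      using e pos by (simp add: \<epsilon>_def)
    ultimately have \<epsilon>: "0 < \<epsilon>" "2 * ((real n)\<^sup>2 * \<epsilon>) + \<epsilon> = e"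
      by auto
    obtain d f0 g0 where fg: "\<And>k j l. k > d \<Longrightarrow> f0 k j l = 0" "\<And>k j l. k > d \<Longrightarrow> g0 k j l = 0" "f0 0 = g0 0"
      and approx: "\<And>j l p. j < n \<Longrightarrow> l < n \<Longrightarrow> p \<in> V \<union> bdV \<Longrightarrow>
        cmod (F j l p - pair_poly d (\<lambda>k. f0 k j l) (\<lambda>k. g0 k j l) p) \<le> \<epsilon>"
      using A_V_matrix_approx[of n F, OF F \<epsilon>(1)] by blast
    \<comment> \<open>The last summand makes the quotient \<open>\<kappa>\<close> strictly less than 1.\<close>
    define R where "R = M + (real n)\<^sup>2 * \<epsilon> + \<epsilon>"
    have R: "0 < R"
      using M0 \<epsilon> by (simp add: R_def add_nonneg_pos)
    define \<kappa> where "\<kappa> = (M + (real n)\<^sup>2 * \<epsilon>) / R"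
    have \<kappa>: "0 < \<kappa>" "\<kappa> < 1"
      using M0 \<epsilon> n R by (auto simp: \<kappa>_def R_def intro!: divide_pos_pos add_nonneg_pos)
    define f where "f k j l = complex_of_real (1 / R) * f0 k j l" for k j l
    define g where "g k j l = complex_of_real (1 / R) * g0 k j l" for k j l
    define P where "P j l = pair_poly d (\<lambda>k. f k j l) (\<lambda>k. g k j l)" for j l
    have P: "of_real R * P j l p = pair_poly d (\<lambda>k. f0 k j l) (\<lambda>k. g0 k j l) p" for j l p
      unfolding P_def f_def g_def pair_poly_scale using R by simp
    have small: "cmod (F j l p + of_real (- R) * P j l p) \<le> \<epsilon>" if "j < n" "l < n" "p \<in> V \<union> bdV" for j l p
      using approx[OF that] by (simp flip: P)
    have contr: "contraction_by \<kappa> n (\<lambda>j l. P j l p)" if p: "p \<in> V" for p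
      unfolding contraction_by_def
    proof
      fix u :: "nat \<Rightarrow> complex"
      let ?u = "L2_set (\<lambda>l. cmod (u l)) {..<n}"
      have "R * L2_set (\<lambda>j. cmod (\<Sum>l<n. P j l p * u l)) {..<n} = L2_set (\<lambda>j. cmod (\<Sum>l<n. of_real R * P j l p * u l)) {..<n}"
        using R by (subst L2_set_right_distrib) (auto simp: mult.assoc norm_mult simp flip: sum_distrib_left)
      also have "\<dots> \<le> L2_set (\<lambda>j. cmod (\<Sum>l<n. F j l p * u l) + cmod (\<Sum>l<n. (F j l p + of_real (- R) * P j l p) * u l)) {..<n}"
      proof (intro L2_set_mono)
        fix j
        have "(\<Sum>l<n. of_real R * P j l p * u l) = (\<Sum>l<n. F j l p * u l) - (\<Sum>l<n. (F j l p + of_real (- R) * P j l p) * u l)"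
          unfolding sum_subtractf[symmetric] by (intro sum.cong refl) (simp add: algebra_simps)
        then show "cmod (\<Sum>l<n. of_real R * P j l p * u l) \<le> cmod (\<Sum>l<n. F j l p * u l) + cmod (\<Sum>l<n. (F j l p + of_real (- R) * P j l p) * u l)"
          by (simp only: norm_triangle_ineq4)
      qed auto
      also have "\<dots> \<le> L2_set (\<lambda>j. cmod (\<Sum>l<n. F j l p * u l)) {..<n} + L2_set (\<lambda>j. cmod (\<Sum>l<n. (F j l p + of_real (- R) * P j l p) * u l)) {..<n}"
        by (rule L2_set_triangle_ineq)
      also have "\<dots> \<le> M * ?u + (real n)\<^sup>2 * \<epsilon> * ?u"
      proof (rule add_mono[OF FM[OF p] L2_matrix_le])
        show "norm ((F j l p + of_real (- R) * P j l p) * u l) \<le> \<epsilon> * norm (u l)" if "j < n" "l < n" for j l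
          unfolding norm_mult by (intro mult_right_mono small that UnI1 p norm_ge_zero)
      qed (use \<epsilon> in simp)
      also have "\<dots> = R * (\<kappa> * ?u)"
        using R by (simp add: \<kappa>_def distrib_right)
      finally have "L2_set (\<lambda>j. cmod (\<Sum>l<n. P j l p * u l)) {..<n} \<le> \<kappa> * ?u"
        using R by simp
      then have "(L2_set (\<lambda>j. cmod (\<Sum>l<n. P j l p * u l)) {..<n})\<^sup>2 \<le> (\<kappa> * ?u)\<^sup>2"
        by (intro power_mono L2_set_nonneg)
      then show "(\<Sum>j<n. (cmod (\<Sum>l<n. P j l p * u l))\<^sup>2) \<le> \<kappa>\<^sup>2 * (\<Sum>l<n. (cmod (u l))\<^sup>2)"
        by (simp add: L2_set_def power_mult_distrib sum_nonneg)
    qed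
    have fg0: "f 0 = g 0"
      using fg(3) by (simp add: f_def g_def fun_eq_iff)
    have "(\<Sum>j<n. (norm (pair_calculus d f g A B n h j))\<^sup>2) \<le> (\<Sum>l<n. (norm (h l))\<^sup>2)"
    proof (rule pair_calculus_contraction[OF _ _ _ _ _ \<kappa>])
      show "clin A" "clin B"
        unfolding A_def B_def using assms by (simp_all add: hom_clin A_V_axis1 A_V_axis2)
      show "A (B x) = 0" "B (A x) = 0" for x
        unfolding A_def B_def using assms by (simp_all add: axis_product_zero)
      show "norm (A u + scaleC \<omega> (B u)) \<le> norm u" if "cmod \<omega> = 1" for \<omega> u
        unfolding A_def B_def by (rule axis_rotation_contraction[OF assms that])
      show "contraction_by \<kappa> n (matpoly d f z)" if "cmod z < 1" for z
      proof -
        have "matpoly d f z = (\<lambda>j l. P j l (z, z))"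
          by (simp add: matpoly_def P_def pair_poly_diag1 fun_eq_iff)
        then show ?thesis
          using contr[of "(z, z)"] diag_mem_V[OF that, of 1] by simp
      qed
      show "contraction_by \<kappa> n (matpoly d g z)" if "cmod z < 1" for z
      proof -
        have "matpoly d g z = (\<lambda>j l. P j l (z, - z))"
          using fg0 by (simp add: matpoly_def P_def pair_poly_diag2 fun_eq_iff)
        then show ?thesis
          using contr[of "(z, - z)"] diag_mem_V[OF that, of "-1"] by simp
      qed
    qed (use fg fg0 in \<open>auto simp: f_def g_def\<close>)
    then have "L2_set (\<lambda>j. norm (pair_calculus d f g A B n h j)) {..<n} \<le> 1"
      using h unfolding L2_set_def by (meson order_trans real_sqrt_le_mono)
    moreover have "pair_calculus d f g A B n h j = (\<Sum>l<n. blinfun_apply (\<pi> (P j l)) (h l))" for j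
      unfolding pair_calculus_def P_def hom_pair_poly[OF assms(1)] A_def B_def ..
    ultimately have P1: "L2_set (\<lambda>j. norm (\<Sum>l<n. blinfun_apply (\<pi> (P j l)) (h l))) {..<n} \<le> 1"
      by simp
    define E where "E j l = (\<lambda>p. F j l p + of_real (- R) * P j l p)" for j l
    have PV: "P j l \<in> A_V" for j l
      unfolding P_def by (rule pair_poly_A_V)
    have EV: "E j l \<in> A_V" if "j < n" "l < n" for j l
      unfolding E_def by (intro A_V_add A_V_cmult F that PV)
    have split: "blinfun_apply (\<pi> (F j l)) x = R *\<^sub>R blinfun_apply (\<pi> (P j l)) x + blinfun_apply (\<pi> (E j l)) x"
      if "j < n" "l < n" for j l x
      unfolding E_def hom_add[OF assms(1) F[OF that] A_V_cmult[OF PV]] hom_cmult[OF assms(1) PV] scaleR_scaleC[symmetric]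
      by simp
    have "L2_set (\<lambda>j. norm (\<Sum>l<n. blinfun_apply (\<pi> (F j l)) (h l))) {..<n} \<le>
      L2_set (\<lambda>j. R * norm (\<Sum>l<n. blinfun_apply (\<pi> (P j l)) (h l)) + norm (\<Sum>l<n. blinfun_apply (\<pi> (E j l)) (h l))) {..<n}"
    proof (intro L2_set_mono)
      fix j assume j: "j \<in> {..<n}"
      have "(\<Sum>l<n. blinfun_apply (\<pi> (F j l)) (h l)) =
        R *\<^sub>R (\<Sum>l<n. blinfun_apply (\<pi> (P j l)) (h l)) + (\<Sum>l<n. blinfun_apply (\<pi> (E j l)) (h l))"
        using j by (simp add: split sum.distrib scaleR_sum_right)
      then show "norm (\<Sum>l<n. blinfun_apply (\<pi> (F j l)) (h l)) \<le>
        R * norm (\<Sum>l<n. blinfun_apply (\<pi> (P j l)) (h l)) + norm (\<Sum>l<n. blinfun_apply (\<pi> (E j l)) (h l))"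
        using norm_triangle_ineq[of "R *\<^sub>R (\<Sum>l<n. blinfun_apply (\<pi> (P j l)) (h l))"] R by simp
    qed auto
    also have "\<dots> \<le> L2_set (\<lambda>j. R * norm (\<Sum>l<n. blinfun_apply (\<pi> (P j l)) (h l))) {..<n} +
        L2_set (\<lambda>j. norm (\<Sum>l<n. blinfun_apply (\<pi> (E j l)) (h l))) {..<n}"
      by (rule L2_set_triangle_ineq)
    also have "\<dots> \<le> R * 1 + (real n)\<^sup>2 * \<epsilon> * 1"
    proof (rule add_mono)
      show "L2_set (\<lambda>j. R * norm (\<Sum>l<n. blinfun_apply (\<pi> (P j l)) (h l))) {..<n} \<le> R * 1"
        using P1 R by (subst L2_set_right_distrib[symmetric]) (auto intro: mult_left_mono)
      have "L2_set (\<lambda>j. norm (\<Sum>l<n. blinfun_apply (\<pi> (E j l)) (h l))) {..<n} \<le>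
          (real n)\<^sup>2 * \<epsilon> * L2_set (\<lambda>l. norm (h l)) {..<n}"
      proof (rule L2_matrix_le)
        show "norm (blinfun_apply (\<pi> (E j l)) (h l)) \<le> \<epsilon> * norm (h l)" if "j < n" "l < n" for j l
          by (rule norm_hom_apply_le[OF assms(2) EV[OF that]]) (simp only: E_def small that)
      qed (use \<epsilon> in simp)
      also have "\<dots> \<le> (real n)\<^sup>2 * \<epsilon> * 1"
        using h \<epsilon> by (intro mult_left_mono) auto
      finally show "L2_set (\<lambda>j. norm (\<Sum>l<n. blinfun_apply (\<pi> (E j l)) (h l))) {..<n} \<le> (real n)\<^sup>2 * \<epsilon> * 1" .
    qed
    also have "\<dots> = M + (2 * ((real n)\<^sup>2 * \<epsilon>) + \<epsilon>)"
      by (simp add: R_def)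
    also have "\<dots> = M + e"
      by (simp only: \<epsilon>(2))
    finally show "L2_set (\<lambda>j. norm (\<Sum>l<n. blinfun_apply (\<pi> (F j l)) (h l))) {..<n} \<le> M + e" .
  qed
  moreover have "{h :: nat \<Rightarrow> 'h. L2_set (\<lambda>l. norm (h l)) {..<n} \<le> 1} \<noteq> {}"
    by (rule L2_ball_nonempty)
  ultimately have "opmat_norm n (\<lambda>j l. blinfun_apply (\<pi> (F j l))) \<le> M"
    unfolding opmat_norm_def by (intro cSUP_least) auto
  then show "opmat_norm n (\<lambda>j l. blinfun_apply (\<pi> (F j l))) \<le> (SUP p\<in>V. opmat_norm n (\<lambda>j l v. F j l p * v))"
    unfolding M_def .
qed

end
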